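(* Let $\ell$ and $m_1,\ldots,m_\ell$ be positive integers such that $m_i \ge 2$ for $i=1,\ldots,\ell$. Let $s=m_1+\ldots+m_\ell$ and let $t$ be an integer with $t>s$. Let $a$ be the number of odd integers in the multiset $\{\!\{m_1,\ldots,m_\ell\}\!\}$ and assume $a \le 2\lfloor t/2\rfloor - s$. If $\mathrm{OP}^\ast(m_1,\ldots,m_\ell)$ has a solution, then (1) $\mathrm{OP}^\ast(m_1,\ldots,m_\ell,t)$ has a solution; and (2) if $t$ is even, $\mathrm{OP}^\ast(m_1,\ldots,m_\ell,2^{\langle t/2\rangle})$ has a solution.
   Context: $K_n^\ast$ denotes the complete symmetric digraph of order $n$. For integers $m_1,\ldots,m_k \ge 2$ with $n=m_1+\ldots+m_k$, $\mathrm{OP}^\ast(m_1,\ldots,m_k)$ asks for a decomposition of $K_n^\ast$ into spanning subdigraphs, each a disjoint union of $k$ directed cycles of lengths $m_1,\ldots,m_k$; such a decomposition is a solution. The notation $2^{\langle r\rangle}$ in a list of cycle lengths denotes $r$ copies of $2$. *)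

theory Defs
  imports
    "Graph_Theory.Digraph_Component"
    "Graph_Theory.Kuratowski"
    "HOL-Library.Disjoint_Sets"
begin

definition complete_symmetric_digraph :: "nat \<Rightarrow> nat pair_pre_digraph" where
  "complete_symmetric_digraph n =
     \<lparr> pverts = {..<n}, parcs = {(u, v). u < n \<and> v < n \<and> u \<noteq> v} \<rparr>"

lemma complete_symmetric_digraph: "complete_digraph n (with_proj (complete_symmetric_digraph n))"
  unfolding complete_digraph_pair_def by (auto simp: complete_symmetric_digraph_def)

text \<open>
  \<open>pre_digraph.cycle\<close> is a predicate on closed arc walks; \<open>directed_cycle C m\<close> says that
  the digraph \<open>C\<close> consists of exactly the vertices and arcs of such a walk of length \<open>m\<close>.
  For \<open>m = 2\<close> this is the digraph formed by two opposite arcs.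
\<close>
definition directed_cycle :: "'a pair_pre_digraph \<Rightarrow> nat \<Rightarrow> bool" where
  "directed_cycle C m \<longleftrightarrow>
     (\<exists>p. pre_digraph.cycle (with_proj C) p \<and> length p = m \<and>
          parcs C = set p \<and> pverts C = fst ` set p)"

definition disjoint_union_of_cycles :: "'a pair_pre_digraph \<Rightarrow> nat list \<Rightarrow> bool" where
  "disjoint_union_of_cycles H ms \<longleftrightarrow>
     (\<exists>Cs. list_all2 directed_cycle Cs ms \<and>
           disjoint_family_on (\<lambda>i. pverts (Cs ! i)) {..<length Cs} \<and>
           pverts H = (\<Union>C\<in>set Cs. pverts C) \<and>
           parcs H = (\<Union>C\<in>set Cs. parcs C))"

definition digraph_decomposition :: "'a pair_pre_digraph set \<Rightarrow> 'a pair_pre_digraph \<Rightarrow> bool" where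
  "digraph_decomposition \<D> G \<longleftrightarrow>
     (\<forall>H\<in>\<D>. subgraph (with_proj H) (with_proj G)) \<and>
     disjoint_family_on parcs \<D> \<and> (\<Union>H\<in>\<D>. parcs H) = parcs G"

definition OP_star_solution :: "nat list \<Rightarrow> nat pair_pre_digraph set \<Rightarrow> bool" where
  "OP_star_solution ms \<D> \<longleftrightarrow>
     digraph_decomposition \<D> (complete_symmetric_digraph (sum_list ms)) \<and>
     (\<forall>H\<in>\<D>. spanning (with_proj H) (with_proj (complete_symmetric_digraph (sum_list ms))) \<and>
             disjoint_union_of_cycles H ms)"

definition OP_star_has_solution :: "nat list \<Rightarrow> bool" where
  "OP_star_has_solution ms \<longleftrightarrow> (\<exists>\<D>. OP_star_solution ms \<D>)"

end

(*
  Number the vertices so that the given solution on s vertices lives on {..<s}, and identify the t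
  new vertices s + i with the residues i modulo t. Let C be a factor of the required type on s + t
  vertices in which every old vertex has its successor and its predecessor among the new ones. The
  t rotations of C under i -> i + 1 cover all arcs between old and new vertices and those arcs
  between new vertices whose difference occurs in C. By counting, at least s - 1 nonzero
  differences do not occur; if exactly s - 1 are missing, each of the s - 1 factors of the given
  solution is completed by a factor of the circulant digraph with the missing differences.

  To leave a set of differences that can be handled, C contains on the new vertices zigzag paths of
  strictly decreasing differences, which avoid the differences near 0, together with a single arcs
  whose differences lie near t/2; the cycles of C of odd length need one such arc each. The missing
  differences are then the nonzero ones between -p and p, and one more if s is even. For even t
  and s the difference t/2 needs care: the zigzags are joined at it, or it replaces another
  difference that is a unit modulo t. Only for s = t - 2 with t/2 odd does this fail; there the
  differences that occur are t/2 - 1 and t/2 + 1.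

  That the circulant with connection set {-p, ..., p} minus 0 decomposes into directed Hamiltonian
  cycles follows by pairing the differences: the 4-regular circulant for a generating pair a, b is
  a twisted torus grid, whose edges are coloured by two Hamiltonian cycles by inserting pairs of
  rows into a small grid. For the second claim such a circulant is decomposed into perfect
  matchings, via bipartiteness or a 3-edge-colouring of a prism.
*)
theory Submission
  imports Defs
begin

section \<open>Cycle factors\<close>

text \<open>The count behind the differences: \<open>C\<close> has \<open>s + t\<close> arcs,
  \<open>2 * s\<close> of them join old and new vertices, so \<open>t - s\<close> arcs remain among
  the new ones and at most \<open>t - s\<close> of the \<open>t - 1\<close> nonzero differences
  occur. Exactly \<open>s - 1\<close> may be missing, so every construction must give its inner arcs
  pairwise distinct differences, without any slack. Old vertices separate the paths that
  \<open>C\<close> induces on the new vertices, so the number of these paths, isolated vertices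
  included, is \<open>s\<close>; this limits how many long paths can be used and forces the small
  cases to join zigzags. Since \<open>s + a\<close> is even, the bound on \<open>a\<close> just says
  \<open>a \<le> t - s\<close>: there is an inner arc for every odd cycle.

  For even \<open>s\<close> the missing differences are a symmetric block and one more, which has to
  supply a factor by itself. In the second claim \<open>t / 2\<close> is welcome, because adding it
  is a perfect matching.\<close>

definition cyc_arcs :: "'a list \<Rightarrow> ('a \<times> 'a) set" where
  "cyc_arcs xs = set (zip xs (rotate1 xs))"

definition factor :: "nat list \<Rightarrow> 'a set \<Rightarrow> ('a \<times> 'a) set \<Rightarrow> bool" where
  "factor ms V C \<longleftrightarrow>
     (\<exists>css. map length css = ms \<and> distinct (concat css) \<and> set (concat css) = V \<and>
            C = (\<Union>xs\<in>set css. cyc_arcs xs))"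

text \<open>Only inclusion is demanded: overlaps and arcs outside \<open>A\<close> are tolerated, so
  covers combine by union and restrict to subsets. Disjointness is recovered by one count at the
  end.\<close>

definition covers :: "nat list \<Rightarrow> 'a set \<Rightarrow> nat \<Rightarrow> ('a \<times> 'a) set \<Rightarrow> bool" where
  "covers ms V k A \<longleftrightarrow> (\<exists>C. (\<forall>i<k. factor ms V (C i)) \<and> A \<subseteq> (\<Union>i<k. C i))"

definition all_arcs :: "'a set \<Rightarrow> ('a \<times> 'a) set" where
  "all_arcs V = {(u, v). u \<in> V \<and> v \<in> V \<and> u \<noteq> v}"

lemma cyc_arcs_conv: "cyc_arcs xs = (\<lambda>i. (xs ! i, xs ! (Suc i mod length xs))) ` {..<length xs}"
proof -
  have "cyc_arcs xs = {(xs ! i, rotate1 xs ! i) | i. i < length xs}"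
    by (auto simp: cyc_arcs_def set_zip)
  then show ?thesis by (auto simp: nth_rotate1)
qed

lemma card_cyc_arcs: "card (cyc_arcs xs) \<le> length xs"
  unfolding cyc_arcs_conv using card_image_le[OF finite_lessThan[of "length xs"]] by simp

lemma finite_cyc_arcs [simp]: "finite (cyc_arcs xs)"
  by (simp add: cyc_arcs_def)

lemma fst_cyc_arcs: "fst ` cyc_arcs xs = set xs"
  unfolding cyc_arcs_def by (simp flip: set_map)

lemma snd_cyc_arcs: "snd ` cyc_arcs xs = set xs"
  unfolding cyc_arcs_def by (simp flip: set_map)

lemma cyc_arcs_map: "cyc_arcs (map f xs) = map_prod f f ` cyc_arcs xs"
  unfolding cyc_arcs_def by (simp flip: set_map add: zip_map_map rotate1_map map_prod_def split_def)

lemma cyc_arcs_subset: "cyc_arcs xs \<subseteq> set xs \<times> set xs"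
  using fst_cyc_arcs[of xs] snd_cyc_arcs[of xs] by (fastforce simp: image_iff)

lemma cyc_arcs_loopfree:
  assumes "distinct xs" "length xs \<ge> 2" "(u, v) \<in> cyc_arcs xs"
  shows "u \<noteq> v"
proof -
  obtain i where i: "i < length xs" "u = xs ! i" "v = xs ! (Suc i mod length xs)"
    using assms(3) by (auto simp: cyc_arcs_conv)
  have "Suc i mod length xs \<noteq> i"
    using i(1) assms(2) by (cases "Suc i = length xs") auto
  then show ?thesis
    using i assms(1,2) nth_eq_iff_index_eq[of xs i "Suc i mod length xs"]
    by (metis mod_less_divisor not_less_zero neq0_conv)
qed

lemma pcas_iff:
  "p \<noteq> [] \<Longrightarrow> pcas u p v \<longleftrightarrow> fst (hd p) = u \<and> map snd p = tl (map fst p) @ [v]"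
proof (induction p arbitrary: u)
  case (Cons e es)
  show ?case
    by (cases "es = []") (auto simp: Cons.IH hd_map neq_Nil_conv)
qed simp

lemma tl_pawalk_verts: "pcas u p v \<Longrightarrow> tl (pawalk_verts u p) = map snd p"
proof (induction p arbitrary: u)
  case (Cons e es)
  then show ?case by (cases es) auto
qed simp

lemma pcas_closed_iff:
  assumes "p \<noteq> []"
  shows "pcas u p u \<longleftrightarrow> u = fst (hd p) \<and> map snd p = rotate1 (map fst p)"
  unfolding pcas_iff[OF assms] using assms by (cases p) auto

text \<open>A closed arc walk is determined by its list of tails: closedness says that the list of
  heads is the rotation of that list by one, which is the shape of \<open>cyc_arcs\<close>.\<close>

lemma directed_cycle_iff:
  assumes "m > 0"
  shows "directed_cycle C m \<longleftrightarrow>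
    (\<exists>xs. distinct xs \<and> length xs = m \<and> pverts C = set xs \<and> parcs C = cyc_arcs xs)"
proof
  assume "directed_cycle C m"
  then obtain p u where p: "pre_digraph.awalk (with_proj C) u p u" "p \<noteq> []" "length p = m"
    "distinct (tl (pre_digraph.awalk_verts (with_proj C) u p))" "parcs C = set p" "pverts C = fst ` set p"
    by (auto simp: directed_cycle_def pre_digraph.cycle_def)
  then have c: "pcas u p u" "distinct (tl (pawalk_verts u p))"
    by (auto simp: pre_digraph.awalk_def cas_with_proj_eq awalk_verts_with_proj_eq)
  have r: "map snd p = rotate1 (map fst p)"
    using c(1) unfolding pcas_closed_iff[OF p(2)] by simp
  have "p = zip (map fst p) (map snd p)"
    by (rule zip_map_fst_snd[symmetric])
  then have "set p = cyc_arcs (map fst p)"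
    unfolding r cyc_arcs_def by metis
  moreover have "distinct (map fst p)"
    using c(2) unfolding tl_pawalk_verts[OF c(1)] r by simp
  ultimately show "\<exists>xs. distinct xs \<and> length xs = m \<and> pverts C = set xs \<and> parcs C = cyc_arcs xs"
    using p(3,5,6) by (intro exI[of _ "map fst p"]) simp
next
  assume "\<exists>xs. distinct xs \<and> length xs = m \<and> pverts C = set xs \<and> parcs C = cyc_arcs xs"
  then obtain xs where xs: "distinct xs" "length xs = m" "pverts C = set xs" "parcs C = cyc_arcs xs"
    by blast
  define p where "p = zip xs (rotate1 xs)"
  have ne: "p \<noteq> []" "xs \<noteq> []" using xs assms by (auto simp: p_def zip_eq_Nil_iff)
  have m: "map fst p = xs" "map snd p = rotate1 xs" by (auto simp: p_def)
  define u where "u = hd xs"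
  have c: "pcas u p u"
    unfolding pcas_closed_iff[OF ne(1), of u] m using hd_map[OF ne(1), of fst] by (simp add: m u_def)
  have "set p = parcs C" by (simp add: p_def xs cyc_arcs_def)
  moreover have "u \<in> pverts C" using ne xs by (simp add: u_def)
  ultimately have "pre_digraph.cycle (with_proj C) p"
    unfolding pre_digraph.cycle_def pre_digraph.awalk_def
    using c ne(1) xs(1) unfolding cas_with_proj_eq awalk_verts_with_proj_eq
    by (intro exI[of _ u]) (simp add: tl_pawalk_verts[OF c] m)
  moreover have "length p = m" using xs by (simp add: p_def)
  moreover have "pverts C = fst ` set p" unfolding xs(3) m(1)[symmetric] by simp
  ultimately show "directed_cycle C m"
    unfolding directed_cycle_def using \<open>set p = parcs C\<close> by blast
qed

lemma distinct_concat_disjoint: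
  assumes "distinct (concat css)" "i < length css" "j < length css" "i \<noteq> j"
  shows "set (css ! i) \<inter> set (css ! j) = {}"
  using assms
proof (induction css arbitrary: i j)
  case (Cons a css)
  have sub: "set (css ! l) \<subseteq> set (concat css)" if "l < length css" for l
    using that by (auto intro!: bexI[of _ "css ! l"])
  have dis: "set a \<inter> set (concat css) = {}" "distinct (concat css)" using Cons.prems(1) by auto
  show ?case
  proof (cases "i = 0 \<or> j = 0")
    case True
    then show ?thesis
      using sub[of "i - 1"] sub[of "j - 1"] dis(1) Cons.prems(2-4) by (cases i; cases j) auto
  next
    case False
    then show ?thesis
      using Cons.IH[OF dis(2), of "i - 1" "j - 1"] Cons.prems(2-4) by (cases i; cases j) auto
  qed
qed simp

lemma distinct_concatI:
  assumes "\<And>i. i < length css \<Longrightarrow> distinct (css ! i)"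
    and "\<And>i j. i < j \<Longrightarrow> j < length css \<Longrightarrow> set (css ! i) \<inter> set (css ! j) = {}"
  shows "distinct (concat css)"
  using assms
proof (induction css)
  case (Cons a css)
  have "distinct (concat css)"
    using Cons.prems(1)[of "Suc _"] Cons.prems(2)[of "Suc _" "Suc _"]
    by (intro Cons.IH) auto
  moreover have "set a \<inter> set xs = {}" if "xs \<in> set css" for xs
    using Cons.prems(2)[of 0 "Suc _"] that by (fastforce simp: in_set_conv_nth)
  ultimately show ?case using Cons.prems(1)[of 0] by auto
qed simp

lemma disjoint_union_of_cycles_iff:
  assumes "\<forall>m\<in>set ms. m > 0"
  shows "disjoint_union_of_cycles H ms \<longleftrightarrow> factor ms (pverts H) (parcs H)"
proof
  assume "disjoint_union_of_cycles H ms"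
  then obtain Cs where Cs: "list_all2 directed_cycle Cs ms"
    "disjoint_family_on (\<lambda>i. pverts (Cs ! i)) {..<length Cs}"
    "pverts H = (\<Union>C\<in>set Cs. pverts C)" "parcs H = (\<Union>C\<in>set Cs. parcs C)"
    by (auto simp: disjoint_union_of_cycles_def)
  have len: "length Cs = length ms" using Cs(1) list_all2_lengthD by blast
  have "\<exists>xs. distinct xs \<and> length xs = ms ! i \<and> pverts (Cs ! i) = set xs \<and> parcs (Cs ! i) = cyc_arcs xs"
    if "i < length ms" for i
    using list_all2_nthD2[OF Cs(1) that] assms that by (simp add: directed_cycle_iff)
  then obtain f where f: "\<And>i. i < length ms \<Longrightarrow> distinct (f i) \<and> length (f i) = ms ! i \<and>
      pverts (Cs ! i) = set (f i) \<and> parcs (Cs ! i) = cyc_arcs (f i)" by metis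
  define css where "css = map f [0..<length ms]"
  have sets: "set css = f ` {..<length ms}" "set Cs = (!) Cs ` {..<length ms}"
    using len by (auto simp: css_def in_set_conv_nth image_iff)
  have "map length css = ms" using f by (intro nth_equalityI) (auto simp: css_def)
  moreover have "distinct (concat css)"
  proof (rule distinct_concatI)
    fix i j assume "i < j" "j < length css"
    then show "set (css ! i) \<inter> set (css ! j) = {}"
      using disjoint_family_onD[OF Cs(2), of i j] f len by (auto simp: css_def)
  qed (use f in \<open>auto simp: css_def\<close>)
  moreover have "set (concat css) = pverts H"
    unfolding Cs(3) set_concat sets using f by simp
  moreover have "parcs H = (\<Union>xs\<in>set css. cyc_arcs xs)"
    unfolding Cs(4) sets using f by simp
  ultimately show "factor ms (pverts H) (parcs H)" unfolding factor_def by blast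
next
  assume "factor ms (pverts H) (parcs H)"
  then obtain css where css: "map length css = ms" "distinct (concat css)"
    "set (concat css) = pverts H" "parcs H = (\<Union>xs\<in>set css. cyc_arcs xs)"
    unfolding factor_def by blast
  define Cs where "Cs = map (\<lambda>xs. \<lparr> pverts = set xs, parcs = cyc_arcs xs \<rparr>) css"
  have "list_all2 directed_cycle Cs ms"
    unfolding list_all2_conv_all_nth
  proof (intro conjI allI impI)
    show "length Cs = length ms" using css(1) by (auto simp: Cs_def)
    fix i assume i: "i < length Cs"
    have "distinct (css ! i)" using css(2) i by (auto simp: Cs_def distinct_concat_iff)
    moreover have "length (css ! i) = ms ! i" "i < length ms" using css(1) i by (auto simp: Cs_def)
    ultimately show "directed_cycle (Cs ! i) (ms ! i)"
      using assms i by (subst directed_cycle_iff) (auto simp: Cs_def intro!: exI[of _ "css ! i"])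
  qed
  moreover have "disjoint_family_on (\<lambda>i. pverts (Cs ! i)) {..<length Cs}"
    using distinct_concat_disjoint[OF css(2)] by (auto simp: disjoint_family_on_def Cs_def)
  ultimately show "disjoint_union_of_cycles H ms"
    unfolding disjoint_union_of_cycles_def using css(3,4)
    by (intro exI[of _ Cs]) (auto simp: Cs_def)
qed

lemma factor_card:
  assumes "factor ms V C"
  shows "finite C" "card C \<le> sum_list ms" "card V = sum_list ms"
proof -
  obtain css where css: "map length css = ms" "distinct (concat css)"
    "set (concat css) = V" "C = (\<Union>xs\<in>set css. cyc_arcs xs)"
    using assms unfolding factor_def by blast
  show "finite C" by (simp add: css)
  have "card (\<Union>xs\<in>set css. cyc_arcs xs) \<le> sum_list (map length css)"
  proof (induction css)
    case (Cons a css)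
    have "card (\<Union>xs\<in>set (a # css). cyc_arcs xs) \<le> card (cyc_arcs a) + card (\<Union>xs\<in>set css. cyc_arcs xs)"
      by (simp add: card_Un_le)
    then show ?case using Cons card_cyc_arcs[of a] by simp
  qed simp
  then show "card C \<le> sum_list ms" by (simp add: css)
  show "card V = sum_list ms"
    using css by (metis distinct_card length_concat)
qed

lemma factor_subset: "factor ms V C \<Longrightarrow> C \<subseteq> V \<times> V"
proof -
  assume "factor ms V C"
  then obtain css where "set (concat css) = V" "C = (\<Union>xs\<in>set css. cyc_arcs xs)"
    unfolding factor_def by blast
  then show ?thesis using cyc_arcs_subset by fastforce
qed

lemma fst_factor: "factor ms V C \<Longrightarrow> fst ` C = V"
proof -
  assume "factor ms V C"
  then obtain css where "set (concat css) = V" "C = (\<Union>xs\<in>set css. cyc_arcs xs)"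
    unfolding factor_def by blast
  then show ?thesis by (simp add: image_UN fst_cyc_arcs)
qed

lemma factor_loopfree:
  assumes "factor ms V C" "\<forall>m\<in>set ms. m \<ge> 2"
  shows "C \<subseteq> all_arcs V"
proof -
  obtain css where css: "map length css = ms" "distinct (concat css)"
    "set (concat css) = V" "C = (\<Union>xs\<in>set css. cyc_arcs xs)"
    using assms unfolding factor_def by blast
  have "u \<noteq> v" if "(u, v) \<in> C" for u v
  proof -
    obtain xs where xs: "xs \<in> set css" "(u, v) \<in> cyc_arcs xs" using \<open>(u, v) \<in> C\<close> css(4) by blast
    then have "distinct xs" "length xs \<ge> 2"
      using css(1,2) assms(2) by (auto simp: distinct_concat_iff)
    then show ?thesis by (rule cyc_arcs_loopfree[OF _ _ xs(2)])
  qed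
  then show ?thesis using factor_subset[OF assms(1)] by (auto simp: all_arcs_def)
qed

lemma factor_image:
  assumes "factor ms V C" "inj_on f V"
  shows "factor ms (f ` V) (map_prod f f ` C)"
proof -
  obtain css where css: "map length css = ms" "distinct (concat css)"
    "set (concat css) = V" "C = (\<Union>xs\<in>set css. cyc_arcs xs)"
    using assms unfolding factor_def by blast
  have "map length (map (map f) css) = ms" using css(1) by auto
  moreover have "distinct (concat (map (map f) css))"
    using css(2,3) assms(2) by (simp add: distinct_map flip: map_concat)
  moreover have "set (concat (map (map f) css)) = f ` V"
    using css(3) by (metis list.set_map map_concat)
  moreover have "map_prod f f ` C = (\<Union>xs\<in>set (map (map f) css). cyc_arcs xs)"
    by (simp add: css(4) cyc_arcs_map image_UN)
  ultimately show ?thesis unfolding factor_def by blast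
qed

lemma factor_append:
  assumes "factor ms V C" "factor ns W D" "V \<inter> W = {}"
  shows "factor (ms @ ns) (V \<union> W) (C \<union> D)"
proof -
  obtain css dss where "map length css = ms" "distinct (concat css)"
    "set (concat css) = V" "C = (\<Union>xs\<in>set css. cyc_arcs xs)"
    "map length dss = ns" "distinct (concat dss)"
    "set (concat dss) = W" "D = (\<Union>xs\<in>set dss. cyc_arcs xs)"
    using assms unfolding factor_def by metis
  then show ?thesis
    unfolding factor_def using assms(3) by (intro exI[of _ "css @ dss"]) auto
qed

lemma covers_mono: "covers ms V k A \<Longrightarrow> B \<subseteq> A \<Longrightarrow> covers ms V k B"
  unfolding covers_def by blast

lemma covers_0 [simp]: "covers ms V 0 {}"
  unfolding covers_def by simp

lemma covers_1: "factor ms V C \<Longrightarrow> A \<subseteq> C \<Longrightarrow> covers ms V 1 A"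
  unfolding covers_def by (intro exI[of _ "\<lambda>_. C"]) auto

lemma covers_Un:
  assumes "covers ms V k A" "covers ms V l B"
  shows "covers ms V (k + l) (A \<union> B)"
proof -
  obtain C D where C: "\<forall>i<k. factor ms V (C i)" "A \<subseteq> (\<Union>i<k. C i)"
    and D: "\<forall>i<l. factor ms V (D i)" "B \<subseteq> (\<Union>i<l. D i)"
    using assms unfolding covers_def by metis
  define E where "E i = (if i < k then C i else D (i - k))" for i
  have "factor ms V (E i)" if "i < k + l" for i
    using that C(1) D(1) by (auto simp: E_def)
  have "C i \<subseteq> (\<Union>i<k+l. E i)" if "i < k" for i
    using that by (auto simp: E_def intro!: bexI[of _ i])
  moreover have "D i \<subseteq> (\<Union>i<k+l. E i)" if "i < l" for i
    using that by (intro UN_upper[of "i + k", THEN order_trans[rotated]]) (auto simp: E_def)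
  ultimately have "A \<union> B \<subseteq> (\<Union>i<k+l. E i)"
    using C(2) D(2) by (intro Un_least order_trans[OF C(2)] order_trans[OF D(2)] UN_least) auto
  with \<open>\<And>i. i < k + l \<Longrightarrow> factor ms V (E i)\<close> show ?thesis
    unfolding covers_def by (intro exI[of _ E]) simp
qed

lemma covers_UN:
  fixes n :: nat
  assumes "\<And>i. i < n \<Longrightarrow> covers ms V (k i) (A i)"
  shows "covers ms V (\<Sum>i<n. k i) (\<Union>i<n. A i)"
  using assms
proof (induction n)
  case (Suc n)
  then have "covers ms V ((\<Sum>i<n. k i) + k n) ((\<Union>i<n. A i) \<union> A n)"
    by (intro covers_Un) auto
  then show ?case by (simp add: lessThan_Suc Un_commute add.commute)
qed simp

lemma covers_image:
  assumes "covers ms V k A" "inj_on f V"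
  shows "covers ms (f ` V) k (map_prod f f ` A)"
proof -
  obtain C where C: "\<forall>i<k. factor ms V (C i)" "A \<subseteq> (\<Union>i<k. C i)"
    using assms unfolding covers_def by metis
  have "map_prod f f ` A \<subseteq> (\<Union>i<k. map_prod f f ` C i)" using C(2) by fastforce
  then show ?thesis
    unfolding covers_def using factor_image[OF _ assms(2)] C(1)
    by (intro exI[of _ "\<lambda>i. map_prod f f ` C i"]) blast
qed

section \<open>Solutions as covers of all arcs\<close>

lemma finite_all_arcs: "finite V \<Longrightarrow> finite (all_arcs V)"
  by (rule finite_subset[of _ "V \<times> V"]) (auto simp: all_arcs_def)

lemma card_all_arcs:
  assumes "finite V"
  shows "card (all_arcs V) = card V * (card V - 1)"
proof -
  have "all_arcs V = (SIGMA u:V. V - {u})" by (auto simp: all_arcs_def)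
  then have "card (all_arcs V) = (\<Sum>u\<in>V. card (V - {u}))"
    using assms by (simp add: card_SigmaI)
  then show ?thesis using assms by simp
qed

lemma parcs_complete: "parcs (complete_symmetric_digraph n) = all_arcs {..<n}"
  by (auto simp: complete_symmetric_digraph_def all_arcs_def)

lemma pverts_complete: "pverts (complete_symmetric_digraph n) = {..<n}"
  by (simp add: complete_symmetric_digraph_def)

lemma wf_with_proj: "parcs H \<subseteq> pverts H \<times> pverts H \<Longrightarrow> wf_digraph (with_proj H)"
  by unfold_locales auto

text \<open>Every vertex is a tail in each factor, so a factor has at least \<open>s\<close> arcs,
  and disjointness leaves room for at most \<open>s - 1\<close> factors.\<close>

lemma OP_star_has_solution_imp_covers:
  assumes "OP_star_has_solution ms" "\<forall>m\<in>set ms. m \<ge> 2" "ms \<noteq> []" "s = sum_list ms"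
  shows "covers ms {..<s} (s - 1) (all_arcs {..<s})"
proof -
  let ?K = "complete_symmetric_digraph s"
  obtain \<D> where D: "digraph_decomposition \<D> ?K"
    "\<And>H. H \<in> \<D> \<Longrightarrow> spanning (with_proj H) (with_proj ?K) \<and> disjoint_union_of_cycles H ms"
    using assms(1,4) unfolding OP_star_has_solution_def OP_star_solution_def by blast
  have V: "pverts H = {..<s}" if "H \<in> \<D>" for H
    using D(2)[OF that] by (simp add: spanning_def pverts_complete)
  have pos: "\<forall>m\<in>set ms. m > 0" using assms(2) by fastforce
  have F: "factor ms {..<s} (parcs H)" if "H \<in> \<D>" for H
    using D(2)[OF that] disjoint_union_of_cycles_iff[OF pos, of H] V[OF that] by simp
  have dis: "disjoint_family_on parcs \<D>" and U: "(\<Union>H\<in>\<D>. parcs H) = all_arcs {..<s}"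
    using D(1) by (auto simp: digraph_decomposition_def parcs_complete)
  have spos: "s > 0"
    using assms(2-4) by (cases ms) auto
  have cs: "card (parcs H) \<ge> s" if "H \<in> \<D>" for H
    using card_image_le[OF factor_card(1)[OF F[OF that]], of fst] fst_factor[OF F[OF that]] by simp
  have inj: "inj_on parcs \<D>"
  proof (rule inj_onI)
    fix H H' assume "H \<in> \<D>" "H' \<in> \<D>" "parcs H = parcs H'"
    then show "H = H'"
      using dis cs[of H] spos by (fastforce simp: disjoint_family_on_def)
  qed
  have "finite (parcs ` \<D>)"
  proof (rule finite_subset)
    show "parcs ` \<D> \<subseteq> Pow (all_arcs {..<s})" using U by blast
  qed (simp add: finite_all_arcs)
  then have fin: "finite \<D>" using inj finite_imageD by blast
  have "card \<D> * s \<le> (\<Sum>H\<in>\<D>. card (parcs H))"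
    using sum_bounded_below[of \<D> s "\<lambda>H. card (parcs H)"] cs by simp
  also have "\<dots> = card (\<Union>H\<in>\<D>. parcs H)"
    using fin factor_card(1)[OF F] dis
    by (subst card_UN_disjoint) (auto simp: disjoint_family_on_def)
  also have "\<dots> = (s - 1) * s" by (simp add: U card_all_arcs)
  finally have le: "card \<D> \<le> s - 1" using spos by simp
  show ?thesis
  proof (cases "\<D> = {}")
    case True
    then have "all_arcs {..<s} = {}" using U by simp
    moreover have "s \<ge> 2" using assms(2-4) by (cases ms) auto
    then have "(0, 1) \<in> all_arcs {..<s}" by (simp add: all_arcs_def)
    ultimately show ?thesis by blast
  next
    case False
    then obtain H0 where H0: "H0 \<in> \<D>" by blast
    obtain f where f: "bij_betw f {..<card \<D>} \<D>"
      using fin bij_betw_from_nat_into_finite atLeast0LessThan ex_bij_betw_nat_finite by metis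
    \<comment> \<open>Indices beyond the number of factors are filled by repeating
      \<open>H0\<close>.\<close>
    define C where "C i = parcs (if i < card \<D> then f i else H0)" for i
    have "factor ms {..<s} (C i)" for i
      using F H0 f by (auto simp: C_def bij_betw_def)
    moreover have "all_arcs {..<s} \<subseteq> (\<Union>i<s-1. C i)"
    proof
      fix e assume "e \<in> all_arcs {..<s}"
      then obtain H where "H \<in> \<D>" "e \<in> parcs H" using U by blast
      moreover then obtain i where "i < card \<D>" "f i = H" using f by (force simp: bij_betw_def)
      ultimately show "e \<in> (\<Union>i<s-1. C i)" using le by (auto simp: C_def intro!: bexI[of _ i])
    qed
    ultimately show ?thesis unfolding covers_def by blast
  qed
qed

text \<open>An element common to two of the sets would be counted twice, and the union of
  \<open>k\<close> sets of size at most \<open>n\<close> could not reach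
  \<open>n * k\<close>.\<close>

lemma tight_cover_disjoint:
  fixes C :: "nat \<Rightarrow> 'a set"
  assumes "\<And>i. i < k \<Longrightarrow> finite (C i)" "\<And>i. i < k \<Longrightarrow> card (C i) \<le> n"
    "card (\<Union>i<k. C i) \<ge> n * k" "i < k" "j < k" "i \<noteq> j"
  shows "C i \<inter> C j = {}"
proof (rule ccontr)
  assume ne: "C i \<inter> C j \<noteq> {}"
  let ?I = "{..<k} - {i, j}"
  have I: "{..<k} = {i, j} \<union> ?I" "card ?I = k - 2" using assms(4-6) by auto
  have k2: "k \<ge> 2" using assms(4-6) by auto
  have "(\<Union>i<k. C i) = (C i \<union> C j) \<union> (\<Union>l\<in>?I. C l)"
    using assms(4,5) by blast
  then have "card (\<Union>i<k. C i) \<le> card (C i \<union> C j) + card (\<Union>l\<in>?I. C l)"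
    by (simp add: card_Un_le)
  also have "card (\<Union>l\<in>?I. C l) \<le> (\<Sum>l\<in>?I. card (C l))" by (simp add: card_UN_le)
  also have "\<dots> \<le> card ?I * n" using sum_bounded_above[of ?I "\<lambda>l. card (C l)" n] assms(2) by simp
  also have "card (C i \<union> C j) < card (C i) + card (C j)"
    using card_Un_Int[of "C i" "C j"] ne assms(1,4,5) by (simp add: card_gt_0_iff)
  finally have "card (\<Union>i<k. C i) < n + n + card ?I * n"
    using assms(2)[OF assms(4)] assms(2)[OF assms(5)] by linarith
  moreover have "n + n + card ?I * n = n * k"
    using I(2) k2 by (metis add_mult_distrib le_add_diff_inverse mult.commute mult_2)
  ultimately show False using assms(3) by simp
qed

lemma covers_imp_OP_star_has_solution:
  assumes "\<forall>m\<in>set ms. m \<ge> 2" "n = sum_list ms" "covers ms {..<n} (n - 1) (all_arcs {..<n})"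
  shows "OP_star_has_solution ms"
proof -
  let ?K = "complete_symmetric_digraph n"
  obtain C where C: "\<And>i. i < n - 1 \<Longrightarrow> factor ms {..<n} (C i)" "all_arcs {..<n} \<subseteq> (\<Union>i<n-1. C i)"
    using assms(3) unfolding covers_def by blast
  have sub: "C i \<subseteq> all_arcs {..<n}" if "i < n - 1" for i
    using factor_loopfree[OF C(1)[OF that] assms(1)] .
  have U: "(\<Union>i<n-1. C i) = all_arcs {..<n}" using C(2) sub by blast
  have dis: "C i \<inter> C j = {}" if "i < n - 1" "j < n - 1" "i \<noteq> j" for i j
  proof (rule tight_cover_disjoint[where k = "n - 1" and n = n])
    show "n * (n - 1) \<le> card (\<Union>i<n-1. C i)" by (simp only: U card_all_arcs finite_lessThan card_lessThan)
  qed (use factor_card[OF C(1)] assms(2) that in auto)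
  define H where "H i = \<lparr> pverts = {..<n}, parcs = C i \<rparr>" for i
  define \<D> where "\<D> = H ` {..<n-1}"
  have sp: "spanning (with_proj (H i)) (with_proj ?K)" if "i < n - 1" for i
    unfolding spanning_def subgraph_def
    using sub[OF that]
    by (auto simp: H_def pverts_complete parcs_complete compatible_def all_arcs_def intro!: wf_with_proj)
  have pos: "\<forall>m\<in>set ms. m > 0" using assms(1) by fastforce
  have "digraph_decomposition \<D> ?K"
    unfolding digraph_decomposition_def
  proof (intro conjI ballI)
    show "disjoint_family_on parcs \<D>"
      using dis unfolding disjoint_family_on_def \<D>_def H_def by auto
    show "(\<Union>H\<in>\<D>. parcs H) = parcs ?K"
      using U by (simp add: \<D>_def H_def parcs_complete)
    show "subgraph (with_proj G) (with_proj ?K)" if "G \<in> \<D>" for G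
      using sp that by (auto simp: \<D>_def spanning_def)
  qed
  moreover have "disjoint_union_of_cycles (H i) ms" if "i < n - 1" for i
    using C(1)[OF that] by (simp add: disjoint_union_of_cycles_iff[OF pos] H_def)
  ultimately have "OP_star_solution ms \<D>"
    unfolding OP_star_solution_def using sp assms(2) by (auto simp: \<D>_def)
  then show ?thesis unfolding OP_star_has_solution_def by blast
qed

section \<open>Rotating a base factor\<close>

definition circ :: "nat \<Rightarrow> nat set \<Rightarrow> (nat \<times> nat) set" where
  "circ t R = {(u, (u + \<delta>) mod t) | u \<delta>. u < t \<and> \<delta> \<in> R}"

lemma circI: "u < t \<Longrightarrow> \<delta> \<in> R \<Longrightarrow> v = (u + \<delta>) mod t \<Longrightarrow> (u, v) \<in> circ t R"
  unfolding circ_def by blast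

lemma add_mod_inj:
  fixes a b j t :: nat
  assumes "a < t" "b < t" "(a + j) mod t = (b + j) mod t"
  shows "a = b"
proof -
  have *: "x = y" if "x \<le> y" "y < t" "(y + j) mod t = (x + j) mod t" for x y :: nat
  proof -
    have "t dvd (y + j) - (x + j)"
      using that by (subst mod_eq_dvd_iff_nat[symmetric]) auto
    then have "t dvd y - x" by simp
    then show ?thesis using that nat_dvd_not_less[of "y - x" t] by linarith
  qed
  show ?thesis
    using *[of a b] *[of b a] assms by (cases "a \<le> b") auto
qed

text \<open>There are at most as many arcs as vertices and every vertex is a tail, so an arc is
  determined by its tail.\<close>

lemma factor_single_valued:
  assumes "factor ms V C" "(u, v) \<in> C" "(u, w) \<in> C"
  shows "v = w"
proof -
  have "card (fst ` C) = card C"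
    using factor_card[OF assms(1)] fst_factor[OF assms(1)] card_image_le[of C fst] by simp
  then have "inj_on fst C" using factor_card(1)[OF assms(1)] eq_card_imp_inj_on by blast
  from inj_onD[OF this, of "(u, v)" "(u, w)"] show ?thesis using assms(2,3) by simp
qed

lemma snd_factor: "factor ms V C \<Longrightarrow> snd ` C = V"
proof -
  assume "factor ms V C"
  then obtain css where "set (concat css) = V" "C = (\<Union>xs\<in>set css. cyc_arcs xs)"
    unfolding factor_def by blast
  then show ?thesis by (simp add: image_UN snd_cyc_arcs)
qed

lemma image_shift: "(+) s ` {..<t} = {s..<s + (t::nat)}"
  by (simp add: lessThan_atLeast0 add.commute)

lemma covers_append:
  assumes "covers ms V k A" "covers ns W k B" "V \<inter> W = {}"
  shows "covers (ms @ ns) (V \<union> W) k (A \<union> B)"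
proof -
  obtain C D where C: "\<forall>i<k. factor ms V (C i)" "A \<subseteq> (\<Union>i<k. C i)"
    and D: "\<forall>i<k. factor ns W (D i)" "B \<subseteq> (\<Union>i<k. D i)"
    using assms unfolding covers_def by metis
  have "A \<union> B \<subseteq> (\<Union>i<k. C i \<union> D i)" using C(2) D(2) by fastforce
  then show ?thesis
    unfolding covers_def using C(1) D(1) factor_append[OF _ _ assms(3)]
    by (intro exI[of _ "\<lambda>i. C i \<union> D i"]) simp
qed

text \<open>
  The arcs between \<open>{..<s}\<close> and \<open>{s..<s + t}\<close>, together with the arcs within \<open>{s..<s + t}\<close> whose
  differences modulo \<open>t\<close> lie outside \<open>R\<close>, are covered by the \<open>t\<close> rotations of \<open>C\<close>.
\<close>
lemma covers_rotate:
  assumes old: "covers ms {..<s} (s - 1) (all_arcs {..<s})"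
    and R: "covers ns {..<t} (s - 1) (circ t R)"
    and C: "factor (ms @ ns) {..<s + t} C"
    and out: "\<And>x. x < s \<Longrightarrow> \<exists>v. (x, s + v) \<in> C"
    and D: "\<And>\<delta>. 0 < \<delta> \<Longrightarrow> \<delta> < t \<Longrightarrow> \<delta> \<notin> R \<Longrightarrow> \<exists>u<t. (s + u, s + (u + \<delta>) mod t) \<in> C"
    and pos: "s > 0" "t > 0"
  shows "covers (ms @ ns) {..<s + t} (s + t - 1) (all_arcs {..<s + t})"
proof -

  have 1: "covers (ms @ ns) {..<s + t} (s - 1) (all_arcs {..<s} \<union> map_prod ((+) s) ((+) s) ` circ t R)"
  proof -
    have "{..<s} \<union> {s..<s+t} = {..<s+t}" "{..<s} \<inter> {s..<s+t} = {}" by auto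
    then show ?thesis
      using covers_append[OF old covers_image[OF R, of "(+) s"]] by (simp add: image_shift)
  qed
  define rot where "rot j x = (if x < s then x else s + (x - s + j) mod t)" for j x
  have rot_lt: "x < s + t \<Longrightarrow> rot j x < s + t" for j x using pos by (simp add: rot_def)
  have inj: "inj_on (rot j) {..<s+t}" for j
  proof (rule inj_onI)
    fix x y assume xy: "x \<in> {..<s+t}" "y \<in> {..<s+t}" "rot j x = rot j y"
    show "x = y"
    proof (cases "x < s \<or> y < s")
      case True
      then show ?thesis using xy by (auto simp: rot_def split: if_splits)
    next
      case False
      then have "(x - s + j) mod t = (y - s + j) mod t" using xy(3) by (simp add: rot_def)
      then have "x - s = y - s" using False xy(1,2) by (intro add_mod_inj[of "x - s" t "y - s" j]) auto
      then show ?thesis using False by linarith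
    qed
  qed
  have rot_im: "rot j ` {..<s+t} = {..<s+t}" for j
    using inj[of j] rot_lt by (intro endo_inj_surj) auto
  define X where "X = (\<Union>j<t. map_prod (rot j) (rot j) ` C)"
  have 2: "covers (ms @ ns) {..<s + t} t X"
    unfolding covers_def X_def using factor_image[OF C inj] rot_im
    by (intro exI[of _ "\<lambda>j. map_prod (rot j) (rot j) ` C"]) simp
  have XI: "(u, v) \<in> X" if "(u', v') \<in> C" "j < t" "u = rot j u'" "v = rot j v'" for u v u' v' j
    unfolding X_def using that by (auto intro!: bexI[of _ j] image_eqI[of _ _ "(u', v')"])
  have Csub: "C \<subseteq> {..<s+t} \<times> {..<s+t}" by (rule factor_subset[OF C])
  \<comment> \<open>The predecessor of an old vertex is new as well: an old predecessor would have
    its only successor among the new vertices by \<open>out\<close>.\<close>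
  have inn: "\<exists>u<t. (s + u, x) \<in> C" if "x < s" for x
  proof -
    have "x \<in> snd ` C" using snd_factor[OF C] that by simp
    then obtain u where u: "(u, x) \<in> C" by auto
    have "u \<ge> s"
    proof (rule ccontr)
      assume "\<not> s \<le> u"
      then obtain v where "(u, s + v) \<in> C" using out[of u] by auto
      then have "x = s + v" using factor_single_valued[OF C u] by blast
      then show False using that by simp
    qed
    then show ?thesis using u Csub by (intro exI[of _ "u - s"]) auto
  qed
  have shift: "\<exists>j<t. (w + j) mod t = v" if "v < t" "w < t" for v w
  proof (cases "w \<le> v")
    case True then show ?thesis using that by (intro exI[of _ "v - w"]) auto
  next
    case False then show ?thesis using that by (intro exI[of _ "v + t - w"]) auto
  qed
  have "all_arcs {..<s+t} \<subseteq> all_arcs {..<s} \<union> map_prod ((+) s) ((+) s) ` circ t R \<union> X"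
  proof
    fix e assume e: "e \<in> all_arcs {..<s+t}"
    obtain u v where uv: "e = (u, v)" by (cases e)
    have lt: "u < s + t" "v < s + t" "u \<noteq> v" using e by (auto simp: uv all_arcs_def)
    consider "u < s" "v < s" | "u < s" "v \<ge> s" | "u \<ge> s" "v < s" | "u \<ge> s" "v \<ge> s" by linarith
    then show "e \<in> all_arcs {..<s} \<union> map_prod ((+) s) ((+) s) ` circ t R \<union> X"
    proof cases
      case 1 then show ?thesis using lt by (simp add: uv all_arcs_def)
    next
      case 2
      obtain w where w: "(u, s + w) \<in> C" using out[OF 2(1)] by blast
      then have "w < t" using Csub by auto
      moreover have "v - s < t" using lt 2 by linarith
      ultimately obtain j where "j < t" "(w + j) mod t = v - s" using shift[of "v - s" w] by blast
      then have "(u, v) \<in> X" using w 2 by (intro XI[of u "s + w" j]) (auto simp: rot_def)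
      then show ?thesis by (simp add: uv)
    next
      case 3
      obtain w where w: "w < t" "(s + w, v) \<in> C" using inn[OF 3(2)] by blast
      moreover have "u - s < t" using lt 3 by linarith
      ultimately obtain j where "j < t" "(w + j) mod t = u - s" using shift[of "u - s" w] by blast
      then have "(u, v) \<in> X" using w 3 by (intro XI[of "s + w" v j]) (auto simp: rot_def)
      then show ?thesis by (simp add: uv)
    next
      case 4
      have lt': "u - s < t" "v - s < t" using lt 4 by linarith+
      obtain \<delta> where \<delta>: "\<delta> < t" "(u - s + \<delta>) mod t = v - s" using shift[OF lt'(2,1)] by blast
      have "\<delta> > 0" using \<delta> lt 4 by (cases "\<delta> = 0") auto
      show ?thesis
      proof (cases "\<delta> \<in> R")
        case True
        have "(u - s, v - s) \<in> circ t R" using True \<delta> lt 4 by (intro circI[of _ _ \<delta>]) auto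
        then have "map_prod ((+) s) ((+) s) (u - s, v - s) \<in> map_prod ((+) s) ((+) s) ` circ t R" by (rule imageI)
        then show ?thesis using 4 by (simp add: uv)
      next
        case False
        obtain w where w: "w < t" "(s + w, s + (w + \<delta>) mod t) \<in> C" using D \<open>\<delta> > 0\<close> \<delta> False by blast
        then obtain j where j: "j < t" "(w + j) mod t = u - s" using shift[OF lt'(1), of w] by blast
        have "((w + \<delta>) mod t + j) mod t = ((w + j) mod t + \<delta>) mod t"
          by (simp add: mod_simps ac_simps)
        then have "((w + \<delta>) mod t + j) mod t = v - s" using j \<delta> by simp
        then have "(u, v) \<in> X"
          using w j 4 by (intro XI[of "s + w" "s + (w + \<delta>) mod t" j]) (auto simp: rot_def)
        then show ?thesis by (simp add: uv)
      qed
    qed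
  qed
  then have "covers (ms @ ns) {..<s + t} (s - 1 + t) (all_arcs {..<s + t})"
    using covers_mono[OF covers_Un[OF 1 2]] by blast
  then show ?thesis using pos by simp
qed

section \<open>Threading old vertices through paths of new vertices\<close>

definition consec :: "'a list \<Rightarrow> ('a \<times> 'a) set" where
  "consec xs = set (zip xs (tl xs))"

lemma consec_simps [simp]:
  "consec [] = {}" "consec [x] = {}" "consec (x # y # xs) = insert (x, y) (consec (y # xs))"
  by (auto simp: consec_def)

lemma consec_Cons: "consec xs \<subseteq> consec (x # xs)"
  by (cases xs) auto

lemma consec_append: "consec xs \<union> consec ys \<subseteq> consec (xs @ ys)"
proof (induction xs)
  case (Cons x xs)
  then show ?case using consec_Cons[of ys x] consec_Cons[of "xs @ ys" x] by (cases xs) auto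
qed simp

lemma consec_map: "consec (map f xs) = map_prod f f ` consec xs"
  by (simp add: consec_def map_tl[symmetric] zip_map_map map_prod_def)

lemma consec_cyc_arcs: "consec xs \<subseteq> cyc_arcs xs"
proof -
  have "consec xs = set (zip xs (tl xs))" by (simp add: consec_def)
  also have "\<dots> \<subseteq> set (zip xs (tl xs @ [hd xs]))"
    by (cases xs) (auto simp: zip_append1 in_set_zip nth_append)
  also have "\<dots> \<subseteq> cyc_arcs xs"
    by (cases xs) (auto simp: cyc_arcs_def)
  finally show ?thesis .
qed

lemma consec_nthI: "Suc i < length xs \<Longrightarrow> (xs ! i, xs ! Suc i) \<in> consec xs"
  unfolding consec_def set_zip by (auto simp: nth_tl intro!: exI[of _ i])

text \<open>\<open>block b k g\<close> threads the new vertices \<open>k, k + 1, \<dots>\<close> through the paths in \<open>g\<close>, shifted by \<open>b\<close>.\<close>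
primrec block :: "nat \<Rightarrow> nat \<Rightarrow> nat list list \<Rightarrow> nat list" where
  "block b k [] = []"
| "block b k (q # g) = k # map ((+) b) q @ block b (Suc k) g"

primrec blocks :: "nat \<Rightarrow> nat \<Rightarrow> nat list list list \<Rightarrow> nat list list" where
  "blocks b k [] = []"
| "blocks b k (g # gs) = block b k g # blocks b (k + length g) gs"

text \<open>The length of the cycle made from the group \<open>g\<close>: one old vertex in front of
  each path, and the vertices of the paths themselves.\<close>

definition weight :: "nat list list \<Rightarrow> nat" where
  "weight g = length g + length (concat g)"

lemma length_block: "length (block b k g) = weight g"
  by (induction g arbitrary: k) (auto simp: weight_def)

lemma set_block: "set (block b k g) = {k..<k + length g} \<union> (+) b ` set (concat g)"
  by (induction g arbitrary: k) auto

lemma distinct_block: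
  "distinct (concat g) \<Longrightarrow> k + length g \<le> b \<Longrightarrow> distinct (block b k g)"
proof (induction g arbitrary: k)
  case (Cons q g)
  have "distinct (block b (Suc k) g)" using Cons by (intro Cons.IH) auto
  then show ?case using Cons.prems by (auto simp: set_block distinct_map)
qed simp

lemma block_out:
  assumes "[] \<notin> set g" "x \<in> {k..<k + length g}"
  shows "\<exists>v. (x, b + v) \<in> consec (block b k g)"
  using assms
proof (induction g arbitrary: k)
  case (Cons q g)
  show ?case
  proof (cases "x = k")
    case True
    then show ?thesis using Cons.prems(1) by (cases q) auto
  next
    case False
    then have "\<exists>v. (x, b + v) \<in> consec (block b (Suc k) g)" using Cons.prems by (intro Cons.IH) auto
    then show ?thesis
      using consec_append[of "k # map ((+) b) q" "block b (Suc k) g"] by (auto simp del: consec_simps)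
  qed
qed simp

lemma block_consec:
  assumes "q \<in> set g" "(u, v) \<in> consec q"
  shows "(b + u, b + v) \<in> consec (block b k g)"
  using assms
proof (induction g arbitrary: k)
  case (Cons p g)
  show ?case
  proof (cases "q = p")
    case True
    have "(b + u, b + v) \<in> consec (map ((+) b) q)"
      using Cons.prems(2) by (auto simp: consec_map intro!: image_eqI[of _ _ "(u, v)"])
    then show ?thesis
      using consec_append[of "map ((+) b) q" "block b (Suc k) g"] consec_Cons[of _ k] True
      by (auto simp del: consec_simps)
  next
    case False
    then have "(b + u, b + v) \<in> consec (block b (Suc k) g)" using Cons by auto
    then show ?thesis
      using consec_append[of "k # map ((+) b) p" "block b (Suc k) g"] by (auto simp del: consec_simps)
  qed
qed simp

lemma set_blocks:
  "set (concat (blocks b k gs)) = {k..<k + length (concat gs)} \<union> (+) b ` set (concat (concat gs))"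
proof (induction gs arbitrary: k)
  case (Cons g gs)
  have e: "{k..<k + length (g @ concat gs)}
      = {k..<k + length g} \<union> {k + length g..<k + length g + length (concat gs)}" by auto
  show ?case
    unfolding blocks.simps concat.simps e concat_append set_append set_block Cons image_Un by blast
qed simp

lemma distinct_blocks:
  "distinct (concat (concat gs)) \<Longrightarrow> k + length (concat gs) \<le> b \<Longrightarrow> distinct (concat (blocks b k gs))"
proof (induction gs arbitrary: k)
  case (Cons g gs)
  have d: "distinct (concat g)" "distinct (concat (concat gs))"
    "set (concat g) \<inter> set (concat (concat gs)) = {}" using Cons.prems(1) by auto
  have "distinct (concat (blocks b (k + length g) gs))"
    using Cons.prems d by (intro Cons.IH) auto
  moreover have "distinct (block b k g)" using Cons.prems d by (intro distinct_block) auto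
  moreover have "set (block b k g) \<inter> set (concat (blocks b (k + length g) gs)) = {}"
    unfolding set_block set_blocks using d(3) Cons.prems(2) by (auto simp del: set_concat)
  ultimately show ?case by simp
qed simp

lemma map_length_blocks: "map length (blocks b k gs) = map weight gs"
  by (induction gs arbitrary: k) (auto simp: length_block)

lemma blocks_out:
  assumes "[] \<notin> set (concat gs)" "x \<in> {k..<k + length (concat gs)}"
  shows "\<exists>v. (x, b + v) \<in> (\<Union>xs\<in>set (blocks b k gs). cyc_arcs xs)"
  using assms
proof (induction gs arbitrary: k)
  case (Cons g gs)
  show ?case
  proof (cases "x < k + length g")
    case True
    then have "\<exists>v. (x, b + v) \<in> consec (block b k g)" using Cons.prems by (intro block_out) auto
    then show ?thesis using consec_cyc_arcs by fastforce
  next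
    case False
    then have "\<exists>v. (x, b + v) \<in> (\<Union>xs\<in>set (blocks b (k + length g) gs). cyc_arcs xs)"
      using Cons.prems by (intro Cons.IH) auto
    then show ?thesis by auto
  qed
qed simp

lemma blocks_consec:
  assumes "q \<in> set (concat gs)" "(u, v) \<in> consec q"
  shows "(b + u, b + v) \<in> (\<Union>xs\<in>set (blocks b k gs). cyc_arcs xs)"
  using assms
proof (induction gs arbitrary: k)
  case (Cons g gs)
  show ?case
  proof (cases "q \<in> set g")
    case True
    then have "(b + u, b + v) \<in> consec (block b k g)" using Cons.prems(2) by (rule block_consec)
    then show ?thesis using consec_cyc_arcs by fastforce
  next
    case False
    then have "(b + u, b + v) \<in> (\<Union>xs\<in>set (blocks b (k + length g) gs). cyc_arcs xs)"
      using Cons by auto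
    then show ?thesis by auto
  qed
qed simp

text \<open>Each path uses up one old vertex, hence \<open>length (concat gs) = s\<close>; as no
  path is empty, every old vertex is followed by a new one.\<close>

lemma factor_blocks:
  assumes "distinct (concat (concat gs))" "[] \<notin> set (concat gs)" "length (concat gs) = s"
  obtains C where "factor (map weight gs) ({..<s} \<union> (+) s ` set (concat (concat gs))) C"
    "\<And>x. x < s \<Longrightarrow> \<exists>v. (x, s + v) \<in> C"
    "\<And>q u v. q \<in> set (concat gs) \<Longrightarrow> (u, v) \<in> consec q \<Longrightarrow> (s + u, s + v) \<in> C"
proof -
  define C where "C = (\<Union>xs\<in>set (blocks s 0 gs). cyc_arcs xs)"
  have "factor (map weight gs) ({..<s} \<union> (+) s ` set (concat (concat gs))) C"
    unfolding factor_def C_def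
    using distinct_blocks[OF assms(1), of 0 s] set_blocks[of s 0 gs] assms(3)
    by (intro exI[of _ "blocks s 0 gs"]) (auto simp: map_length_blocks atLeast0LessThan)
  moreover have "\<exists>v. (x, s + v) \<in> C" if "x < s" for x
    unfolding C_def using blocks_out[OF assms(2), of x 0 s] that assms(3) by simp
  moreover have "(s + u, s + v) \<in> C" if "q \<in> set (concat gs)" "(u, v) \<in> consec q" for q u v
    unfolding C_def using blocks_consec[OF that] .
  ultimately show thesis using that by blast
qed

text \<open>The number of isolated new vertices consumed by the cycles of lengths \<open>ms\<close>.
  An even cycle alternates between old and new vertices. An odd cycle does so too, except for one
  path on two new vertices, which accounts for 3 together with its old vertex.\<close>

definition need :: "nat list \<Rightarrow> nat" where
  "need ms = (\<Sum>m\<leftarrow>ms. if even m then m div 2 else (m - 3) div 2)"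

lemma need_eq:
  assumes "\<forall>m\<in>set ms. m \<ge> (2::nat)"
  shows "2 * need ms + 3 * length (filter odd ms) = sum_list ms"
  using assms
proof (induction ms)
  case (Cons m ms)
  have "odd m \<Longrightarrow> 2 * ((m - 3) div 2) + 3 = m" using Cons.prems by (auto elim!: oddE)
  then show ?case using Cons by (auto simp: need_def)
qed (simp add: need_def)

text \<open>A path on two vertices adds 3 to the weight of its group and an isolated vertex adds 2,
  so each entry of \<open>ms\<close> is met by taking paths from the front of \<open>P\<close> and
  \<open>I\<close>. Grouping permutes the paths, which is why the conclusion compares
  multisets.\<close>

lemma exists_groups:
  assumes "\<forall>m\<in>set ms. m \<ge> (2::nat)" "length P = length (filter odd ms)" "\<forall>q\<in>set P. length q = 2"
    "length I = need ms" "\<forall>q\<in>set I. length q = 1"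
  shows "\<exists>gs. map weight gs = ms \<and> mset (concat gs) = mset (P @ I)"
  using assms
proof (induction ms arbitrary: P I)
  case Nil
  then show ?case by (intro exI[of _ "[]"]) (simp add: need_def)
next
  case (Cons m ms)
  have con: "length (concat J) = length J" if "\<forall>q\<in>set J. length q = 1" for J :: "nat list list"
    using that by (induction J) auto
  show ?case
  proof (cases "even m")
    case True
    define k where "k = m div 2"
    have k: "k + need ms = length I" using Cons.prems(4) True by (simp add: need_def k_def)
    have "\<exists>gs. map weight gs = ms \<and> mset (concat gs) = mset (P @ drop k I)"
      using Cons.prems True k by (intro Cons.IH) (auto dest: in_set_dropD)
    then obtain gs where gs: "map weight gs = ms" "mset (concat gs) = mset (P @ drop k I)" by blast
    have "length (concat (take k I)) = length (take k I)"
      using Cons.prems(5) by (intro con) (auto dest: in_set_takeD)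
    moreover have "k + k = m" using True by (auto simp: k_def elim!: evenE)
    ultimately have "weight (take k I) = m" using k by (simp add: weight_def)
    moreover have "mset I = mset (take k I) + mset (drop k I)"
      by (metis append_take_drop_id mset_append)
    ultimately show ?thesis using gs by (intro exI[of _ "take k I # gs"]) simp
  next
    case False
    define k where "k = (m - 3) div 2"
    have m: "2 * k + 3 = m" using False Cons.prems(1) by (auto simp: k_def elim!: oddE)
    have k: "k + need ms = length I" using Cons.prems(4) False by (simp add: need_def k_def)
    obtain p P' where P: "P = p # P'" using Cons.prems(2) False by (cases P) auto
    have "\<exists>gs. map weight gs = ms \<and> mset (concat gs) = mset (P' @ drop k I)"
      using Cons.prems False k P by (intro Cons.IH) (auto dest: in_set_dropD)
    then obtain gs where gs: "map weight gs = ms" "mset (concat gs) = mset (P' @ drop k I)" by blast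
    have "length (concat (take k I)) = length (take k I)"
      using Cons.prems(5) by (intro con) (auto dest: in_set_takeD)
    then have "weight (p # take k I) = m" using k m Cons.prems(3) P by (simp add: weight_def)
    moreover have "mset I = mset (take k I) + mset (drop k I)"
      by (metis append_take_drop_id mset_append)
    ultimately show ?thesis using gs P by (intro exI[of _ "(p # take k I) # gs"]) simp
  qed
qed

lemma mset_concat_cong: "mset xs = mset ys \<Longrightarrow> mset (concat xs) = mset (concat ys)"
  by (simp add: mset_concat flip: sum_mset_sum_list)

lemma distinct_concat_mset_cong:
  "mset xs = mset ys \<Longrightarrow> distinct (concat xs) \<Longrightarrow> distinct (concat ys)"
  using mset_concat_cong mset_eq_imp_distinct_iff by blast

lemma isolated_paths:
  assumes "distinct (concat N)" "set (concat N) \<subseteq> {..<t}"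
  obtains I where "\<forall>q\<in>set I. length q = 1" "length I + length (concat N) = t"
    "distinct (concat (N @ I))" "set (concat (N @ I)) = {..<t}"
proof -
  define L where "L = sorted_list_of_set ({..<t} - set (concat N))"
  have L: "set L = {..<t} - set (concat N)" "distinct L" by (auto simp: L_def)
  have "card (set (concat N)) \<le> t" using card_mono[OF _ assms(2)] by simp
  then have len: "length L + length (concat N) = t"
    using distinct_card[OF L(2)] L(1) distinct_card[OF assms(1)] assms(2)
    by (simp add: card_Diff_subset)
  have c: "concat (map (\<lambda>v. [v]) L) = L" by (induction L) auto
  show thesis
  proof (rule that[of "map (\<lambda>v. [v]) L"])
    show "distinct (concat (N @ map (\<lambda>v. [v]) L))"
      using assms(1) L unfolding concat_append c by auto
    show "set (concat (N @ map (\<lambda>v. [v]) L)) = {..<t}"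
      using assms(2) L unfolding concat_append c set_append by auto
  qed (use len in auto)
qed

text \<open>
  Each even \<open>m\<close> in \<open>ms\<close> becomes a cycle alternating between \<open>{..<s}\<close> and isolated vertices, each odd
  \<open>m\<close> uses in addition one of the \<open>a\<close> single arcs, and all remaining paths go into the cycle of
  length \<open>t\<close>.
\<close>
lemma base_factor_long:
  assumes ms: "\<forall>m\<in>set ms. m \<ge> 2" "s = sum_list ms" "a = length (filter odd ms)" and st: "s \<le> t"
    and N: "[] \<notin> set N" "distinct (concat N)" "set (concat N) \<subseteq> {..<t}"
      "a \<le> length N" "\<forall>i<a. length (N ! i) = 2"
      "length (concat N) = t - s + length N" "2 * length N \<le> s + 3 * a"
  obtains C where "factor (ms @ [t]) {..<s + t} C" "\<And>x. x < s \<Longrightarrow> \<exists>v. (x, s + v) \<in> C"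
    "\<And>q u v. q \<in> set N \<Longrightarrow> (u, v) \<in> consec q \<Longrightarrow> (s + u, s + v) \<in> C"
proof -
  obtain I where I: "\<forall>q\<in>set I. length q = 1" "length I + length (concat N) = t"
    "distinct (concat (N @ I))" "set (concat (N @ I)) = {..<t}"
    using isolated_paths[OF N(2,3)] by metis
  have need: "2 * need ms + 3 * a = s" using need_eq[OF ms(1)] ms by simp
  \<comment> \<open>The paths, isolated vertices included, number exactly \<open>s\<close>, one for
    each old vertex.\<close>
  have lI: "length I + length N = s" using I(2) N(6) st by linarith
  have le: "need ms \<le> length I" using need lI N(7) by linarith
  have "\<exists>gs. map weight gs = ms \<and> mset (concat gs) = mset (take a N @ take (need ms) I)"
    using ms N(4,5) I(1) le
    by (intro exists_groups) (auto simp: in_set_conv_nth dest: in_set_takeD)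
  then obtain gs where gs: "map weight gs = ms" "mset (concat gs) = mset (take a N @ take (need ms) I)"
    by blast
  \<comment> \<open>Everything left over forms one more group; its weight is \<open>t\<close>
    because all weights add up to \<open>s + t\<close>.\<close>
  define r where "r = drop a N @ drop (need ms) I"
  have m: "mset (concat (gs @ [r])) = mset (N @ I)"
  proof -
    have "mset N = mset (take a N) + mset (drop a N)" "mset I = mset (take (need ms) I) + mset (drop (need ms) I)"
      by (metis append_take_drop_id mset_append)+
    then show ?thesis using gs(2) by (simp add: r_def)
  qed
  have set_eq: "set (concat (gs @ [r])) = set (N @ I)" using m mset_eq_setD by blast
  have len_eq: "length (concat (gs @ [r])) = s" using m lI mset_eq_length by (metis add.commute length_append)
  have ccm: "mset (concat (concat (gs @ [r]))) = mset (concat (N @ I))" using mset_concat_cong[OF m] .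
  have d: "distinct (concat (concat (gs @ [r])))" using distinct_concat_mset_cong[OF m[symmetric] I(3)] .
  have ne: "[] \<notin> set (concat (gs @ [r]))" unfolding set_eq using N(1) I(1) by auto
  have "sum_list (map weight gs') = length (concat gs') + length (concat (concat gs'))" for gs'
    by (induction gs') (auto simp: weight_def)
  then have "sum_list (map weight (gs @ [r])) = s + length (concat (N @ I))"
    unfolding len_eq[symmetric] mset_eq_length[OF ccm, symmetric] .
  moreover have "length (concat J) = length J" if "\<forall>q\<in>set J. length q = 1" for J :: "nat list list"
    using that by (induction J) auto
  ultimately have "sum_list (map weight (gs @ [r])) = s + t"
    using I(1,2) by simp
  then have wr: "weight r = t" using gs(1) ms(2) by simp
  have st_set: "{..<s} \<union> (+) s ` set (concat (concat (gs @ [r]))) = {..<s + t}"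
  proof -
    have "set (concat (concat (gs @ [r]))) = {..<t}" using mset_eq_setD[OF ccm] I(4) by simp
    moreover have "{..<s} \<union> (+) s ` {..<t} = {..<s+t}" unfolding image_shift by auto
    ultimately show ?thesis by simp
  qed
  show thesis
  proof (rule factor_blocks[OF d ne len_eq])
    fix C assume C: "factor (map weight (gs @ [r])) ({..<s} \<union> (+) s ` set (concat (concat (gs @ [r])))) C"
      "\<And>x. x < s \<Longrightarrow> \<exists>v. (x, s + v) \<in> C"
      "\<And>q u v. q \<in> set (concat (gs @ [r])) \<Longrightarrow> (u, v) \<in> consec q \<Longrightarrow> (s + u, s + v) \<in> C"
    show thesis
    proof (rule that)
      show "factor (ms @ [t]) {..<s + t} C" using C(1) wr gs(1) unfolding st_set by simp
      show "(s + u, s + v) \<in> C" if "q \<in> set N" "(u, v) \<in> consec q" for q u v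
        using C(3)[OF _ that(2)] that(1) unfolding set_eq by simp
    qed (rule C(2))
  qed
qed

text \<open>The digons of \<open>D\<close> stay among the new vertices, while each isolated vertex
  not consumed by \<open>ms\<close> forms a digon with an old vertex. A digon of \<open>D\<close>
  contributes two of the \<open>t - s\<close> inner arcs, a path of \<open>N\<close> contributes
  one.\<close>

lemma base_factor_digons:
  assumes ms: "\<forall>m\<in>set ms. m \<ge> 2" "s = sum_list ms" "a = length (filter odd ms)" and st: "s \<le> t" "even t"
    and N: "\<forall>q\<in>set N. length q = 2" "\<forall>q\<in>set D. length q = 2"
      "distinct (concat (N @ D))" "set (concat (N @ D)) \<subseteq> {..<t}"
      "length N = a" "a + 2 * length D = t - s"
  obtains C where "factor (ms @ replicate (t div 2) 2) {..<s + t} C"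
    "\<And>x. x < s \<Longrightarrow> \<exists>v. (x, s + v) \<in> C"
    "\<And>u v. [u, v] \<in> set N \<Longrightarrow> (s + u, s + v) \<in> C"
    "\<And>u v. [u, v] \<in> set D \<Longrightarrow> (s + u, s + v) \<in> C \<and> (s + v, s + u) \<in> C"
proof -
  obtain I where I: "\<forall>q\<in>set I. length q = 1" "length I + length (concat (N @ D)) = t"
    "distinct (concat ((N @ D) @ I))" "set (concat ((N @ D) @ I)) = {..<t}"
    using isolated_paths[OF N(3,4)] by metis
  have two: "length (concat J) = 2 * length J" if "\<forall>q\<in>set J. length q = 2" for J :: "nat list list"
    using that by (induction J) auto
  have need: "2 * need ms + 3 * a = s" using need_eq[OF ms(1)] ms by simp
  have lI: "length I + a = s" using I(2) N(5,6) st two[OF N(1)] two[OF N(2)] by simp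
  have le: "need ms \<le> length I" using need lI by linarith
  have "\<exists>gs. map weight gs = ms \<and> mset (concat gs) = mset (N @ take (need ms) I)"
    using ms N(1,5) I(1) le by (intro exists_groups) (auto dest: in_set_takeD)
  then obtain gs where gs: "map weight gs = ms" "mset (concat gs) = mset (N @ take (need ms) I)"
    by blast
  define r where "r = map (\<lambda>q. [q]) (drop (need ms) I)"
  have cr: "concat r = drop (need ms) I" by (simp add: r_def)
  have m: "mset (concat (gs @ r)) = mset (N @ I)"
  proof -
    have "mset I = mset (take (need ms) I) + mset (drop (need ms) I)"
      by (metis append_take_drop_id mset_append)
    then show ?thesis using gs(2) by (simp add: cr)
  qed
  have set_eq: "set (concat (gs @ r)) = set (N @ I)" using m mset_eq_setD by blast
  have len_eq: "length (concat (gs @ r)) = s" using m lI N(5) mset_eq_length by (metis add.commute length_append)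
  have ccm: "mset (concat (concat (gs @ r))) = mset (concat (N @ I))" using mset_concat_cong[OF m] .
  have dNI: "distinct (concat (N @ I))" using I(3) by auto
  have d: "distinct (concat (concat (gs @ r)))" using distinct_concat_mset_cong[OF m[symmetric] dNI] .
  have ne: "[] \<notin> set (concat (gs @ r))" unfolding set_eq using N(1) I(1) by auto
  have wr: "map weight r = replicate (length r) 2"
    using I(1) by (intro replicate_eqI) (auto simp: weight_def r_def dest: in_set_dropD)
  have setNI: "set (concat (concat (gs @ r))) = set (concat (N @ I))" using mset_eq_setD[OF ccm] .
  obtain C where C: "factor (map weight (gs @ r)) ({..<s} \<union> (+) s ` set (concat (concat (gs @ r)))) C"
      "\<And>x. x < s \<Longrightarrow> \<exists>v. (x, s + v) \<in> C"
      "\<And>q u v. q \<in> set (concat (gs @ r)) \<Longrightarrow> (u, v) \<in> consec q \<Longrightarrow> (s + u, s + v) \<in> C"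
    using factor_blocks[OF d ne len_eq] by metis
  define E where "E = (\<Union>xs\<in>set (map (map ((+) s)) D). cyc_arcs xs)"
  have "map length (map (map ((+) s)) D) = replicate (length D) 2"
    using N(2) by (auto intro!: replicate_eqI)
  moreover have "distinct (concat (map (map ((+) s)) D))"
    using N(3) by (simp add: distinct_map flip: map_concat)
  moreover have "set (concat (map (map ((+) s)) D)) = (+) s ` set (concat D)" by auto
  ultimately have E: "factor (replicate (length D) 2) ((+) s ` set (concat D)) E"
    unfolding factor_def E_def by blast
  have "({..<s} \<union> (+) s ` set (concat (concat (gs @ r)))) \<inter> (+) s ` set (concat D) = {}"
    unfolding setNI using I(3) by (auto simp del: set_concat)
  then have F: "factor (map weight (gs @ r) @ replicate (length D) 2)
      ({..<s} \<union> (+) s ` set (concat (N @ I)) \<union> (+) s ` set (concat D)) (C \<union> E)"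
    using factor_append[OF C(1) E] unfolding setNI by simp
  have V: "{..<s} \<union> (+) s ` set (concat (N @ I)) \<union> (+) s ` set (concat D) = {..<s+t}"
  proof -
    have "{..<s} \<union> (+) s ` {..<t} = {..<s+t}" unfolding image_shift by auto
    moreover have "set (concat (N @ I)) \<union> set (concat D) = {..<t}" using I(4) by auto
    ultimately show ?thesis by (simp only: Un_assoc image_Un[symmetric])
  qed
  have "length r + length D = t div 2"
    using need lI N(6) st by (auto simp: r_def elim!: evenE)
  then have M: "map weight (gs @ r) @ replicate (length D) 2 = ms @ replicate (t div 2) 2"
    using gs(1) wr by (simp flip: replicate_add)
  show thesis
  proof (rule that)
    show "factor (ms @ replicate (t div 2) 2) {..<s + t} (C \<union> E)" using F unfolding V M .
    show "\<exists>v. (x, s + v) \<in> C \<union> E" if "x < s" for x using C(2)[OF that] by blast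
    show "(s + u, s + v) \<in> C \<union> E" if "[u, v] \<in> set N" for u v
      using C(3)[of "[u, v]" u v] that unfolding set_eq by simp
    show "(s + u, s + v) \<in> C \<union> E \<and> (s + v, s + u) \<in> C \<union> E" if "[u, v] \<in> set D" for u v
    proof -
      have "cyc_arcs (map ((+) s) [u, v]) \<subseteq> E" unfolding E_def using that by auto
      then show ?thesis by (simp add: cyc_arcs_def)
    qed
  qed
qed

section \<open>Elementary Hamiltonian cycles on residues and 2-regular graphs\<close>

lemma factor_single: "distinct xs \<Longrightarrow> set xs = V \<Longrightarrow> length xs = n \<Longrightarrow> factor [n] V (cyc_arcs xs)"
  unfolding factor_def by (intro exI[of _ "[xs]"]) auto

lemma cyc_arcs_nthI:
  "i < length xs \<Longrightarrow> (xs ! i, xs ! (Suc i mod length xs)) \<in> cyc_arcs xs"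
  unfolding cyc_arcs_conv by blast

lemma distinct_set_lessThan:
  assumes "distinct xs" "set xs \<subseteq> {..<t}" "length xs = t"
  shows "set xs = {..<(t::nat)}"
  using assms by (intro card_subset_eq) (auto simp: distinct_card)

lemma mult_mod_inj:
  fixes i j q t :: nat
  assumes "coprime q t" "i < t" "j < t" "i * q mod t = j * q mod t"
  shows "i = j"
proof -
  have *: "x = y" if "x \<le> y" "y < t" "y * q mod t = x * q mod t" for x y
  proof -
    have "t dvd y * q - x * q"
      using that mod_eq_dvd_iff_nat[of "x * q" "y * q" t] by simp
    then have "t dvd (y - x) * q" by (simp add: diff_mult_distrib)
    then have "t dvd y - x" using assms(1) by (simp add: coprime_dvd_mult_left_iff coprime_commute)
    then show ?thesis using that nat_dvd_not_less[of "y - x" t] by linarith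
  qed
  show ?thesis using *[of i j] *[of j i] assms by (cases "i \<le> j") auto
qed

text \<open>The multiples of the unit \<open>q\<close>, taken in order, form the cycle.\<close>

lemma covers_unit:
  assumes "coprime q t" "t > 0"
  shows "covers [t] {..<t} 1 (circ t {q})"
proof -
  define xs where "xs = map (\<lambda>i. i * q mod t) [0..<t]"
  have d: "distinct xs"
    unfolding xs_def distinct_map by (auto intro!: inj_onI intro: mult_mod_inj[OF assms(1)])
  have len: "length xs = t" by (simp add: xs_def)
  have set: "set xs = {..<t}"
    using assms by (intro distinct_set_lessThan d len) (auto simp: xs_def)
  have "(u, (u + q) mod t) \<in> cyc_arcs xs" if "u < t" for u
  proof -
    have "u \<in> set xs" using that set by simp
    then obtain i where i: "i < t" "u = xs ! i" by (auto simp: in_set_conv_nth len)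
    have "xs ! (Suc i mod t) = (Suc i mod t) * q mod t" using assms by (simp add: xs_def)
    also have "\<dots> = (i * q mod t + q) mod t" by (simp add: mod_simps algebra_simps)
    also have "\<dots> = (u + q) mod t" using i by (simp add: xs_def)
    finally show ?thesis using cyc_arcs_nthI[of i xs] i len by simp
  qed
  then have "circ t {q} \<subseteq> cyc_arcs xs" by (auto simp: circ_def)
  then show ?thesis using covers_1[OF factor_single[OF d set len]] by blast
qed

text \<open>
  Alternately adding \<open>x\<close> and \<open>d - x\<close>, where \<open>x\<close> is odd, visits the even residues in steps of \<open>d\<close>.
\<close>
lemma alternating_ham:
  assumes "even t" "odd x" "gcd d t = 2" "t > 0"
  obtains C where "factor [t] {..<t} C"
    "\<And>e. e < t \<Longrightarrow> even e \<Longrightarrow> (e, (e + x) mod t) \<in> C"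
    "\<And>e. e < t \<Longrightarrow> even e \<Longrightarrow> ((e + x) mod t, (e + d) mod t) \<in> C"
proof -
  obtain m where m: "t = 2 * m" using assms(1) by blast
  have "even d" using assms(3) by (metis gcd_dvd1)
  then obtain k where k: "d = 2 * k" by blast
  have m0: "m > 0" using assms(4) m by simp
  have cop: "coprime k m" using assms(3) by (simp add: m k gcd_mult_distrib_nat[symmetric] coprime_iff_gcd_eq_1)
  define f where "f i = (if even i then (i div 2) * d mod t else ((i div 2) * d + x) mod t)" for i
  have par: "even (f i) \<longleftrightarrow> even i" for i
    using assms(1,2) k by (auto simp: f_def dvd_mod_iff)
  have inj2: "i = j" if "i < m" "j < m" "i * d mod t = j * d mod t" for i j
  proof -
    have "2 * (i * k mod m) = 2 * (j * k mod m)"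
      using that(3) unfolding m k mult.left_commute[of _ 2] mult_mod_right by simp
    then show ?thesis using mult_mod_inj[OF cop that(1,2)] by simp
  qed
  define xs where "xs = map f [0..<t]"
  have inj: "i = j" if "i < t" "j < t" "f i = f j" for i j
  proof -
    have pij: "even i = even j" using par that(3) by metis
    have "(i div 2) * d mod t = (j div 2) * d mod t"
    proof (cases "even i")
      case True
      then show ?thesis using that(3) pij by (simp add: f_def)
    next
      case False
      then have "((i div 2) * d + x) mod t = ((j div 2) * d + x) mod t"
        using that(3) pij by (simp add: f_def)
      then have "(((i div 2) * d) mod t + x) mod t = (((j div 2) * d) mod t + x) mod t"
        by (simp add: mod_simps)
      then show ?thesis using add_mod_inj[of "((i div 2) * d) mod t" t "((j div 2) * d) mod t" x] assms(4) by simp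
    qed
    moreover have "i div 2 < m" "j div 2 < m" using that(1,2) unfolding m by linarith+
    ultimately have "i div 2 = j div 2" using inj2 by blast
    then show ?thesis using pij by (cases "even i") (auto elim!: evenE oddE)
  qed
  have d: "distinct xs" using inj by (auto simp: xs_def distinct_map inj_on_def)
  have len: "length xs = t" by (simp add: xs_def)
  have nth: "xs ! i = f i" if "i < t" for i using that by (simp add: xs_def)
  have set: "set xs = {..<t}"
    using assms by (intro distinct_set_lessThan d len) (auto simp: xs_def f_def)
  have ev: "\<exists>i<m. e = i * d mod t" if "e < t" "even e" for e
  proof -
    have "e \<in> set xs" using set that by simp
    then obtain i where i: "i < t" "e = f i" by (auto simp: xs_def)
    then have "even i" using par that(2) by simp
    then show ?thesis using i m by (intro exI[of _ "i div 2"]) (auto simp: f_def)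
  qed
  show thesis
  proof (rule that)
    show "factor [t] {..<t} (cyc_arcs xs)" by (rule factor_single[OF d set len])
    fix e assume e: "e < t" "even e"
    obtain i where i: "i < m" "e = i * d mod t" using ev[OF e] by blast
    have lt: "2 * i < t" "Suc (2 * i) < t" using i m by auto
    have fe: "f (2 * i) = e" "f (Suc (2 * i)) = (e + x) mod t"
      using i by (auto simp: f_def mod_simps)
    show "(e, (e + x) mod t) \<in> cyc_arcs xs"
      using cyc_arcs_nthI[of "2 * i" xs] lt fe len nth by simp
    have "xs ! (Suc (Suc (2 * i)) mod t) = (e + d) mod t"
    proof (cases "Suc (Suc (2 * i)) < t")
      case True
      then show ?thesis using nth[OF True] i by (simp add: f_def mod_simps algebra_simps)
    next
      case False
      then have im: "Suc i = m" using lt m by simp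
      have "(e + d) mod t = (Suc i * d) mod t" using i by (simp add: mod_simps algebra_simps)
      also have "\<dots> = 0" by (simp add: im k m)
      also have "Suc (Suc (2 * i)) mod t = 0" using im m by (metis mod_self mult_Suc_right add_2_eq_Suc)
      ultimately show ?thesis using nth[of 0] assms(4) by (simp add: f_def)
    qed
    then show "((e + x) mod t, (e + d) mod t) \<in> cyc_arcs xs"
      using cyc_arcs_nthI[of "Suc (2 * i)" xs] lt fe len nth by simp
  qed
qed

lemma cyc_arcs_revI:
  assumes "j < length xs"
  shows "(xs ! (Suc j mod length xs), xs ! j) \<in> cyc_arcs (rev xs)"
proof (cases "Suc j < length xs")
  case True
  define i where "i = length xs - Suc (Suc j)"
  have "i < length xs" "Suc i < length xs" "length xs - Suc i = Suc j" "length xs - Suc (Suc i) = j"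
    using True by (auto simp: i_def)
  then show ?thesis using cyc_arcs_nthI[of i "rev xs"] True by (simp add: rev_nth)
next
  case False
  then have "Suc j = length xs" "xs \<noteq> []" "length xs - Suc 0 = j" using assms by auto
  then show ?thesis using cyc_arcs_nthI[of j "rev xs"] by (simp add: rev_nth)
qed

text \<open>A longest path closes up: the neighbours of its last vertex lie on the path, and an
  interior vertex already has both its neighbours there. The vertex set of the resulting cycle is
  closed under \<open>N\<close>, hence equal to \<open>V\<close>, and the cycle is used in both
  directions.\<close>

lemma two_regular_connected_covers:
  assumes V: "finite V" "V \<noteq> {}"
    and N: "\<And>v. v \<in> V \<Longrightarrow> N v \<subseteq> V" "\<And>v. v \<in> V \<Longrightarrow> card (N v) = 2" "\<And>v. v \<in> V \<Longrightarrow> v \<notin> N v"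
    and sym: "\<And>u v. u \<in> V \<Longrightarrow> v \<in> N u \<Longrightarrow> u \<in> N v"
    and conn: "\<And>W. W \<subseteq> V \<Longrightarrow> W \<noteq> {} \<Longrightarrow> (\<And>w. w \<in> W \<Longrightarrow> N w \<subseteq> W) \<Longrightarrow> W = V"
  shows "covers [card V] V 2 {(u, v). u \<in> V \<and> v \<in> N u}"
proof -
  define P where "P xs \<longleftrightarrow> distinct xs \<and> set xs \<subseteq> V \<and> xs \<noteq> [] \<and>
    (\<forall>i. Suc i < length xs \<longrightarrow> xs ! Suc i \<in> N (xs ! i))" for xs
  obtain v0 where v0: "v0 \<in> V" using V by blast
  have "\<exists>xs. P xs \<and> (\<forall>ys. P ys \<longrightarrow> length ys \<le> length xs)"
  proof (rule ex_has_greatest_nat)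
    show "P [v0]" using v0 by (simp add: P_def)
    show "\<forall>ys. P ys \<longrightarrow> length ys < Suc (card V)"
      using card_mono[OF V(1)] by (metis P_def distinct_card less_Suc_eq_le)
  qed
  then obtain xs where xs: "P xs" and max: "\<And>ys. P ys \<Longrightarrow> length ys \<le> length xs" by blast
  define n where "n = length xs"
  define x where "x i = xs ! i" for i
  have d: "distinct xs" and sub: "set xs \<subseteq> V" and ne: "xs \<noteq> []"
    and st: "\<And>i. Suc i < n \<Longrightarrow> x (Suc i) \<in> N (x i)"
    using xs by (auto simp: P_def n_def x_def)
  have xin: "x i \<in> set xs" "x i \<in> V" if "i < n" for i using that sub by (auto simp: x_def n_def)
  have inj: "i = j" if "i < n" "j < n" "x i = x j" for i j
    using that d by (simp add: x_def n_def nth_eq_iff_index_eq)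
  have st': "x i \<in> N (x (Suc i))" if "Suc i < n" for i using sym[OF _ st[OF that]] xin that by simp
  have ex: "\<exists>i<n. v = x i" if "v \<in> set xs" for v using that by (auto simp: in_set_conv_nth x_def n_def)
  define k where "k = n - 1"
  have nk: "n = Suc k" using ne by (simp add: k_def n_def)
  have fin: "finite (N v)" if "v \<in> V" for v using N(2)[OF that] card.infinite by fastforce
  have last: "N (x k) \<subseteq> set xs"
  proof
    fix v assume v: "v \<in> N (x k)"
    show "v \<in> set xs"
    proof (rule ccontr)
      assume "v \<notin> set xs"
      then have "P (xs @ [v])"
        using xs v N(1)[of "x k"] xin[of k] nk
        by (auto simp: P_def nth_append x_def n_def less_Suc_eq)
      then show False using max by fastforce
    qed
  qed
  have mid: "N (x (Suc i)) = {x i, x (Suc (Suc i))}" if "Suc (Suc i) < n" for i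
  proof -
    have "x i \<noteq> x (Suc (Suc i))" using inj[of i "Suc (Suc i)"] that by auto
    then have "card {x i, x (Suc (Suc i))} = 2" by simp
    then show ?thesis
      using that st st' N(2)[OF xin(2), of "Suc i"] fin[OF xin(2), of "Suc i"]
      by (intro card_subset_eq[symmetric]) auto
  qed
  have lastsub: "N (x k) \<subseteq> {x 0, x (k - 1)}"
  proof
    fix v assume v: "v \<in> N (x k)"
    then obtain i where i: "i < n" "v = x i" using last ex by blast
    have "x k \<in> N (x i)" using sym[OF _ v] i xin(2)[of k] nk by simp
    have "i \<noteq> k" using v i N(3)[of "x k"] xin[of k] nk by auto
    show "v \<in> {x 0, x (k - 1)}"
    proof (cases i)
      case 0 then show ?thesis using i by simp
    next
      case (Suc j)
      then have "N (x i) = {x j, x (Suc (Suc j))}" using mid[of j] i nk \<open>i \<noteq> k\<close> by simp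
      then have "k = j \<or> k = Suc (Suc j)"
        using \<open>x k \<in> N (x i)\<close> inj[of k j] inj[of k "Suc (Suc j)"] Suc i nk \<open>i \<noteq> k\<close> by auto
      then show ?thesis using Suc i nk by auto
    qed
  qed
  have lasteq: "N (x k) = {x 0, x (k - 1)}"
  proof (rule card_seteq[OF _ lastsub])
    have "card {x 0, x (k - 1)} \<le> 2" by (simp add: card_insert_if)
    then show "card {x 0, x (k - 1)} \<le> card (N (x k))" using N(2)[OF xin(2), of k] nk by simp
  qed simp
  \<comment> \<open>The last vertex has two different neighbours, so the path has at least three
    vertices.\<close>
  have "x 0 \<noteq> x (k - 1)"
    using lasteq N(2)[OF xin(2), of k] nk by auto
  then have k2: "k \<ge> 2" by (cases k; cases "k - 1") auto
  have wrap: "x 0 \<in> N (x k)" "x k \<in> N (x 0)" using lasteq sym[of "x k" "x 0"] xin(2)[of k] nk by auto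
  have first: "N (x 0) = {x 1, x k}"
  proof -
    have "x 1 \<noteq> x k" using inj[of 1 k] nk k2 by auto
    then have "card {x 1, x k} = 2" by simp
    then show ?thesis
      using wrap st[of 0] nk k2 N(2)[OF xin(2), of 0] fin[OF xin(2), of 0]
      by (intro card_subset_eq[symmetric]) auto
  qed
  \<comment> \<open>As \<open>n = Suc k\<close>, adding \<open>k\<close> modulo \<open>n\<close>
    means going back by one.\<close>
  have Neq: "N (x i) = {x (Suc i mod n), x ((i + k) mod n)}" if i: "i < n" for i
  proof -
    consider "i = 0" | j where "i = Suc j" "Suc i < n" | "i = k" "i > 0"
      using i nk by (cases i; cases "i = k") auto
    then show ?thesis
    proof cases
      case 1 then show ?thesis using first nk k2 by simp
    next
      case (2 j)
      have "(i + k) mod n = j" using 2 nk by (simp add: mod_if)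
      then show ?thesis using mid[of j] 2 by auto
    next
      case 3
      have "(i + k) mod n = k - 1" using 3 nk k2 by (simp add: mod_if)
      then show ?thesis using lasteq 3 nk by auto
    qed
  qed
  have setV: "set xs = V"
  proof (rule conn[OF sub])
    fix w assume "w \<in> set xs"
    then obtain i where "i < n" "w = x i" using ex by blast
    then show "N w \<subseteq> set xs" using Neq xin(1) nk by simp
  qed (use ne in simp)
  have len: "length xs = card V" using setV d distinct_card by metis
  have 1: "factor [card V] V (cyc_arcs xs)" using factor_single[OF d setV len] .
  have 2: "factor [card V] V (cyc_arcs (rev xs))" using d setV len by (intro factor_single) auto
  have "{(u, v). u \<in> V \<and> v \<in> N u} \<subseteq> cyc_arcs xs \<union> cyc_arcs (rev xs)"
  proof clarify
    fix u v assume uv: "u \<in> V" "v \<in> N u" "(u, v) \<notin> cyc_arcs (rev xs)"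
    obtain i where i: "i < n" "u = x i" using uv(1) ex setV by blast
    have "(x i, x (Suc i mod n)) \<in> cyc_arcs xs" using cyc_arcs_nthI[of i xs] i by (simp add: x_def n_def)
    moreover have "(x i, x ((i + k) mod n)) \<in> cyc_arcs (rev xs)"
    proof -
      have "Suc ((i + k) mod n) mod n = i" using i nk by (simp add: mod_simps) (metis add.commute add_Suc_right mod_add_self2 mod_less)
      then show ?thesis using cyc_arcs_revI[of "(i + k) mod n" xs] nk by (simp add: x_def n_def)
    qed
    ultimately show "(u, v) \<in> cyc_arcs xs" using uv i Neq by auto
  qed
  then show ?thesis
    using covers_mono[OF covers_Un[OF covers_1[OF 1 order_refl] covers_1[OF 2 order_refl]]]
    by (simp add: numeral_2_eq_2)
qed

section \<open>Two Hamiltonian cycles in a twisted torus\<close>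

text \<open>
  The 4-regular multigraph on \<open>V\<close> with edges \<open>v \<midarrow> f v\<close> and \<open>v \<midarrow> g v\<close>, for permutations \<open>f\<close> and \<open>g\<close>, with
  its edges coloured by \<open>cf\<close> and \<open>cg\<close> in such a way that both colour classes are connected and
  2-regular, that is, Hamiltonian cycles.
\<close>
definition ham_colouring ::
  "'a set \<Rightarrow> ('a \<Rightarrow> 'a) \<Rightarrow> ('a \<Rightarrow> 'a) \<Rightarrow> ('a \<Rightarrow> bool) \<Rightarrow> ('a \<Rightarrow> bool) \<Rightarrow> bool" where
  "ham_colouring V f g cf cg \<longleftrightarrow>
     (\<forall>u\<in>V. \<forall>w\<in>V. f u = g w \<longrightarrow>
        of_bool (cf (f u)) + of_bool (cf u) + of_bool (cg (g w)) + of_bool (cg w) = (2::nat)) \<and>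
     (\<forall>\<kappa> P. (\<forall>v\<in>V. cf v = \<kappa> \<longrightarrow> P (f v) = P v) \<longrightarrow> (\<forall>v\<in>V. cg v = \<kappa> \<longrightarrow> P (g v) = P v) \<longrightarrow>
        (\<forall>u\<in>V. \<forall>v\<in>V. P u = (P v :: bool)))"

lemma ham_colouring_degree:
  "ham_colouring V f g cf cg \<Longrightarrow> u \<in> V \<Longrightarrow> w \<in> V \<Longrightarrow> f u = g w \<Longrightarrow>
    of_bool (cf (f u)) + of_bool (cf u) + of_bool (cg (g w)) + of_bool (cg w) = (2::nat)"
  unfolding ham_colouring_def by blast

lemma ham_colouring_connected:
  fixes P :: "'a \<Rightarrow> bool"
  assumes "ham_colouring V f g cf cg"
    "\<And>v. v \<in> V \<Longrightarrow> cf v = \<kappa> \<Longrightarrow> P (f v) = P v" "\<And>v. v \<in> V \<Longrightarrow> cg v = \<kappa> \<Longrightarrow> P (g v) = P v"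
    "u \<in> V" "v \<in> V"
  shows "P u = P v"
  by (rule conjunct2[OF assms(1)[unfolded ham_colouring_def], rule_format, OF assms(2-5)])

lemma ham_colouringI:
  assumes "\<And>u w. u \<in> V \<Longrightarrow> w \<in> V \<Longrightarrow> f u = g w \<Longrightarrow>
      of_bool (cf (f u)) + of_bool (cf u) + of_bool (cg (g w)) + of_bool (cg w) = (2::nat)"
    "\<And>\<kappa> P u v. (\<And>v. v \<in> V \<Longrightarrow> cf v = \<kappa> \<Longrightarrow> P (f v) = P v) \<Longrightarrow>
      (\<And>v. v \<in> V \<Longrightarrow> cg v = \<kappa> \<Longrightarrow> P (g v) = P v) \<Longrightarrow> u \<in> V \<Longrightarrow> v \<in> V \<Longrightarrow> P u = (P v :: bool)"
  shows "ham_colouring V f g cf cg"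
  unfolding ham_colouring_def
proof (intro conjI allI impI ballI)
  fix \<kappa> and P :: "'a \<Rightarrow> bool" and u v
  assume a: "\<forall>v\<in>V. cf v = \<kappa> \<longrightarrow> P (f v) = P v" "\<forall>v\<in>V. cg v = \<kappa> \<longrightarrow> P (g v) = P v" "u \<in> V" "v \<in> V"
  show "P u = P v"
    by (rule assms(2)[OF a(1)[rule_format] a(2)[rule_format] a(3,4)])
qed (rule assms(1))

lemma ham_colouring_swap:
  assumes "ham_colouring V f g cf cg"
  shows "ham_colouring V g f cg cf"
proof (rule ham_colouringI)
  fix u w assume "u \<in> V" "w \<in> V" "g u = f w"
  then show "of_bool (cg (g u)) + of_bool (cg u) + of_bool (cf (f w)) + of_bool (cf w) = (2::nat)"
    using ham_colouring_degree[OF assms, of w u] by simp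
next
  fix \<kappa> and P :: "'a \<Rightarrow> bool" and u v
  assume *: "\<And>v. v \<in> V \<Longrightarrow> cg v = \<kappa> \<Longrightarrow> P (g v) = P v" "\<And>v. v \<in> V \<Longrightarrow> cf v = \<kappa> \<Longrightarrow> P (f v) = P v"
    "u \<in> V" "v \<in> V"
  show "P u = P v" by (rule ham_colouring_connected[OF assms *(2,1,3,4)])
qed

lemma ham_colouring_transport:
  assumes "ham_colouring V f g cf cg" "bij_betw \<phi> V V'"
    and V: "\<And>v. v \<in> V \<Longrightarrow> f v \<in> V" "\<And>v. v \<in> V \<Longrightarrow> g v \<in> V"
    and \<phi>: "\<And>v. v \<in> V \<Longrightarrow> \<phi> (f v) = f' (\<phi> v)" "\<And>v. v \<in> V \<Longrightarrow> \<phi> (g v) = g' (\<phi> v)"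
  shows "ham_colouring V' f' g' (cf \<circ> inv_into V \<phi>) (cg \<circ> inv_into V \<phi>)"
proof -
  have inj: "inj_on \<phi> V" and im: "V' = \<phi> ` V" using assms(2) by (auto simp: bij_betw_def)
  have inv: "inv_into V \<phi> (\<phi> v) = v" if "v \<in> V" for v using inj that by simp
  show ?thesis
  proof (rule ham_colouringI)
    fix u' w' assume *: "u' \<in> V'" "w' \<in> V'" "f' u' = g' w'"
    then obtain u w where uw: "u \<in> V" "w \<in> V" "u' = \<phi> u" "w' = \<phi> w" by (auto simp: im)
    have "\<phi> (f u) = \<phi> (g w)" using * uw \<phi> by simp
    then have "f u = g w" using inj_onD[OF inj] V uw by blast
    then show "of_bool ((cf \<circ> inv_into V \<phi>) (f' u')) + of_bool ((cf \<circ> inv_into V \<phi>) u') +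
        of_bool ((cg \<circ> inv_into V \<phi>) (g' w')) + of_bool ((cg \<circ> inv_into V \<phi>) w') = (2::nat)"
      using ham_colouring_degree[OF assms(1) uw(1,2)] uw V inv by (simp flip: \<phi>)
  next
    fix \<kappa> and P :: "'b \<Rightarrow> bool" and u' v'
    assume *: "\<And>v. v \<in> V' \<Longrightarrow> (cf \<circ> inv_into V \<phi>) v = \<kappa> \<Longrightarrow> P (f' v) = P v"
      "\<And>v. v \<in> V' \<Longrightarrow> (cg \<circ> inv_into V \<phi>) v = \<kappa> \<Longrightarrow> P (g' v) = P v" "u' \<in> V'" "v' \<in> V'"
    obtain u v where uv: "u \<in> V" "v \<in> V" "u' = \<phi> u" "v' = \<phi> v" using *(3,4) by (auto simp: im)
    have "(P \<circ> \<phi>) u = (P \<circ> \<phi>) v"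
    proof (rule ham_colouring_connected[OF assms(1), where \<kappa> = \<kappa>])
      show "(P \<circ> \<phi>) (f w) = (P \<circ> \<phi>) w" if "w \<in> V" "cf w = \<kappa>" for w
        using *(1)[of "\<phi> w"] that inv by (simp add: im \<phi>)
      show "(P \<circ> \<phi>) (g w) = (P \<circ> \<phi>) w" if "w \<in> V" "cg w = \<kappa>" for w
        using *(2)[of "\<phi> w"] that inv by (simp add: im \<phi>)
    qed (use uv in auto)
    then show "P u' = P v'" using uv by simp
  qed
qed

text \<open>By \<open>dist\<close> the four neighbours of a vertex are distinct, so each colour
  class is a simple connected 2-regular graph and yields two directed Hamiltonian cycles.\<close>

lemma ham_colouring_covers:
  assumes c: "ham_colouring V f g cf cg" and V: "finite V" "V \<noteq> {}"
    and bij: "bij_betw f V V" "bij_betw g V V"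
    and dist: "\<And>v. v \<in> V \<Longrightarrow> f v \<noteq> v \<and> g v \<noteq> v \<and> f (f v) \<noteq> v \<and> g (g v) \<noteq> v"
      "\<And>v. v \<in> V \<Longrightarrow> f v \<noteq> g v \<and> f (g v) \<noteq> v \<and> g (f v) \<noteq> v"
  shows "covers [card V] V 4 (\<Union>v\<in>V. {(v, f v), (f v, v), (v, g v), (g v, v)})"
proof -
  define N where "N \<kappa> v = {u\<in>V. (u = f v \<and> cf v = \<kappa>) \<or> (v = f u \<and> cf u = \<kappa>) \<or>
    (u = g v \<and> cg v = \<kappa>) \<or> (v = g u \<and> cg u = \<kappa>)}" for \<kappa> v
  have fV: "f v \<in> V" "g v \<in> V" if "v \<in> V" for v
    using bij that by (auto simp: bij_betw_def)
  have sym: "u \<in> N \<kappa> v" if "u \<in> V" "v \<in> N \<kappa> u" for u v \<kappa> using that by (auto simp: N_def)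
  have 2: "covers [card V] V 2 {(u, v). u \<in> V \<and> v \<in> N \<kappa> u}" for \<kappa>
  proof (rule two_regular_connected_covers[OF V])
    fix v assume v: "v \<in> V"
    show "N \<kappa> v \<subseteq> V" by (auto simp: N_def)
    show "v \<notin> N \<kappa> v" using dist(1)[OF v] by (auto simp: N_def)
    have "v \<in> f ` V" "v \<in> g ` V" using v bij by (simp_all add: bij_betw_def)
    then obtain u w where u: "u \<in> V" "f u = v" and w: "w \<in> V" "g w = v" by (metis imageE)
    have uu: "x = u" if "x \<in> V" "f x = v" for x
      using inj_onD[OF bij_betw_imp_inj_on[OF bij(1)], of x u] that u by simp
    have ww: "x = w" if "x \<in> V" "g x = v" for x
      using inj_onD[OF bij_betw_imp_inj_on[OF bij(2)], of x w] that w by simp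
    have eq: "N \<kappa> v = (if cf v = \<kappa> then {f v} else {}) \<union> (if cf u = \<kappa> then {u} else {}) \<union>
        (if cg v = \<kappa> then {g v} else {}) \<union> (if cg w = \<kappa> then {w} else {})"
    proof -
      have "(v = f x) = (x = u)" "(v = g x) = (x = w)" if "x \<in> V" for x
        using uu[OF that] ww[OF that] u(2) w(2) by metis+
      then have "N \<kappa> v = {x\<in>V. (x = f v \<and> cf v = \<kappa>) \<or> (x = u \<and> cf x = \<kappa>) \<or>
          (x = g v \<and> cg v = \<kappa>) \<or> (x = w \<and> cg x = \<kappa>)}"
        unfolding N_def by (intro Collect_cong) (simp cong: conj_cong)
      also have "\<dots> = (if cf v = \<kappa> then {f v} else {}) \<union> (if cf u = \<kappa> then {u} else {}) \<union>
          (if cg v = \<kappa> then {g v} else {}) \<union> (if cg w = \<kappa> then {w} else {})"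
        using u(1) w(1) fV[OF v] by (auto split: if_splits)
      finally show ?thesis .
    qed
    have d: "f v \<noteq> u" "f v \<noteq> g v" "f v \<noteq> w" "u \<noteq> g v" "u \<noteq> w" "g v \<noteq> w"
      using dist[OF v] dist[OF u(1)] dist[OF w(1)] u w by auto
    have "of_bool (cf v) + of_bool (cf u) + of_bool (cg v) + of_bool (cg w) = (2::nat)"
      using ham_colouring_degree[OF c u(1) w(1)] u w by simp
    then show "card (N \<kappa> v) = 2"
      unfolding eq using d by (cases \<kappa>; cases "cf v"; cases "cf u"; cases "cg v"; cases "cg w") auto
  next
    fix W assume W: "W \<subseteq> V" "W \<noteq> {}" "\<And>w. w \<in> W \<Longrightarrow> N \<kappa> w \<subseteq> W"
    obtain w where w: "w \<in> W" using W(2) by blast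
    have eq: "u \<in> W \<longleftrightarrow> v \<in> W" if "u \<in> V" "v \<in> N \<kappa> u" for u v
      using W(3)[of u] W(3)[of v] sym[OF that] that by blast
    have "(v \<in> W) = (w \<in> W)" if "v \<in> V" for v
    proof (rule ham_colouring_connected[OF c, where \<kappa> = \<kappa>])
      show "(f v \<in> W) = (v \<in> W)" if "v \<in> V" "cf v = \<kappa>" for v
        using eq[of v "f v"] that fV by (auto simp: N_def)
      show "(g v \<in> W) = (v \<in> W)" if "v \<in> V" "cg v = \<kappa>" for v
        using eq[of v "g v"] that fV by (auto simp: N_def)
    qed (use that w W in auto)
    then show "W = V" using w W(1) by blast
  qed (rule sym)
  have "(\<Union>v\<in>V. {(v, f v), (f v, v), (v, g v), (g v, v)}) \<subseteq>
      {(u, v). u \<in> V \<and> v \<in> N True u} \<union> {(u, v). u \<in> V \<and> v \<in> N False u}"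
    using fV by (auto simp: N_def)
  then show ?thesis using covers_mono[OF covers_Un[OF 2 2]] by simp
qed

section \<open>Torus grids and the insertion of rows\<close>

definition frame :: "nat \<Rightarrow> nat \<Rightarrow> (nat \<times> nat) set" where
  "frame d n = {..<d} \<times> {..<n}"

definition right :: "nat \<Rightarrow> nat \<times> nat \<Rightarrow> nat \<times> nat" where
  "right n p = (fst p, Suc (snd p) mod n)"

text \<open>The number \<open>r\<close> is the twist of the torus. For \<open>d = 1\<close> the maps
  \<open>right\<close> and \<open>up\<close> are the steps \<open>1\<close> and \<open>r\<close> of
  a circulant on \<open>n\<close> vertices.\<close>

definition up :: "nat \<Rightarrow> nat \<Rightarrow> nat \<Rightarrow> nat \<times> nat \<Rightarrow> nat \<times> nat" where
  "up d n r p = (if Suc (fst p) < d then (Suc (fst p), snd p) else (0, (snd p + r) mod n))"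

lemma right_up_in_frame:
  "p \<in> frame d n \<Longrightarrow> right n p \<in> frame d n" "p \<in> frame d n \<Longrightarrow> up d n r p \<in> frame d n"
  by (auto simp: frame_def right_def up_def)

text \<open>
  Two rows can be inserted at the seam of the torus \<open>frame d n\<close>: every coloured path crossing the
  seam is extended through the two new rows, provided both colours cross it.
\<close>
lemma ham_colouring_insert_rows:
  assumes c: "ham_colouring (frame d n) (right n) (up d n r) h v" and d: "d > 0"
    and seam: "j1 < n" "v (d - 1, j1)" "j2 < n" "\<not> v (d - 1, j2)"
  defines "V \<equiv> \<lambda>j. v (d - 1, j)"
  defines "h' \<equiv> \<lambda>(i, j). if i < d then h (i, j) else \<not> V (Suc j mod n)"
  defines "v' \<equiv> \<lambda>(i, j). if i < d then v (i, j) else if i = d then V (Suc j mod n) else V j"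
  shows "ham_colouring (frame (d + 2) n) (right n) (up (d + 2) n r) h' v'"
proof -
  have n: "n > 0" using seam by simp
  note frd = frame_def right_def up_def
  show ?thesis
  proof (rule ham_colouringI)
    fix u w assume uw: "u \<in> frame (d + 2) n" "w \<in> frame (d + 2) n" "right n u = up (d + 2) n r w"
    obtain i j0 where u: "u = (i, j0)" by (cases u)
    define j where "j = Suc j0 mod n"
    have ru: "right n u = (i, j)" by (simp add: right_def u j_def)
    have j: "j < n" "j0 < n" "i < d + 2" using uw n by (auto simp: j_def frame_def u)
    consider "i = 0" | "0 < i" "i < d" | "i = d" | "i = Suc d" using j by linarith
    then show "of_bool (h' (right n u)) + of_bool (h' u) + of_bool (v' (up (d+2) n r w)) + of_bool (v' w) = (2::nat)"
    proof cases
      case 1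
      then obtain jw where w: "w = (Suc d, jw)" "jw < n" "(jw + r) mod n = j"
        using uw ru by (cases w) (auto simp: frd split: if_splits)
      have "right n (0, j0) = up d n r (d - 1, jw)" using w d by (simp add: up_def right_def j_def)
      from ham_colouring_degree[OF c _ _ this]
      show ?thesis using w 1 j d by (simp add: h'_def v'_def V_def u frd j_def)
    next
      case 2
      then have w: "w = (i - 1, j)"
        using uw ru by (cases w) (auto simp: frd split: if_splits)
      have "right n u = up d n r w" using w 2 ru by (simp add: up_def)
      moreover have "i - Suc 0 < d" using 2 by simp
      moreover note ham_colouring_degree[OF c _ _ calculation(1)]
      ultimately show ?thesis using w 2 j by (simp add: h'_def v'_def u frd j_def)
    next
      case 3
      \<comment> \<open>At a new vertex in column \<open>j\<close> the vertical edges carry the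
        colours \<open>V j\<close> and \<open>V (Suc j mod n)\<close> in some order and the
        horizontal edges carry their negations, so the sum is 2.\<close>
      then have w: "w = (d - 1, j)"
        using uw ru d by (cases w) (auto simp: frd split: if_splits)
      show ?thesis unfolding uw(3)[symmetric] ru unfolding w u 3
        using d by (auto simp: h'_def v'_def V_def j_def[symmetric] of_bool_def)
    next
      case 4
      then have w: "w = (d, j)"
        using uw ru d by (cases w) (auto simp: frd split: if_splits)
      show ?thesis unfolding uw(3)[symmetric] ru unfolding w u 4
        by (auto simp: h'_def v'_def V_def j_def[symmetric] of_bool_def)
    qed
  next
    fix \<kappa> and P :: "nat \<times> nat \<Rightarrow> bool" and p q
    assume H: "\<And>p. p \<in> frame (d + 2) n \<Longrightarrow> h' p = \<kappa> \<Longrightarrow> P (right n p) = P p"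
      and U: "\<And>p. p \<in> frame (d + 2) n \<Longrightarrow> v' p = \<kappa> \<Longrightarrow> P (up (d + 2) n r p) = P p"
      and pq: "p \<in> frame (d + 2) n" "q \<in> frame (d + 2) n"
    \<comment> \<open>Some column crosses the seam in colour \<kappa>; otherwise each new row would
      be a closed cycle of that colour, separate from the rest.\<close>
    obtain jk where jk: "jk < n" "V jk = \<kappa>" using seam by (cases \<kappa>) (auto simp: V_def)
    have hx: "P (d, Suc j mod n) = P (d, j)" "P (Suc d, Suc j mod n) = P (Suc d, j)"
      if "j < n" "V (Suc j mod n) \<noteq> \<kappa>" for j
      using H[of "(d, j)"] H[of "(Suc d, j)"] that by (auto simp: frame_def right_def h'_def)
    have vx: "P (Suc d, j) = P (d, j)" if "j < n" "V (Suc j mod n) = \<kappa>" for j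
      using U[of "(d, j)"] that by (auto simp: frame_def up_def v'_def)
    have vb: "P (d, j) = P (d - 1, j)" "P (0, (j + r) mod n) = P (Suc d, j)" if "j < n" "V j = \<kappa>" for j
      using U[of "(d - 1, j)"] U[of "(Suc d, j)"] that d by (auto simp: frame_def up_def v'_def V_def)
    \<comment> \<open>In colour \<kappa> a crossing path enters row \<open>d\<close>, runs right
      until just before the next crossing column, steps up there and returns in row
      \<open>Suc d\<close>. So the two new vertices of a column lie on one path, and this path
      leaves in the column in which it came.\<close>
    have xy: "P (Suc d, j) = P (d, j)" if "j < n" for j
    proof -
      have *: "P (Suc d, j) = P (d, j)" if "j < n" "V (Suc (j + m) mod n) = \<kappa>" for j m
        using that
      proof (induction m arbitrary: j)
        case (Suc m)
        show ?case
        proof (cases "V (Suc j mod n) = \<kappa>")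
          case False
          have "Suc (Suc j mod n + m) mod n = Suc (j + Suc m) mod n"
            by (metis add_Suc add_Suc_right mod_Suc_eq mod_add_left_eq)
          then have "P (Suc d, Suc j mod n) = P (d, Suc j mod n)"
            using Suc.prems n by (intro Suc.IH) auto
          then show ?thesis using hx[OF Suc.prems(1) False] by simp
        qed (use vx Suc.prems in simp)
      qed (use vx in simp)
      \<comment> \<open>The number of steps is chosen so that the column reached is congruent to
        \<open>jk\<close>; the multiple of \<open>n\<close> prevents truncated subtraction.\<close>
      have "Suc (j + (jk + n * Suc j - Suc j)) = jk + n * Suc j"
        using n by (cases n) auto
      moreover have "(jk + n * Suc j) mod n = jk" using jk by (simp del: mult_Suc_right)
      ultimately have "Suc (j + (jk + n * Suc j - Suc j)) mod n = jk" by (simp only:)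
      then show ?thesis using *[OF that] jk by metis
    qed
    have old: "\<exists>j'<n. P (d, j) = P (d - 1, j')" if "j < n" for j
    proof -
      have *: "\<exists>j'<n. P (d, (jk + m) mod n) = P (d - 1, j')" for m
      proof (induction m)
        case 0
        then show ?case using vb[of jk] jk by auto
      next
        case (Suc m)
        have lt: "(jk + m) mod n < n" "(jk + Suc m) mod n < n" using n by auto
        have e: "Suc ((jk + m) mod n) mod n = (jk + Suc m) mod n" by (simp add: mod_Suc_eq)
        show ?case
        proof (cases "V ((jk + Suc m) mod n) = \<kappa>")
          case True
          then show ?thesis using vb[OF lt(2)] lt by blast
        next
          case False
          then show ?thesis using hx[OF lt(1)] Suc e by simp
        qed
      qed
      have "(jk + (j + n - jk)) mod n = j" using that jk by simp
      then show ?thesis using *[of "j + n - jk"] by simp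
    qed
    have const: "P x = P y" if "x \<in> frame d n" "y \<in> frame d n" for x y
    proof (rule ham_colouring_connected[OF c, where \<kappa> = \<kappa>])
      show "P (right n p) = P p" if "p \<in> frame d n" "h p = \<kappa>" for p
        using H[of p] that by (cases p) (auto simp: frame_def h'_def)
      show "P (up d n r p) = P p" if p: "p \<in> frame d n" "v p = \<kappa>" for p
      proof -
        obtain i j where ij: "p = (i, j)" "i < d" "j < n" using p by (auto simp: frame_def)
        show ?thesis
        proof (cases "Suc i < d")
          case True
          then show ?thesis using U[of p] p ij by (auto simp: frame_def v'_def up_def)
        next
          case False
          then have i: "i = d - 1" using ij by simp
          have "V j = \<kappa>" using p ij i by (simp add: V_def)
          then have "P (0, (j + r) mod n) = P (d - 1, j)" using vb[OF ij(3)] xy[OF ij(3)] by simp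
          then show ?thesis using False ij i by (simp add: up_def)
        qed
      qed
    qed (use that in auto)
    have "\<exists>x\<in>frame d n. P p = P x" if p: "p \<in> frame (d + 2) n" for p
    proof -
      obtain i j where ij: "p = (i, j)" "i < d + 2" "j < n" using p by (auto simp: frame_def)
      obtain j' where j': "j' < n" "P (d, j) = P (d - 1, j')" using old[OF ij(3)] by blast
      have "(d - 1, j') \<in> frame d n" using d j' by (simp add: frame_def)
      consider "i < d" | "i = d" | "i = Suc d" using ij by linarith
      then show ?thesis
        using ij j' \<open>(d - 1, j') \<in> frame d n\<close> xy[OF ij(3)] p
        by cases (auto simp: frame_def intro!: bexI[of _ "(d - 1, j')"] bexI[of _ p])
    qed
    then show "P p = P q" using const pq by metis
  qed
qed

definition seam_bichromatic :: "nat \<Rightarrow> nat \<Rightarrow> (nat \<times> nat \<Rightarrow> bool) \<Rightarrow> bool" where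
  "seam_bichromatic d n v \<longleftrightarrow> (\<exists>j<n. v (d - 1, j)) \<and> (\<exists>j<n. \<not> v (d - 1, j))"

text \<open>The last conjunct records that old horizontal edges keep their colours; the seams that
  appear after exchanging the two directions are read off from them.\<close>

lemma ham_colouring_insert_many_rows:
  assumes "ham_colouring (frame d n) (right n) (up d n r) h v" "d > 0" "seam_bichromatic d n v"
  shows "\<exists>h' v'. ham_colouring (frame (d + 2 * k) n) (right n) (up (d + 2 * k) n r) h' v' \<and>
    seam_bichromatic (d + 2 * k) n v' \<and> (\<forall>i<d. \<forall>j. h' (i, j) = h (i, j))"
proof (induction k)
  case 0
  then show ?case using assms by auto
next
  case (Suc k)
  then obtain h' v' where *: "ham_colouring (frame (d + 2 * k) n) (right n) (up (d + 2 * k) n r) h' v'"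
    "seam_bichromatic (d + 2 * k) n v'" "\<forall>i<d. \<forall>j. h' (i, j) = h (i, j)" by blast
  obtain j1 j2 where j: "j1 < n" "v' (d + 2 * k - 1, j1)" "j2 < n" "\<not> v' (d + 2 * k - 1, j2)"
    using *(2) unfolding seam_bichromatic_def by blast
  have "d + 2 * k > 0" using assms(2) by simp
  note ins = ham_colouring_insert_rows[OF *(1) this j]
  have eq: "d + 2 * k + 2 = d + 2 * Suc k" by simp
  show ?case unfolding eq[symmetric]
    by (rule exI, rule exI, rule conjI, rule ins) (use *(3) j assms(2) in \<open>auto simp: seam_bichromatic_def\<close>)
qed

section \<open>Circulants as twisted torus grids\<close>

lemma add_mod_if: "j < w \<Longrightarrow> r \<le> w \<Longrightarrow> (j + r) mod w = (if j + r < w then j + r else j + r - (w::nat))"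
  by (auto simp: mod_if)

lemma add_mod_neq: "v < t \<Longrightarrow> 0 < x \<Longrightarrow> x < t \<Longrightarrow> (v + x) mod t \<noteq> (v::nat)"
  by (auto simp: add_mod_if)

lemma unit_solve:
  fixes a n b :: nat
  assumes "coprime a n" "n > 0"
  shows "\<exists>r<n. r * a mod n = b mod n"
proof -
  have "inj_on (\<lambda>i. i * a mod n) {..<n}"
    using mult_mod_inj[OF assms(1)] by (auto intro!: inj_onI)
  then have "(\<lambda>i. i * a mod n) ` {..<n} = {..<n}"
    using assms(2) by (intro endo_inj_surj) auto
  moreover have "b mod n \<in> {..<n}" using assms(2) by simp
  ultimately have "b mod n \<in> (\<lambda>i. i * a mod n) ` {..<n}" by simp
  then show ?thesis by auto
qed

text \<open>Modulo \<open>d\<close> only \<open>i * b\<close> survives, which determines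
  \<open>i\<close> because \<open>b\<close> is a unit there. What remains is \<open>d\<close> times
  \<open>j * a\<close> modulo \<open>n\<close>, which determines \<open>j\<close>.\<close>

lemma frame_bij:
  assumes "coprime a n" "coprime b d" "d > 0" "n > 0"
  shows "bij_betw (\<lambda>(i, j). (i * b + j * (d * a)) mod (d * n)) (frame d n) {..<d * n}"
proof -
  let ?\<phi> = "\<lambda>(i, j). (i * b + j * (d * a)) mod (d * n)"
  have inj: "inj_on ?\<phi> (frame d n)"
  proof (rule inj_onI, clarsimp simp: frame_def)
    fix i j i' j'
    assume lt: "i < d" "j < n" "i' < d" "j' < n"
      and eq: "(i * b + j * (d * a)) mod (d * n) = (i' * b + j' * (d * a)) mod (d * n)"
    have red: "(x * b + y * (d * a)) mod (d * n) mod d = x * b mod d" for x y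
    proof -
      have "(x * b + y * (d * a)) mod (d * n) mod d = (x * b + d * (y * a)) mod d"
        by (simp add: mod_mod_cancel mult.left_commute)
      then show ?thesis by simp
    qed
    have "i * b mod d = i' * b mod d" using eq red by metis
    then have ii: "i = i'" using mult_mod_inj[OF assms(2)] lt by blast
    have "(x * (d * a) mod (d * n) + i * b) mod (d * n) = (i * b + x * (d * a)) mod (d * n)" for x
      unfolding mod_add_left_eq by (simp only: add.commute)
    then have "(j * (d * a) mod (d * n) + i * b) mod (d * n) = (j' * (d * a) mod (d * n) + i * b) mod (d * n)"
      using eq ii by simp
    then have "j * (d * a) mod (d * n) = j' * (d * a) mod (d * n)"
      by (rule add_mod_inj[rotated 2]) (use assms(3,4) in simp_all)
    then have "d * (j * a mod n) = d * (j' * a mod n)"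
      by (simp only: mult.left_commute[of _ d] mult_mod_right[symmetric])
    then have "j * a mod n = j' * a mod n" using assms(3) by simp
    then show "i = i' \<and> j = j'" using mult_mod_inj[OF assms(1)] lt ii by blast
  qed
  have "?\<phi> ` frame d n = {..<d * n}"
  proof (rule card_subset_eq)
    show "?\<phi> ` frame d n \<subseteq> {..<d * n}" using assms(3,4) by auto
    show "card (?\<phi> ` frame d n) = card {..<d * n}"
      by (simp add: card_image[OF inj]) (simp add: frame_def)
  qed simp
  then show ?thesis using inj by (simp add: bij_betw_def)
qed

text \<open>
  The rows of the torus are the cosets of the subgroup generated by \<open>d * a\<close> in \<open>\<int>\<^sub>d\<^sub>n\<close>, and \<open>b\<close> leads
  from one row to the next.
\<close>
lemma frame_to_circulant:
  assumes c: "ham_colouring (frame d n) (right n) (up d n r) h v"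
    and "coprime a n" "coprime b d" "d > 0" "n > 0" and r: "r * a mod n = b mod n"
  obtains ca cb where
    "ham_colouring {..<d * n} (\<lambda>v. (v + d * a) mod (d * n)) (\<lambda>v. (v + b) mod (d * n)) ca cb"
    "\<And>p. p \<in> frame d n \<Longrightarrow> \<exists>v<d * n. ca v = h p"
proof -
  define \<phi> where "\<phi> = (\<lambda>(i, j). (i * b + j * (d * a)) mod (d * n))"
  have bij: "bij_betw \<phi> (frame d n) {..<d * n}"
    unfolding \<phi>_def by (rule frame_bij) (use assms in auto)
  have dn: "d * x mod (d * n) = d * (x mod n)" for x by (rule mult_mod_right[symmetric])
  have dj: "y mod n * (d * a) mod (d * n) = y * (d * a) mod (d * n)" for y
  proof -
    have "y mod n * (d * a) mod (d * n) = d * (y mod n * a mod n)"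
      by (simp only: mult.left_commute[of _ d] dn)
    also have "\<dots> = d * (y * a mod n)" by (simp only: mod_mult_left_eq)
    also have "\<dots> = y * (d * a) mod (d * n)" by (simp only: mult.left_commute[of _ d] dn)
    finally show ?thesis .
  qed
  show thesis
  proof (rule that)
    show "ham_colouring {..<d * n} (\<lambda>v. (v + d * a) mod (d * n)) (\<lambda>v. (v + b) mod (d * n))
        (h \<circ> inv_into (frame d n) \<phi>) (v \<circ> inv_into (frame d n) \<phi>)"
    proof (rule ham_colouring_transport[OF c bij])
      fix p assume "p \<in> frame d n"
      then obtain i j where p: "p = (i, j)" "i < d" "j < n" by (auto simp: frame_def)
      have "\<phi> (right n p) = (i * b + Suc j mod n * (d * a) mod (d * n)) mod (d * n)"
        by (simp only: \<phi>_def right_def p prod.case fst_conv snd_conv mod_add_right_eq)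
      also have "\<dots> = (i * b + Suc j * (d * a)) mod (d * n)" by (simp only: dj mod_add_right_eq)
      finally show "\<phi> (right n p) = (\<phi> p + d * a) mod (d * n)"
        by (simp add: \<phi>_def p mod_simps algebra_simps)
      show "\<phi> (up d n r p) = (\<phi> p + b) mod (d * n)"
      proof (cases "Suc i < d")
        case True
        then show ?thesis by (simp add: \<phi>_def p up_def mod_simps algebra_simps)
      next
        case False
        \<comment> \<open>At the seam \<open>d\<close> steps of length \<open>b\<close> must amount
          to \<open>r\<close> steps of length \<open>d * a\<close> modulo \<open>d * n\<close>, that
          is, \<open>r * a = b\<close> modulo \<open>n\<close>. This is where the twist comes
          from.\<close>
        then have d: "d = Suc i" using p by simp
        have "\<phi> (up d n r p) = (j + r) * (d * a) mod (d * n)"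
          using False dj[of "j + r"] by (simp add: \<phi>_def p up_def)
        also have "\<dots> = (j * (d * a) + d * (r * a)) mod (d * n)" by (simp add: algebra_simps)
        also have "\<dots> = (j * (d * a) + d * (r * a mod n)) mod (d * n)"
          by (simp only: dn[symmetric] mod_add_right_eq)
        also have "\<dots> = (j * (d * a) + d * b) mod (d * n)"
          by (simp only: r dn[symmetric] mod_add_right_eq)
        also have "\<dots> = (\<phi> p + b) mod (d * n)"
          by (simp add: \<phi>_def p d mod_simps algebra_simps)
        finally show ?thesis .
      qed
    qed (simp_all add: right_up_in_frame)
    fix p assume p: "p \<in> frame d n"
    then have "\<phi> p < d * n" "inv_into (frame d n) \<phi> (\<phi> p) = p"
      using bij by (auto simp: bij_betw_def)
    then show "\<exists>v<d * n. (h \<circ> inv_into (frame d n) \<phi>) v = h p"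
      by (intro exI[of _ "\<phi> p"]) simp
  qed
qed

text \<open>The steps by \<open>r\<close> form one cycle. Without the steps leaving 0 and 1 it falls
  into two paths, one ending at 0 and one at 1, and \<open>P 0 = P 1\<close> links them
  again.\<close>

lemma step_chain:
  fixes P :: "nat \<Rightarrow> bool"
  assumes cop: "coprime r w" and w: "w \<ge> 2"
    and step: "\<And>j. j < w \<Longrightarrow> j \<noteq> 0 \<Longrightarrow> j \<noteq> 1 \<Longrightarrow> P ((j + r) mod w) = P j" and P01: "P 0 = P 1"
    and j: "j < w"
  shows "P j = P 0"
proof -
  define Q where "Q k = P (k * r mod w)" for k
  obtain k1 where k1: "k1 < w" "k1 * r mod w = 1" using unit_solve[OF cop, of 1] w by auto
  have stepQ: "Q (Suc k) = Q k" if "0 < k" "k < w" "k \<noteq> k1" for k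
  proof -
    have "k * r mod w \<noteq> 0" using mult_mod_inj[OF cop that(2), of 0] that w by auto
    moreover have "k * r mod w \<noteq> 1" using mult_mod_inj[OF cop that(2) k1(1)] k1 that by auto
    ultimately have "P ((k * r mod w + r) mod w) = P (k * r mod w)" using step w by simp
    then show ?thesis by (simp add: Q_def mod_simps add.commute)
  qed
  have k1pos: "k1 > 0" using k1 by (cases k1) auto
  have low: "Q k = Q k1" if "k \<le> k1" "0 < k" for k
    using that
  proof (induction k rule: inc_induct)
    case (step i)
    then show ?case using stepQ[of i] k1 by simp
  qed simp
  have high: "Q k = Q w" if "k \<le> w" "k1 < k" for k
    using that
  proof (induction k rule: inc_induct)
    case (step i)
    then show ?case using stepQ[of i] by simp
  qed simp
  have "Q w = P 0" "Q k1 = P 1" by (simp_all add: Q_def k1)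
  obtain k where k: "k < w" "k * r mod w = j" using unit_solve[OF cop, of j] w j by auto
  show ?thesis
  proof (cases "k = 0")
    case False
    then have "Q k = P 0"
      using low[of k] high[of k] k \<open>Q w = P 0\<close> \<open>Q k1 = P 1\<close> P01 by (cases "k \<le> k1") auto
    then show ?thesis using k by (simp add: Q_def)
  qed (use k in simp)
qed

lemma row_chain:
  fixes P :: "nat \<Rightarrow> bool"
  assumes r: "r < w" and step: "\<And>j. j < w \<Longrightarrow> j \<noteq> r \<Longrightarrow> P (Suc j mod w) = P j"
    and j: "j < w"
  shows "P j = P 0"
proof -
  have low: "P k = P 0" if "k \<le> r" for k
    using that
  proof (induction k)
    case (Suc k)
    then show ?case using step[of k] r by simp
  qed simp
  have high: "P k = P (w - 1)" if "k \<le> w - 1" "r < k" for k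
    using that
  proof (induction k rule: inc_induct)
    case (step i)
    then show ?case using assms(2)[of i] by simp
  qed simp
  have "P 0 = P (w - 1)" if "r \<noteq> w - 1" using step[of "w - 1"] that r by simp
  then show ?thesis using low[of j] high[of j] j by (cases "j \<le> r") auto
qed

lemma of_bool_sum_2:
  "\<not> (a \<and> r) \<Longrightarrow> \<not> (r \<and> q) \<Longrightarrow> \<not> (b \<and> q) \<Longrightarrow> \<not> (a \<and> b) \<Longrightarrow>
    of_bool (\<not> a \<and> \<not> r) + of_bool (\<not> b \<and> \<not> q) + of_bool (a \<or> b) + of_bool (r \<or> q) = (2::nat)"
  by (cases a; cases b; cases r; cases q) simp_all

text \<open>Two Hamiltonian cycles, the one of the steps \<open>1\<close> and the one of the steps
  \<open>r\<close>, trade opposite sides of the square \<open>0, 1, r + 1, r\<close>. Either cycle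
  remains Hamiltonian, and now both colours occur among the steps \<open>r\<close>, as row insertion
  requires.\<close>

lemma ham_colouring_one_row:
  assumes cop: "coprime r w" and r: "0 < r" "r < w"
  shows "ham_colouring (frame 1 w) (right w) (up 1 w r)
    (\<lambda>p. snd p \<noteq> 0 \<and> snd p \<noteq> r) (\<lambda>p. snd p = 0 \<or> snd p = 1)"
proof (rule ham_colouringI)
  fix u w' assume uw: "u \<in> frame 1 w" "w' \<in> frame 1 w" "right w u = up 1 w r w'"
  define q where "q = Suc r mod w"
  obtain j0 jw where j0: "u = (0, j0)" "j0 < w" and jw: "w' = (0, jw)" "jw < w"
    using uw by (auto simp: frame_def)
  define j where "j = Suc j0 mod w"
  have j: "right w u = (0, j)" "up 1 w r w' = (0, j)" "j = (jw + r) mod w"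
    using uw(3) by (auto simp: right_def up_def j0 jw j_def)
  have "j = (if Suc j0 = w then 0 else Suc j0)" using j0(2) by (simp add: j_def mod_Suc)
  moreover have qd: "q = (if Suc r = w then 0 else Suc r)" using r by (simp add: q_def mod_Suc)
  moreover have "j = (if jw + r < w then jw + r else jw + r - w)"
    using j(3) jw(2) r by (simp add: add_mod_if)
  ultimately have eqs: "(j0 = 0) = (j = 1)" "(j0 = r) = (j = q)" "(jw = 0) = (j = r)" "(jw = 1) = (j = q)"
    using j0(2) jw(2) r
    by - (cases "Suc j0 = w"; cases "Suc r = w"; cases "jw + r < w"; auto)+
  have "q \<noteq> r" "q \<noteq> 1" using r by (auto simp: q_def mod_Suc)
  then show "of_bool (snd (right w u) \<noteq> 0 \<and> snd (right w u) \<noteq> r) + of_bool (snd u \<noteq> 0 \<and> snd u \<noteq> r) +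
      of_bool (snd (up 1 w r w') = 0 \<or> snd (up 1 w r w') = 1) + of_bool (snd w' = 0 \<or> snd w' = 1) = (2::nat)"
    unfolding j(1,2) unfolding j0(1) jw(1) snd_conv eqs using r(1) by (intro of_bool_sum_2) auto
next
  fix \<kappa> and P :: "nat \<times> nat \<Rightarrow> bool" and u v
  assume H: "\<And>p. p \<in> frame 1 w \<Longrightarrow> (snd p \<noteq> 0 \<and> snd p \<noteq> r) = \<kappa> \<Longrightarrow> P (right w p) = P p"
    and U: "\<And>p. p \<in> frame 1 w \<Longrightarrow> (snd p = 0 \<or> snd p = 1) = \<kappa> \<Longrightarrow> P (up 1 w r p) = P p"
    and uv: "u \<in> frame 1 w" "v \<in> frame 1 w"
  have H': "P (0, Suc j mod w) = P (0, j)" if "j < w" "(j \<noteq> 0 \<and> j \<noteq> r) = \<kappa>" for j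
    using H[of "(0, j)"] that by (simp add: frame_def right_def)
  have U': "P (0, (j + r) mod w) = P (0, j)" if "j < w" "(j = 0 \<or> j = 1) = \<kappa>" for j
    using U[of "(0, j)"] that by (simp add: frame_def up_def)
  have "P (0, j) = P (0, 0)" if "j < w" for j
  proof (cases \<kappa>)
    case True
    have P0r: "P (0, r) = P (0, 0)" using U'[of 0] True r by simp
    have step_low: "P (0, Suc j mod w) = P (0, j)" if "0 < j" "j < r" for j using H'[of j] True that r by simp
    have low: "P (0, k) = P (0, r)" if "k \<le> r" "0 < k" for k
      using that
    proof (induction k rule: inc_induct)
      case (step i) then show ?case using step_low[of i] r by simp
    qed simp
    have step_high: "P (0, Suc j mod w) = P (0, j)" if "r < j" "j < w" for j using H'[of j] True that r by simp
    have high: "P (0, k) = P (0, w - 1)" if "k \<le> w - 1" "r < k" for k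
      using that
    proof (induction k rule: inc_induct)
      case (step i) then show ?case using step_high[of i] by simp
    qed simp
    have wrap: "P (0, 0) = P (0, w - 1)" if "r < w - 1" using step_high[of "w - 1"] that r by simp
    show ?thesis
    proof (cases "j \<le> r")
      case True
      then show ?thesis using low[OF True] P0r by (cases "j = 0") simp_all
    next
      case False
      then have "r < w - 1" "j \<le> w - 1" "r < j" using \<open>j < w\<close> by simp_all
      then show ?thesis using high[of j] wrap by simp
    qed
  next
    case False
    show ?thesis
    proof (rule step_chain[OF cop, of "\<lambda>j. P (0, j)"])
      show "w \<ge> 2" using r by simp
      show "P (0, 0) = P (0, 1)" using H'[of 0] False r by simp
    qed (use U' False that in auto)
  qed
  note claim = this
  have "P p = P (0, 0)" if p: "p \<in> frame 1 w" for p
  proof -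
    obtain j where "p = (0, j)" "j < w" using p by (auto simp: frame_def)
    then show ?thesis using claim[of j] by simp
  qed
  then show "P u = P v" using uv by simp
qed

text \<open>The same trade on the square \<open>(1, 0), (1, 1), (0, r + 1), (0, r)\<close> across
  the seam: it merges the two row cycles into one, while the single cycle of the \<open>up\<close>
  steps stays Hamiltonian.\<close>

lemma ham_colouring_two_rows:
  assumes cop: "coprime r w" and r: "0 < r" "r < w"
  shows "ham_colouring (frame 2 w) (right w) (up 2 w r)
    (\<lambda>p. p \<noteq> (1, 0) \<and> p \<noteq> (0, r)) (\<lambda>p. p = (1, 0) \<or> p = (1, 1))"
proof (rule ham_colouringI)
  fix u w' assume uw: "u \<in> frame 2 w" "w' \<in> frame 2 w" "right w u = up 2 w r w'"
  define q where "q = Suc r mod w"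
  obtain i j0 iw jw where u: "u = (i, j0)" "i < 2" "j0 < w" and w': "w' = (iw, jw)" "iw < 2" "jw < w"
    using uw by (auto simp: frame_def)
  define j where "j = Suc j0 mod w"
  have ru: "right w u = (i, j)" by (simp add: right_def u j_def)
  have q: "(j0 = r) = (j = q)" "(j0 = 0) = (j = 1)" "q \<noteq> r"
    using u r unfolding q_def j_def by (auto simp: mod_Suc split: if_splits)
  consider "i = 0" | "i = 1" using u by linarith
  then show "of_bool (right w u \<noteq> (1, 0) \<and> right w u \<noteq> (0, r)) + of_bool (u \<noteq> (1, 0) \<and> u \<noteq> (0, r)) +
      of_bool (up 2 w r w' = (1, 0) \<or> up 2 w r w' = (1, 1)) + of_bool (w' = (1, 0) \<or> w' = (1, 1)) = (2::nat)"
  proof cases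
    case 1
    then have iw: "iw = 1" "(jw + r) mod w = j" using uw(3) ru w' by (auto simp: up_def split: if_splits)
    have "(jw = 0) = (j = r)" "(jw = 1) = (j = q)"
      using w' r iw(2) unfolding q_def by (auto simp: add_mod_if[of jw] mod_Suc split: if_splits)
    then show ?thesis
      unfolding uw(3)[symmetric] ru unfolding u(1) w'(1) 1 iw(1) using q
      by (cases "j = r"; cases "j = q") simp_all
  next
    case 2
    then have iw: "iw = 0" "jw = j" using uw(3) ru w' by (auto simp: up_def split: if_splits)
    show ?thesis
      unfolding uw(3)[symmetric] ru unfolding u(1) w'(1) 2 iw(1) using q
      by (cases "j = 0"; cases "j = 1") simp_all
  qed
next
  fix \<kappa> and P :: "nat \<times> nat \<Rightarrow> bool" and u v
  assume H: "\<And>p. p \<in> frame 2 w \<Longrightarrow> (p \<noteq> (1, 0) \<and> p \<noteq> (0, r)) = \<kappa> \<Longrightarrow> P (right w p) = P p"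
    and U: "\<And>p. p \<in> frame 2 w \<Longrightarrow> (p = (1, 0) \<or> p = (1, 1)) = \<kappa> \<Longrightarrow> P (up 2 w r p) = P p"
    and uv: "u \<in> frame 2 w" "v \<in> frame 2 w"
  have H0: "P (0, Suc j mod w) = P (0, j)" if "j < w" "(j \<noteq> r) = \<kappa>" for j
    using H[of "(0, j)"] that by (simp add: frame_def right_def)
  have H1: "P (1, Suc j mod w) = P (1, j)" if "j < w" "(j \<noteq> 0) = \<kappa>" for j
    using H[of "(1, j)"] that by (simp add: frame_def right_def)
  have U0: "P (1, j) = P (0, j)" if "j < w" "\<not> \<kappa>" for j
    using U[of "(0, j)"] that by (simp add: frame_def up_def)
  have U1: "P (0, (j + r) mod w) = P (1, j)" if "j < w" "(j = 0 \<or> j = 1) = \<kappa>" for j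
    using U[of "(1, j)"] that by (simp add: frame_def up_def)
  have "P (0, j) = P (0, 0) \<and> P (1, j) = P (0, 0)" if "j < w" for j
  proof (cases \<kappa>)
    case True
    have 0: "P (0, j) = P (0, 0)" if "j < w" for j
      using row_chain[OF r(2), of "\<lambda>j. P (0, j)" j] H0 True that by simp
    have 1: "P (1, j) = P (1, 0)" if "j < w" for j
      using row_chain[of 0 w "\<lambda>j. P (1, j)" j] H1 True that r by simp
    have "P (0, r) = P (1, 0)" using U1[of 0] True r by simp
    then show ?thesis using 0[OF that] 0[OF r(2)] 1[OF that] by simp
  next
    case False
    have "P (0, j) = P (0, 0)" if "j < w" for j
    proof (rule step_chain[OF cop, of "\<lambda>j. P (0, j)"])
      show "w \<ge> 2" using r by simp
      have "P (1, 1) = P (1, 0)" using H1[of 0] False r by simp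
      then show "P (0, 0) = P (0, 1)" using U0[of 0] U0[of 1] False r by simp
      show "P (0, (j + r) mod w) = P (0, j)" if "j < w" "j \<noteq> 0" "j \<noteq> 1" for j
        using U1[of j] U0[of j] that False by simp
    qed (use that in auto)
    from this[OF that] show ?thesis using U0[of j] that False by simp
  qed
  note claim = this
  have "P p = P (0, 0)" if p: "p \<in> frame 2 w" for p
  proof -
    obtain i j where ij: "p = (i, j)" "i < 2" "j < w" using p by (auto simp: frame_def)
    then have "i = 0 \<or> i = 1" by linarith
    then show ?thesis using claim[of j] ij by auto
  qed
  then show "P u = P v" using uv by simp
qed

text \<open>With twist 0 the columns are closed as well, and trading one square merges only two of
  three rows. Here colour \<open>True\<close> has a path through each row and one vertical edge
  between cyclically consecutive rows; the other colour has the same form with rows and columns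
  interchanged.\<close>

lemma ham_colouring_torus_3_3:
  "ham_colouring (frame 3 3) (right 3) (up 3 3 0)
    (\<lambda>p. p \<in> {(0, 0), (0, 1), (1, 0), (1, 2), (2, 1), (2, 2)}) (\<lambda>p. p \<in> {(0, 2), (1, 1), (2, 0)})"
  (is "ham_colouring _ _ _ ?h ?v")
proof -
  have fr: "frame 3 3 = {(0,0),(0,1),(0,2),(1,0),(1,1),(1,2),(2,0),(2,1),(2,2)}"
  proof -
    have "{..<3} = {0, 1, 2 :: nat}" by auto
    then show ?thesis unfolding frame_def by auto
  qed
  show ?thesis
  proof (rule ham_colouringI)
    fix u w assume uw: "u \<in> frame 3 3" "w \<in> frame 3 3" "right 3 u = up 3 3 0 w"
    obtain i j i' j' where u: "u = (i, j)" "i < 3" "j < 3" and w: "w = (i', j')" "i' < 3" "j' < 3"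
      using uw by (auto simp: frame_def)
    have w': "i' = (i + 2) mod 3" "j' = Suc j mod 3"
      using uw(3) u w by (auto simp: right_def up_def split: if_splits)
    have "i = 0 \<or> i = 1 \<or> i = 2" "j = 0 \<or> j = 1 \<or> j = 2" using u by linarith+
    then show "of_bool (?h (right 3 u)) + of_bool (?h u) + of_bool (?v (up 3 3 0 w)) + of_bool (?v w) = (2::nat)"
      unfolding uw(3)[symmetric] unfolding u(1) w(1) w'
      by (elim disjE) (simp_all add: right_def)
  next
    fix \<kappa> and P :: "nat \<times> nat \<Rightarrow> bool" and u v
    assume H: "\<And>p. p \<in> frame 3 3 \<Longrightarrow> ?h p = \<kappa> \<Longrightarrow> P (right 3 p) = P p"
      and U: "\<And>p. p \<in> frame 3 3 \<Longrightarrow> ?v p = \<kappa> \<Longrightarrow> P (up 3 3 0 p) = P p"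
      and uv: "u \<in> frame 3 3" "v \<in> frame 3 3"
    have R: "right 3 (i, 0) = (i, 1)" "right 3 (i, 1) = (i, 2)" "right 3 (i, 2) = (i, 0)" for i
      by (simp_all add: right_def)
    have T: "up 3 3 0 (0, 0) = (1, 0)" "up 3 3 0 (0, 1) = (1, 1)" "up 3 3 0 (0, 2) = (1, 2)"
      "up 3 3 0 (1, 0) = (2, 0)" "up 3 3 0 (1, 1) = (2, 1)" "up 3 3 0 (1, 2) = (2, 2)"
      "up 3 3 0 (2, 0) = (0, 0)" "up 3 3 0 (2, 1) = (0, 1)" "up 3 3 0 (2, 2) = (0, 2)"
      by (simp_all add: up_def)
    have "\<forall>p\<in>frame 3 3. P p = P (0, 0)"
    proof (cases \<kappa>)
      case True
      show ?thesis
        using True H[of "(0,0)"] H[of "(0,1)"] H[of "(1,0)"] H[of "(1,2)"] H[of "(2,1)"] H[of "(2,2)"]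
          U[of "(0,2)"] U[of "(1,1)"] U[of "(2,0)"]
        unfolding fr R T by simp
    next
      case False
      show ?thesis
        using False H[of "(0,2)"] H[of "(1,1)"] H[of "(2,0)"] U[of "(0,0)"] U[of "(0,1)"] U[of "(1,0)"]
          U[of "(1,2)"] U[of "(2,1)"] U[of "(2,2)"]
        unfolding fr R T by simp
    qed
    then show "P u = P v" using uv by simp
  qed
qed

lemma ham_colouring_transpose:
  assumes "ham_colouring (frame d n) (right n) (up d n 0) h v"
  shows "ham_colouring (frame n d) (right d) (up n d 0) (v \<circ> prod.swap) (h \<circ> prod.swap)"
proof -
  have bij: "bij_betw prod.swap (frame d n) (frame n d)"
    by (rule bij_betw_byWitness[of _ prod.swap]) (auto simp: frame_def)
  have inv: "inv_into (frame d n) prod.swap p = prod.swap p" if "p \<in> frame n d" for p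
  proof -
    have "prod.swap p \<in> frame d n" using that by (auto simp: frame_def)
    then show ?thesis using inv_into_f_f[of prod.swap "frame d n" "prod.swap p"] by (simp add: inj_swap inj_on_subset)
  qed
  have "ham_colouring (frame n d) (right d) (up n d 0)
      (v \<circ> inv_into (frame d n) prod.swap) (h \<circ> inv_into (frame d n) prod.swap)"
  proof (rule ham_colouring_transport[OF ham_colouring_swap[OF assms] bij])
    fix p assume "p \<in> frame d n"
    then obtain i j where p: "p = (i, j)" "i < d" "j < n" by (auto simp: frame_def)
    show "prod.swap (up d n 0 p) = right d (prod.swap p)"
      using p by (cases "Suc i < d") (auto simp: up_def right_def mod_Suc)
    show "prod.swap (right n p) = up n d 0 (prod.swap p)"
      using p by (cases "Suc j < n") (auto simp: up_def right_def mod_Suc)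
  qed (simp_all add: right_up_in_frame)
  note c = this
  show ?thesis
  proof (rule ham_colouringI)
    fix u w assume uw: "u \<in> frame n d" "w \<in> frame n d" "right d u = up n d 0 w"
    have "right d u \<in> frame n d" "up n d 0 w \<in> frame n d" using uw by (simp_all add: right_up_in_frame)
    then show "of_bool ((v \<circ> prod.swap) (right d u)) + of_bool ((v \<circ> prod.swap) u) +
        of_bool ((h \<circ> prod.swap) (up n d 0 w)) + of_bool ((h \<circ> prod.swap) w) = (2::nat)"
      using ham_colouring_degree[OF c uw] uw inv by simp
  next
    fix \<kappa> and P :: "nat \<times> nat \<Rightarrow> bool" and x y
    assume *: "\<And>p. p \<in> frame n d \<Longrightarrow> (v \<circ> prod.swap) p = \<kappa> \<Longrightarrow> P (right d p) = P p"
      "\<And>p. p \<in> frame n d \<Longrightarrow> (h \<circ> prod.swap) p = \<kappa> \<Longrightarrow> P (up n d 0 p) = P p"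
      "x \<in> frame n d" "y \<in> frame n d"
    show "P x = P y"
      by (rule ham_colouring_connected[OF c, where \<kappa> = \<kappa>]) (use * inv in auto)
  qed
qed

text \<open>Rows are inserted into the 3 by 3 grid, the grid is transposed, and rows are inserted
  again. The second seam consists of horizontal edges in the three original rows among others, so it
  has both colours.\<close>

lemma ham_colouring_torus_odd:
  assumes "odd d" "odd n" "d \<ge> 3" "n \<ge> 3"
  shows "\<exists>h v. ham_colouring (frame d n) (right n) (up d n 0) h v"
proof -
  obtain k l where k: "d = 3 + 2 * k" and l: "n = 3 + 2 * l"
  proof -
    have "even (d - 3)" "even (n - 3)" using assms by auto
    then have "d = 3 + 2 * ((d - 3) div 2)" "n = 3 + 2 * ((n - 3) div 2)" using assms by auto
    then show thesis by (rule that)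
  qed
  let ?h = "\<lambda>p. p \<in> ({(0, 0), (0, 1), (1, 0), (1, 2), (2, 1), (2, 2)} :: (nat \<times> nat) set)"
  let ?v = "\<lambda>p. p \<in> ({(0, 2), (1, 1), (2, 0)} :: (nat \<times> nat) set)"
  have "seam_bichromatic 3 3 ?v"
    unfolding seam_bichromatic_def by (auto intro: exI[of _ 0] exI[of _ 1])
  then obtain h' v' where 1: "ham_colouring (frame d 3) (right 3) (up d 3 0) h' v'"
    "\<forall>i<3. \<forall>j. h' (i, j) = ?h (i, j)"
    using ham_colouring_insert_many_rows[OF ham_colouring_torus_3_3 _ , of k] unfolding k by auto
  have "seam_bichromatic 3 d (h' \<circ> prod.swap)"
    unfolding seam_bichromatic_def using 1(2) k by (auto intro: exI[of _ 0] exI[of _ 1])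
  then obtain h'' v'' where "ham_colouring (frame n d) (right d) (up n d 0) h'' v''"
    using ham_colouring_insert_many_rows[OF ham_colouring_transpose[OF 1(1)], of l] unfolding l by auto
  then show ?thesis using ham_colouring_transpose by blast
qed

text \<open>The grid is the circulant with steps \<open>1\<close> and \<open>r\<close>, where
  \<open>r\<close> need not be a unit. With the roles of the steps exchanged it becomes a grid of
  \<open>e = gcd r n\<close> rows, the cosets of the multiples of \<open>r\<close>, with a twist
  \<open>r2\<close> inverse to \<open>a\<close> modulo \<open>w\<close>. That twist is a unit, so
  the one-row colouring applies, and \<open>e\<close> is odd, so the other rows come in
  pairs.\<close>

lemma ham_colouring_one_row_odd:
  assumes n: "odd n" and r: "0 < r" "r < n"
  shows "\<exists>h v. ham_colouring (frame 1 n) (right n) (up 1 n r) h v \<and> seam_bichromatic 1 n v"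
proof -
  define e where "e = gcd r n"
  define w where "w = n div e"
  define a where "a = r div e"
  have e0: "e > 0" using r by (simp add: e_def)
  have n': "n = e * w" and r': "r = e * a" by (simp_all add: e_def w_def a_def)
  have cop: "coprime a w"
    unfolding a_def w_def e_def using r by (intro div_gcd_coprime) auto
  have w3: "w \<ge> 3"
  proof -
    have "w \<noteq> 0" using r n' by (intro notI) simp
    moreover have "w \<noteq> 1" using r unfolding n' r' by (cases a) auto
    moreover have "odd w" using n n' by simp
    ultimately show ?thesis by (cases "w = 2") auto
  qed
  obtain r2 where r2: "r2 < w" "r2 * a mod w = 1 mod w" using unit_solve[OF cop, of 1] w3 by auto
  have "coprime r2 w"
  proof (rule coprimeI)
    fix c assume c: "c dvd r2" "c dvd w"
    then have "c dvd r2 * a mod w" by (simp add: dvd_mod)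
    then show "is_unit c" using r2(2) w3 by simp
  qed
  moreover have "r2 > 0" using r2 w3 by (cases r2) auto
  ultimately have base: "ham_colouring (frame 1 w) (right w) (up 1 w r2)
    (\<lambda>p. snd p \<noteq> 0 \<and> snd p \<noteq> r2) (\<lambda>p. snd p = 0 \<or> snd p = 1)"
    using r2(1) by (intro ham_colouring_one_row)
  have "odd e" using n n' by simp
  then obtain k where k: "e = 1 + 2 * k" by (metis add.commute oddE)
  have "seam_bichromatic 1 w (\<lambda>p. snd p = 0 \<or> snd p = 1)"
    unfolding seam_bichromatic_def
    by (rule conjI, rule exI[of _ 0], use w3 in simp, rule exI[of _ 2], use w3 in simp)
  then obtain h v where hv: "ham_colouring (frame e w) (right w) (up e w r2) h v"
    "\<And>j. h (0, j) = (j \<noteq> 0 \<and> j \<noteq> r2)"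
    using ham_colouring_insert_many_rows[OF base, of k] unfolding k by auto
  obtain ca cb where c: "ham_colouring {..<e * w} (\<lambda>v. (v + e * a) mod (e * w)) (\<lambda>v. (v + 1) mod (e * w)) ca cb"
    and ca: "\<And>p. p \<in> frame e w \<Longrightarrow> \<exists>v<e * w. ca v = h p"
    using frame_to_circulant[OF hv(1) cop, of 1] e0 w3 r2 by auto
  have c': "ham_colouring {..<n} (\<lambda>v. (v + 1) mod n) (\<lambda>v. (v + r) mod n) cb ca"
    using ham_colouring_swap[OF c] by (simp add: n' r')
  have bij: "bij_betw (Pair 0) {..<n} (frame 1 n)"
    by (rule bij_betw_byWitness[of _ snd]) (auto simp: frame_def)
  have "ham_colouring (frame 1 n) (right n) (up 1 n r)
      (cb \<circ> inv_into {..<n} (Pair 0)) (ca \<circ> inv_into {..<n} (Pair 0))"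
    using r by (intro ham_colouring_transport[OF c' bij]) (auto simp: right_def up_def)
  moreover have "seam_bichromatic 1 n (ca \<circ> inv_into {..<n} (Pair (0::nat)))"
  proof -
    have inv: "inv_into {..<n} (Pair (0::nat)) (0, j) = j" if "j < n" for j
      using that by (intro inv_into_f_eq) (auto simp: inj_on_def)
    \<comment> \<open>Columns 0 and \<open>j\<close> of the first row have different horizontal
      colours; these are the colours of steps by \<open>r\<close> in the circulant.\<close>
    obtain j where j: "j < w" "j \<noteq> 0" "j \<noteq> r2"
      using w3 by (cases "r2 = 1") (auto intro: that[of 1] that[of 2])
    have "(0, 0) \<in> frame e w" "(0, j) \<in> frame e w" using e0 w3 j by (auto simp: frame_def)
    then obtain v1 v2 where "v1 < n" "\<not> ca v1" "v2 < n" "ca v2"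
      using ca[of "(0, 0)"] ca[of "(0, j)"] hv(2) j by (auto simp: n')
    then show ?thesis unfolding seam_bichromatic_def using inv by auto
  qed
  ultimately show ?thesis by blast
qed

text \<open>The coprimality assumption says that \<open>a\<close> and \<open>b\<close> generate all
  residues. The cosets of the multiples of \<open>a\<close> are the rows; a nonzero twist is treated
  by enlarging a one-row grid, and twist 0 by the untwisted torus.\<close>

lemma ham_colouring_circulant_odd:
  fixes t a b :: nat
  assumes t: "odd t" and ab: "0 < a" "a < t" "0 < b" "b < t" "coprime b (gcd a t)"
  shows "\<exists>ca cb. ham_colouring {..<t} (\<lambda>v. (v + a) mod t) (\<lambda>v. (v + b) mod t) ca cb"
proof -
  define d where "d = gcd a t"
  define n where "n = t div d"
  define a' where "a' = a div d"
  have d0: "d > 0" using ab by (simp add: d_def)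
  have t': "t = d * n" and a: "a = d * a'" by (simp_all add: d_def n_def a'_def)
  have cop: "coprime a' n" unfolding a'_def n_def d_def using ab by (intro div_gcd_coprime) auto
  have n3: "n \<ge> 3"
  proof -
    have "n \<noteq> 0" using ab t' by (intro notI) simp
    moreover have "n \<noteq> 1" using ab(1,2) unfolding t' a by (cases a') auto
    moreover have "odd n" using t t' by simp
    ultimately show ?thesis by (cases "n = 2") auto
  qed
  obtain r where r: "r < n" "r * a' mod n = b mod n" using unit_solve[OF cop, of b] n3 by auto
  have odd: "odd d" "odd n" using t t' by auto
  have "\<exists>h v. ham_colouring (frame d n) (right n) (up d n r) h v"
  proof (cases "r = 0")
    case False
    then obtain h v where hv: "ham_colouring (frame 1 n) (right n) (up 1 n r) h v" "seam_bichromatic 1 n v"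
      using ham_colouring_one_row_odd[OF odd(2), of r] r by auto
    obtain k where k: "d = 1 + 2 * k" using odd(1) by (metis add.commute oddE)
    show ?thesis using ham_colouring_insert_many_rows[OF hv(1) _ hv(2), of k] unfolding k by auto
  next
    case True
    \<comment> \<open>A single row cannot have twist 0: \<open>d = 1\<close> would give
      \<open>t dvd b\<close>.\<close>
    then have "n dvd b" using r(2) by auto
    then have "d \<noteq> 1" using ab t' nat_dvd_not_less by auto
    then have "d \<ge> 3" using odd(1) d0 by (cases "d = 2") auto
    then show ?thesis using ham_colouring_torus_odd[OF odd _ n3] True by simp
  qed
  then obtain h v where hv: "ham_colouring (frame d n) (right n) (up d n r) h v" by blast
  have "coprime b d" "n > 0" using ab(5) n3 by (simp_all add: d_def)
  then obtain ca cb where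
    "ham_colouring {..<d * n} (\<lambda>v. (v + d * a') mod (d * n)) (\<lambda>v. (v + b) mod (d * n)) ca cb"
    using frame_to_circulant[OF hv cop _ d0 _ r(2)] by metis
  then show ?thesis unfolding t'[symmetric] a[symmetric] by blast
qed

text \<open>The number \<open>gcd a t\<close> of rows is even, so the rows grow in pairs from the
  two-row grid. The bound \<open>2 * a < t\<close> makes them at least 3 long, so that the two
  switched columns do not fill the seam.\<close>

lemma ham_colouring_circulant_even:
  fixes t a :: nat
  assumes t: "even t" and a: "even a" "0 < a" "2 * a < t"
  shows "\<exists>ca cb. ham_colouring {..<t} (\<lambda>v. (v + 1) mod t) (\<lambda>v. (v + a) mod t) ca cb"
proof -
  define e where "e = gcd a t"
  define w where "w = t div e"
  define a' where "a' = a div e"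
  have e0: "e > 0" using a by (simp add: e_def)
  have t': "t = e * w" and a'': "a = e * a'" by (simp_all add: e_def w_def a'_def)
  have cop: "coprime a' w" unfolding a'_def w_def e_def using a by (intro div_gcd_coprime) auto
  have "a' > 0" using a a'' by (cases a') auto
  have "e * (2 * a') < e * w" using a(3) unfolding a'' t' by (simp add: ac_simps)
  then have w3: "w \<ge> 3" using \<open>a' > 0\<close> by simp
  obtain r2 where r2: "r2 < w" "r2 * a' mod w = 1 mod w" using unit_solve[OF cop, of 1] w3 by auto
  have "coprime r2 w"
  proof (rule coprimeI)
    fix c assume c: "c dvd r2" "c dvd w"
    then have "c dvd r2 * a' mod w" by (simp add: dvd_mod)
    then show "is_unit c" using r2(2) w3 by simp
  qed
  moreover have "r2 > 0" using r2 w3 by (cases r2) auto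
  ultimately have base: "ham_colouring (frame 2 w) (right w) (up 2 w r2)
      (\<lambda>p. p \<noteq> (1, 0) \<and> p \<noteq> (0, r2)) (\<lambda>p. p = (1, 0) \<or> p = (1, 1))"
    using r2(1) by (intro ham_colouring_two_rows)
  have "even e" "e \<ge> 2" using t a e0 by (auto simp: e_def intro: dvd_imp_le)
  then obtain k where k: "e = 2 + 2 * k" by (metis add_diff_inverse_nat dvd_diff_nat evenE even_numeral not_less)
  have "seam_bichromatic 2 w (\<lambda>p. p = (1, 0) \<or> p = (1, 1))"
    unfolding seam_bichromatic_def
    by (rule conjI, rule exI[of _ 0], use w3 in simp, rule exI[of _ 2], use w3 in simp)
  then obtain h v where hv: "ham_colouring (frame e w) (right w) (up e w r2) h v"
    using ham_colouring_insert_many_rows[OF base, of k] unfolding k by auto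
  obtain ca cb where "ham_colouring {..<e * w} (\<lambda>v. (v + e * a') mod (e * w)) (\<lambda>v. (v + 1) mod (e * w)) ca cb"
    by (rule frame_to_circulant[OF hv cop _ e0 _ r2(2)]) (use w3 in simp_all)
  then show ?thesis using ham_colouring_swap unfolding a'' t' by blast
qed

section \<open>Hamiltonian cycles in circulants\<close>

lemma add_mod_cancel: "u < t \<Longrightarrow> x \<le> t \<Longrightarrow> ((u + x) mod t + (t - x)) mod t = (u::nat)"
  by (subst mod_add_left_eq) simp

lemma add_mod_cancel': "u < t \<Longrightarrow> x \<le> t \<Longrightarrow> ((u + (t - x)) mod t + x) mod t = (u::nat)"
  by (subst mod_add_left_eq) simp

lemma bij_add_mod: "bij_betw (\<lambda>v. (v + x) mod t) {..<t} {..<(t::nat)}"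
proof -
  have inj: "inj_on (\<lambda>v. (v + x) mod t) {..<t}" by (auto intro!: inj_onI elim: add_mod_inj)
  moreover have "(\<lambda>v. (v + x) mod t) ` {..<t} = {..<t}"
    using inj by (intro endo_inj_surj) auto
  ultimately show ?thesis by (simp add: bij_betw_def)
qed

lemma circ_pair_subset:
  assumes "x < t"
  shows "circ t {x, t - x} \<subseteq> (\<Union>v\<in>{..<t}. {(v, (v + x) mod t), ((v + x) mod t, v)})"
proof
  fix e assume "e \<in> circ t {x, t - x}"
  then obtain u \<delta> where u: "u < t" "\<delta> = x \<or> \<delta> = t - x" "e = (u, (u + \<delta>) mod t)"
    by (auto simp: circ_def)
  have "((u + (t - x)) mod t + x) mod t = u" using u(1) assms by (intro add_mod_cancel') auto
  then show "e \<in> (\<Union>v\<in>{..<t}. {(v, (v + x) mod t), ((v + x) mod t, v)})"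
    using u by (intro UN_I[of "if \<delta> = x then u else (u + (t - x)) mod t"]) (auto split: if_splits)
qed

lemma ham_colouring_circulant_covers:
  fixes t a b :: nat
  assumes c: "ham_colouring {..<t} (\<lambda>v. (v + a) mod t) (\<lambda>v. (v + b) mod t) ca cb"
    and ab: "0 < a" "a < b" "2 * b < t"
  shows "covers [t] {..<t} 4 (circ t {a, t - a, b, t - b})"
proof -
  have "covers [card {..<t}] {..<t} 4 (\<Union>v\<in>{..<t}. {(v, (v + a) mod t), ((v + a) mod t, v), (v, (v + b) mod t), ((v + b) mod t, v)})"
  proof (rule ham_colouring_covers[OF c])
    fix v assume "v \<in> {..<t}"
    then have v: "v < t" by simp
    have two: "((v + x) mod t + y) mod t \<noteq> v" if "0 < x + y" "x + y < t" for x y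
      using add_mod_neq[OF v that] by (simp add: mod_add_left_eq add.assoc)
    show "(v + a) mod t \<noteq> v \<and> (v + b) mod t \<noteq> v \<and> ((v + a) mod t + a) mod t \<noteq> v \<and> ((v + b) mod t + b) mod t \<noteq> v"
      using two[of a a] two[of b b] add_mod_neq[OF v, of a] add_mod_neq[OF v, of b] ab by auto
    have "(v + a) mod t \<noteq> (v + b) mod t"
    proof
      assume "(v + a) mod t = (v + b) mod t"
      then have "(a + v) mod t = (b + v) mod t" by (simp add: add.commute)
      then show False using add_mod_inj[of a t b v] ab by simp
    qed
    then show "(v + a) mod t \<noteq> (v + b) mod t \<and> ((v + b) mod t + a) mod t \<noteq> v \<and> ((v + a) mod t + b) mod t \<noteq> v"
      using two[of a b] two[of b a] ab by simp
  qed (use ab bij_add_mod in auto)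
  then have *: "covers [t] {..<t} 4 (\<Union>v\<in>{..<t}. {(v, (v + a) mod t), ((v + a) mod t, v), (v, (v + b) mod t), ((v + b) mod t, v)})"
    by simp
  have "circ t {a, t - a, b, t - b} = circ t {a, t - a} \<union> circ t {b, t - b}"
    by (auto simp: circ_def)
  then show ?thesis
    using circ_pair_subset[of a t] circ_pair_subset[of b t] ab by (intro covers_mono[OF *]) auto
qed

definition near :: "nat \<Rightarrow> nat \<Rightarrow> nat set" where
  "near t p = {\<delta>. 0 < \<delta> \<and> \<delta> < t \<and> (\<delta> \<le> p \<or> t - \<delta> \<le> p)}"

lemma circ_mono: "R \<subseteq> R' \<Longrightarrow> circ t R \<subseteq> circ t R'"
  by (auto simp: circ_def)

lemma circ_UN: "circ t (\<Union>i\<in>I. R i) = (\<Union>i\<in>I. circ t (R i))"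
  by (auto simp: circ_def)

lemma circ_Un: "circ t (R \<union> R') = circ t R \<union> circ t R'"
  by (auto simp: circ_def)

text \<open>Consecutive numbers are coprime and hence generate the residues.\<close>

lemma covers_consecutive_odd:
  assumes t: "odd t" and a: "0 < a" "2 * Suc a < t"
  shows "covers [t] {..<t} 4 (circ t {a, t - a, Suc a, t - Suc a})"
proof -
  have "coprime (Suc a) (gcd a t)"
  proof (rule coprimeI)
    fix c assume c: "c dvd Suc a" "c dvd gcd a t"
    then have "c dvd a" using dvd_trans by fastforce
    then show "is_unit c" using c(1) by (metis dvd_add_right_iff Suc_eq_plus1)
  qed
  then obtain ca cb where "ham_colouring {..<t} (\<lambda>v. (v + a) mod t) (\<lambda>v. (v + Suc a) mod t) ca cb"
    using ham_colouring_circulant_odd[OF t, of a "Suc a"] a by auto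
  then show ?thesis by (rule ham_colouring_circulant_covers) (use a in auto)
qed

text \<open>For even \<open>p\<close> the differences are taken up to sign in pairs (1, 2), (3, 4),
  and so on. For odd \<open>p\<close> the differences \<open>1\<close> and \<open>t - 1\<close> are
  units, and the pairs start at 2.\<close>

lemma covers_near_odd:
  assumes t: "odd t" and p: "2 * p < t"
  shows "covers [t] {..<t} (2 * p) (circ t (near t p))"
proof -
  have main: "covers [t] {..<t} (4 * k) (\<Union>l<k. circ t {q + 2 * l, t - (q + 2 * l), Suc (q + 2 * l), t - Suc (q + 2 * l)})"
    if "q > 0" "2 * (q + 2 * k) \<le> t + 1" for q k
  proof -
    have "covers [t] {..<t} (\<Sum>l<k. 4) (\<Union>l<k. circ t {q + 2 * l, t - (q + 2 * l), Suc (q + 2 * l), t - Suc (q + 2 * l)})"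
    proof (rule covers_UN)
      fix l assume "l < k"
      then show "covers [t] {..<t} 4 (circ t {q + 2 * l, t - (q + 2 * l), Suc (q + 2 * l), t - Suc (q + 2 * l)})"
        using that t by (intro covers_consecutive_odd) (auto elim!: oddE)
    qed
    then show ?thesis by (simp add: mult.commute)
  qed
  show ?thesis
  proof (cases "even p")
    case True
    then obtain k where k: "p = 2 * k" by blast
    have "near t p \<subseteq> (\<Union>l<k. {1 + 2 * l, t - (1 + 2 * l), Suc (1 + 2 * l), t - Suc (1 + 2 * l)})"
    proof
      fix \<delta> assume "\<delta> \<in> near t p"
      then obtain \<epsilon> where e: "0 < \<epsilon>" "\<epsilon> \<le> p" "\<delta> = \<epsilon> \<or> \<delta> = t - \<epsilon>"
        unfolding near_def by (cases "\<delta> \<le> p") (auto intro: that[of \<delta>] that[of "t - \<delta>"])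
      then have "(\<epsilon> - 1) div 2 < k" "\<epsilon> = 1 + 2 * ((\<epsilon> - 1) div 2) \<or> \<epsilon> = Suc (1 + 2 * ((\<epsilon> - 1) div 2))"
        using k by linarith+
      then show "\<delta> \<in> (\<Union>l<k. {1 + 2 * l, t - (1 + 2 * l), Suc (1 + 2 * l), t - Suc (1 + 2 * l)})"
        using e(3) by (intro UN_I[of "(\<epsilon> - 1) div 2"]) auto
    qed
    then have "circ t (near t p) \<subseteq> (\<Union>l<k. circ t {1 + 2 * l, t - (1 + 2 * l), Suc (1 + 2 * l), t - Suc (1 + 2 * l)})"
      unfolding circ_UN[symmetric] by (rule circ_mono)
    then show ?thesis using covers_mono[OF main[of 1 k]] k p by simp
  next
    case False
    then obtain k where k: "p = 2 * k + 1" by (elim oddE)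
    have 1: "covers [t] {..<t} 1 (circ t {1})" using k p by (intro covers_unit) auto
    have "coprime (t - 1) t" using p by (intro coprime_diff_one_left_nat) auto
    then have 2: "covers [t] {..<t} 1 (circ t {t - 1})" using k p by (intro covers_unit) auto
    have 3: "covers [t] {..<t} (4 * k) (\<Union>l<k. circ t {2 + 2 * l, t - (2 + 2 * l), Suc (2 + 2 * l), t - Suc (2 + 2 * l)})"
      using k p by (intro main) auto
    have "near t p \<subseteq> {1} \<union> {t - 1} \<union> (\<Union>l<k. {2 + 2 * l, t - (2 + 2 * l), Suc (2 + 2 * l), t - Suc (2 + 2 * l)})"
    proof
      fix \<delta> assume "\<delta> \<in> near t p"
      then obtain \<epsilon> where e: "0 < \<epsilon>" "\<epsilon> \<le> p" "\<delta> = \<epsilon> \<or> \<delta> = t - \<epsilon>"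
        unfolding near_def by (cases "\<delta> \<le> p") (auto intro: that[of \<delta>] that[of "t - \<delta>"])
      show "\<delta> \<in> {1} \<union> {t - 1} \<union> (\<Union>l<k. {2 + 2 * l, t - (2 + 2 * l), Suc (2 + 2 * l), t - Suc (2 + 2 * l)})"
      proof (cases "\<epsilon> = 1")
        case False
        then have "(\<epsilon> - 2) div 2 < k" "\<epsilon> = 2 + 2 * ((\<epsilon> - 2) div 2) \<or> \<epsilon> = Suc (2 + 2 * ((\<epsilon> - 2) div 2))"
          using k e(1,2) by linarith+
        then show ?thesis using e(3) by (intro UnI2 UN_I[of "(\<epsilon> - 2) div 2"]) auto
      qed (use e in auto)
    qed
    then have "circ t (near t p) \<subseteq> circ t {1} \<union> circ t {t - 1} \<union>
        (\<Union>l<k. circ t {2 + 2 * l, t - (2 + 2 * l), Suc (2 + 2 * l), t - Suc (2 + 2 * l)})"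
      unfolding circ_UN[symmetric] circ_Un[symmetric] by (rule circ_mono)
    from covers_mono[OF covers_Un[OF covers_Un[OF 1 2] 3] this]
    have "covers [t] {..<t} (1 + 1 + 4 * k) (circ t (near t p))" .
    moreover have "1 + 1 + 4 * k = 2 * p" using k by simp
    ultimately show ?thesis by (simp only:)
  qed
qed

text \<open>For even \<open>t\<close> and odd \<open>x\<close>: the perfect matching joining each even \<open>e\<close> to \<open>e + x\<close>, in both directions.\<close>
definition mat :: "nat \<Rightarrow> nat \<Rightarrow> (nat \<times> nat) set" where
  "mat t x = (\<Union>e\<in>{e. e < t \<and> even e}. {(e, (e + x) mod t), ((e + x) mod t, e)})"

lemma even_add_mod: "even t \<Longrightarrow> even ((u + x) mod t) = even (u + (x::nat))"
  by (simp add: dvd_mod_iff)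

lemma mat_evenI: "u < t \<Longrightarrow> even u \<Longrightarrow> y mod t = x mod t \<Longrightarrow> v = (u + y) mod t \<Longrightarrow> (u, v) \<in> mat t x"
  unfolding mat_def using mod_add_right_eq[of u x t] mod_add_right_eq[of u y t] by auto

lemma mat_oddI:
  assumes "even t" "odd y" "u < t" "odd u" "y < t" "(t - y) mod t = x mod t" "v = (u + y) mod t"
  shows "(u, v) \<in> mat t x"
proof -
  have v: "v < t" "even v" using assms by (auto simp: even_add_mod)
  have "(v + x) mod t = (v + (t - y)) mod t" using assms(6) by (metis mod_add_right_eq)
  also have "\<dots> = u" using assms(3,5,7) add_mod_cancel[of u t y] by simp
  finally show ?thesis unfolding mat_def using v by auto
qed

lemma gcd_minus_2:
  assumes "even t" "t > 0"
  shows "gcd (t - 2) t = (2::nat)"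
proof -
  have "2 \<le> t" using assms by auto
  then have "gcd (t - 2) t = gcd 2 t" by (rule gcd_diff2_nat)
  then show ?thesis using assms(1) by (simp add: gcd_nat.absorb1)
qed

text \<open>The two matchings together are one Hamiltonian cycle. The cycle \<open>C\<close> takes
  the steps \<open>x\<close> and \<open>- 2 - x\<close> in turn, and \<open>D\<close> takes
  \<open>x + 2\<close> and \<open>- x\<close>: these are its two orientations.\<close>

lemma covers_mat_pair:
  assumes t: "even t" "t > 0" and x: "odd x"
  shows "covers [t] {..<t} 2 (mat t x \<union> mat t (x + 2))"
proof -
  have t2: "t \<ge> 2" using t by auto
  obtain C where C: "factor [t] {..<t} C" "\<And>e. e < t \<Longrightarrow> even e \<Longrightarrow> (e, (e + x) mod t) \<in> C"
    "\<And>e. e < t \<Longrightarrow> even e \<Longrightarrow> ((e + x) mod t, (e + (t - 2)) mod t) \<in> C"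
    using alternating_ham[OF t(1) x gcd_minus_2[OF t] t(2)] by metis
  have "gcd 2 t = 2" "odd (x + 2)" using t x by (simp_all add: gcd_nat.absorb1)
  then obtain D where D: "factor [t] {..<t} D" "\<And>e. e < t \<Longrightarrow> even e \<Longrightarrow> (e, (e + (x + 2)) mod t) \<in> D"
    "\<And>e. e < t \<Longrightarrow> even e \<Longrightarrow> ((e + (x + 2)) mod t, (e + 2) mod t) \<in> D"
    using alternating_ham[OF t(1) _ _ t(2), of "x + 2" 2] by metis
  have C4: "((e + (x + 2)) mod t, e) \<in> C" if e: "e < t" "even e" for e
  proof -
    have "(((e + 2) mod t + x) mod t, ((e + 2) mod t + (t - 2)) mod t) \<in> C"
      using e t by (intro C(3)) (auto simp: dvd_mod_iff)
    moreover have "((e + 2) mod t + (t - 2)) mod t = e" using e t2 by (intro add_mod_cancel)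
    moreover have "((e + 2) mod t + x) mod t = (e + (x + 2)) mod t"
      by (subst mod_add_left_eq) (simp add: ac_simps)
    ultimately show ?thesis by simp
  qed
  have D4: "((e + x) mod t, e) \<in> D" if e: "e < t" "even e" for e
  proof -
    have "(((e + (t - 2)) mod t + (x + 2)) mod t, ((e + (t - 2)) mod t + 2) mod t) \<in> D"
      using e t t2 by (intro D(3)) (auto simp: dvd_mod_iff)
    moreover have "((e + (t - 2)) mod t + 2) mod t = e" using e t2 by (intro add_mod_cancel')
    moreover have "((e + (t - 2)) mod t + (x + 2)) mod t = (e + x) mod t"
    proof -
      have "e + (t - 2) + (x + 2) = e + x + t" using t2 by simp
      then have "((e + (t - 2)) mod t + (x + 2)) mod t = (e + x + t) mod t"
        by (simp only: mod_add_left_eq)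
      then show ?thesis by simp
    qed
    ultimately show ?thesis by simp
  qed
  have "mat t x \<union> mat t (x + 2) \<subseteq> C \<union> D"
    unfolding mat_def using C(2) C4 D(2) D4 by auto
  then show ?thesis
    using covers_mono[OF covers_Un[OF covers_1[OF C(1) order_refl] covers_1[OF D(1) order_refl]]]
    by (simp add: numeral_2_eq_2)
qed

text \<open>
  The matchings \<open>mat t x\<close> and \<open>mat t (x + 2)\<close> form a Hamiltonian cycle in which \<open>v\<close> and \<open>v + a\<close>
  are at distance \<open>a\<close>, so that the case of the circulant with connection set \<open>{\<plusminus>1, \<plusminus>a}\<close> applies.
\<close>
lemma covers_mat_pair_even:
  assumes t: "even t" and x: "odd x" and a: "even a" "0 < a" "2 * a < t"
  shows "covers [t] {..<t} 4 (mat t x \<union> mat t (x + 2) \<union> circ t {a, t - a})"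
proof -
  obtain ca cb where c: "ham_colouring {..<t} (\<lambda>v. (v + 1) mod t) (\<lambda>v. (v + a) mod t) ca cb"
    using ham_colouring_circulant_even[OF t a] by blast
  have "a \<noteq> 1" using a by auto
  then have 1: "covers [t] {..<t} 4 (circ t {1, t - 1, a, t - a})"
    using a by (intro ham_colouring_circulant_covers[OF c]) auto
  \<comment> \<open>Even vertices stay fixed and odd ones move by \<open>x + 1\<close>. The steps
    \<open>1\<close> and \<open>- 1\<close> from an even vertex become \<open>x + 2\<close> and
    \<open>x\<close>, and even differences are preserved.\<close>
  define \<psi> where "\<psi> v = (if even v then v else (v + (x + 1)) mod t)" for v
  have par: "even (\<psi> v) = even v" for v using t x by (simp add: \<psi>_def dvd_mod_iff)
  have lt: "\<psi> v < t" if "v < t" for v using that a by (simp add: \<psi>_def)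
  have inj: "inj_on \<psi> {..<t}"
  proof (rule inj_onI)
    fix u v assume uv: "u \<in> {..<t}" "v \<in> {..<t}" "\<psi> u = \<psi> v"
    then have "even u = even v" using par by metis
    then show "u = v" using uv add_mod_inj[of u t v "x + 1"] by (auto simp: \<psi>_def split: if_splits)
  qed
  have im: "\<psi> ` {..<t} = {..<t}" using inj lt by (intro endo_inj_surj) auto
  have 2: "covers [t] {..<t} 4 (map_prod \<psi> \<psi> ` circ t {1, t - 1, a, t - a})"
    using covers_image[OF 1 inj] by (simp add: im)
  have I: "(\<psi> v, \<psi> ((v + \<delta>) mod t)) \<in> map_prod \<psi> \<psi> ` circ t {1, t - 1, a, t - a}"
    if "v < t" "\<delta> \<in> {1, t - 1, a, t - a}" for v \<delta>
    using imageI[OF circI[OF that refl], of "map_prod \<psi> \<psi>"] by simp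
  have shift: "\<psi> ((v + \<delta>) mod t) = (\<psi> v + \<delta>) mod t" if "even \<delta>" "v < t" for v \<delta>
  proof -
    have "((v + \<delta>) mod t + (x + 1)) mod t = ((v + (x + 1)) mod t + \<delta>) mod t"
      by (simp only: mod_add_left_eq add.assoc add.commute[of \<delta>])
    moreover have "even ((v + \<delta>) mod t) = even v" using that t by (simp add: dvd_mod_iff)
    ultimately show ?thesis by (simp add: \<psi>_def)
  qed
  have A: "circ t {a, t - a} \<subseteq> map_prod \<psi> \<psi> ` circ t {1, t - 1, a, t - a}"
  proof (clarsimp simp only: circ_def[of t "{a, t - a}"] mem_Collect_eq)
    fix u \<delta> assume u: "u < t" "\<delta> \<in> {a, t - a}"
    obtain v where v: "v < t" "u = \<psi> v" using im u(1) by auto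
    have "even \<delta>" using u t a by auto
    then show "(u, (u + \<delta>) mod t) \<in> map_prod \<psi> \<psi> ` circ t {1, t - 1, a, t - a}"
      using I[of v \<delta>] shift[of \<delta> v] u v by auto
  qed
  have odd_next: "\<psi> ((e + 1) mod t) = (e + (x + 2)) mod t" "\<psi> ((e + (t - 1)) mod t) = (e + x) mod t"
    if e: "e < t" "even e" for e
  proof -
    have "\<not> even ((e + 1) mod t)" "\<not> even ((e + (t - 1)) mod t)" using t e a by (auto simp: dvd_mod_iff)
    then have "\<psi> ((e + 1) mod t) = ((e + 1) mod t + (x + 1)) mod t"
      "\<psi> ((e + (t - 1)) mod t) = ((e + (t - 1)) mod t + (x + 1)) mod t" by (auto simp: \<psi>_def)
    moreover have "((e + 1) mod t + (x + 1)) mod t = (e + (x + 2)) mod t"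
      by (simp only: mod_add_left_eq) (simp add: ac_simps)
    moreover have "((e + (t - 1)) mod t + (x + 1)) mod t = (e + x + t) mod t"
      using a by (simp only: mod_add_left_eq) (simp add: ac_simps)
    ultimately show "\<psi> ((e + 1) mod t) = (e + (x + 2)) mod t" "\<psi> ((e + (t - 1)) mod t) = (e + x) mod t"
      by simp_all
  qed
  have M: "(e, (e + x) mod t) \<in> map_prod \<psi> \<psi> ` circ t {1, t - 1, a, t - a}"
    "(e, (e + (x + 2)) mod t) \<in> map_prod \<psi> \<psi> ` circ t {1, t - 1, a, t - a}"
    "((e + x) mod t, e) \<in> map_prod \<psi> \<psi> ` circ t {1, t - 1, a, t - a}"
    "((e + (x + 2)) mod t, e) \<in> map_prod \<psi> \<psi> ` circ t {1, t - 1, a, t - a}"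
    if e: "e < t" "even e" for e
  proof -
    have \<psi>e: "\<psi> e = e" using e by (simp add: \<psi>_def)
    show "(e, (e + x) mod t) \<in> map_prod \<psi> \<psi> ` circ t {1, t - 1, a, t - a}"
      "(e, (e + (x + 2)) mod t) \<in> map_prod \<psi> \<psi> ` circ t {1, t - 1, a, t - a}"
      using I[of e "t - 1"] I[of e 1] odd_next[OF e] e \<psi>e by auto
    have "((e + (t - 1)) mod t + 1) mod t = e" using e by (intro add_mod_cancel') auto
    then show "((e + x) mod t, e) \<in> map_prod \<psi> \<psi> ` circ t {1, t - 1, a, t - a}"
      using I[of "(e + (t - 1)) mod t" 1] odd_next[OF e] e \<psi>e by auto
    have "((e + 1) mod t + (t - 1)) mod t = e" using e by (intro add_mod_cancel) auto
    then show "((e + (x + 2)) mod t, e) \<in> map_prod \<psi> \<psi> ` circ t {1, t - 1, a, t - a}"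
      using I[of "(e + 1) mod t" "t - 1"] odd_next[OF e] e \<psi>e by auto
  qed
  have "mat t x \<union> mat t (x + 2) \<subseteq> map_prod \<psi> \<psi> ` circ t {1, t - 1, a, t - a}"
    unfolding mat_def using M by blast
  from covers_mono[OF 2 Un_least[OF this A]] show ?thesis .
qed

text \<open>From an even vertex the difference \<delta> is a forward arc of a matching; from an odd
  vertex it is a backward arc of the matching for \<open>t - \<delta>\<close>.\<close>

lemma circ_odd_subset_mats:
  assumes "even t" "\<And>\<delta>. \<delta> \<in> R \<Longrightarrow> odd \<delta> \<Longrightarrow> \<delta> < t \<and> t - \<delta> \<in> R"
    and "\<And>\<delta>. \<delta> \<in> R \<Longrightarrow> odd \<delta> \<Longrightarrow> \<exists>y\<in>Y. y mod t = \<delta>"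
  shows "circ t {\<delta>\<in>R. odd \<delta>} \<subseteq> (\<Union>y\<in>Y. mat t y)"
proof (clarsimp simp: circ_def)
  fix u \<delta> assume u: "u < t" and d: "\<delta> \<in> R" "odd \<delta>"
  note lt = assms(2)[OF d]
  show "\<exists>y\<in>Y. (u, (u + \<delta>) mod t) \<in> mat t y"
  proof (cases "even u")
    case True
    obtain y where "y \<in> Y" "y mod t = \<delta>" using assms(3)[OF d] by blast
    then show ?thesis using u True lt by (intro bexI[of _ y] mat_evenI[of _ _ \<delta>]) auto
  next
    case False
    have "odd (t - \<delta>)" using assms(1) d lt by simp
    then obtain y where "y \<in> Y" "y mod t = t - \<delta>" using assms(3)[of "t - \<delta>"] lt by blast
    moreover have "\<delta> > 0" using d by (cases \<delta>) auto
    ultimately show ?thesis using u False lt d assms(1) by (intro bexI[of _ y] mat_oddI[of _ \<delta>]) auto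
  qed
qed

lemma circ_split_parity: "circ t R = circ t {\<delta>\<in>R. odd \<delta>} \<union> circ t {\<delta>\<in>R. even \<delta>}"
  by (auto simp: circ_def)

lemma near_sym: "\<delta> \<in> near t p \<Longrightarrow> \<delta> < t \<and> t - \<delta> \<in> near t p"
  by (auto simp: near_def)

text \<open>The odd differences run from \<open>1 - 2 * K\<close> to \<open>2 * K - 1\<close> and
  are grouped consecutively into \<open>K\<close> pairs of matchings. Each pair of opposite even
  differences is combined with one such pair; for odd \<open>p\<close> one pair of matchings is left
  over and is covered by itself.\<close>

lemma covers_near_even:
  assumes t: "even t" and p: "2 * p < t"
  shows "covers [t] {..<t} (2 * p) (circ t (near t p))"
proof -
  define K where "K = (p + 1) div 2"
  \<comment> \<open>This is the odd residue \<open>4 * l + 1 - 2 * K\<close>, raised by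
    \<open>t\<close> to remain positive.\<close>
  define x where "x l = t + 1 + 4 * l - 2 * K" for l
  have K: "2 * K \<le> t" using p by (auto simp: K_def)
  have xodd: "odd (x l)" for l using t K by (simp add: x_def)
  have x2: "x l + 2 = t + 1 + (4 * l + 2) - 2 * K" for l using K by (simp add: x_def)
  have "covers [t] {..<t} (\<Sum>l<p div 2. 4) (\<Union>l<p div 2. mat t (x l) \<union> mat t (x l + 2) \<union> circ t {2 * l + 2, t - (2 * l + 2)})"
    using t p xodd by (intro covers_UN covers_mat_pair_even) auto
  then have 1: "covers [t] {..<t} (4 * (p div 2)) (\<Union>l<p div 2. mat t (x l) \<union> mat t (x l + 2) \<union> circ t {2 * l + 2, t - (2 * l + 2)})"
    by (simp add: mult.commute)
  have 2: "covers [t] {..<t} (2 * (p mod 2)) (if odd p then mat t (x (p div 2)) \<union> mat t (x (p div 2) + 2) else {})"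
    using t p xodd covers_mat_pair[of t "x (p div 2)"] by (auto simp: odd_iff_mod_2_eq_one)
  have o: "circ t {\<delta>\<in>near t p. odd \<delta>} \<subseteq> (\<Union>y\<in>(\<lambda>i. t + 1 + 2 * i - 2 * K) ` {..<2 * K}. mat t y)"
  proof (rule circ_odd_subset_mats[OF t])
    fix \<delta> assume d: "\<delta> \<in> near t p" "odd \<delta>"
    show "\<delta> < t \<and> t - \<delta> \<in> near t p" using near_sym[OF d(1)] .
    show "\<exists>y\<in>(\<lambda>i. t + 1 + 2 * i - 2 * K) ` {..<2 * K}. y mod t = \<delta>"
    proof (cases "\<delta> \<le> p")
      case True
      obtain e where e: "\<delta> = 2 * e + 1" using d(2) by (elim oddE)
      have "e < K" using True e by (simp add: K_def)
      then have "t + 1 + 2 * (e + K) - 2 * K = t + \<delta>" "e + K < 2 * K" using e by auto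
      moreover have "\<delta> < t" using d by (simp add: near_def)
      ultimately show ?thesis by (intro bexI[of _ "t + \<delta>"] image_eqI[of _ _ "e + K"]) auto
    next
      case False
      then have d': "\<delta> < t" "t - \<delta> \<le> p" using d by (auto simp: near_def)
      have "odd (t - \<delta>)" using t d d' by simp
      then obtain e where e: "t - \<delta> = 2 * e + 1" by (elim oddE)
      have "e < K" using d' e by (simp add: K_def)
      then have "t + 1 + 2 * (K - Suc e) - 2 * K = \<delta>" "K - Suc e < 2 * K" using e d' K by auto
      then show ?thesis using d' by (intro bexI[of _ \<delta>] image_eqI[of _ _ "K - Suc e"]) auto
    qed
  qed
  have cls: "mat t (t + 1 + 2 * i - 2 * K) \<subseteq> (\<Union>l<p div 2. mat t (x l) \<union> mat t (x l + 2) \<union> circ t {2 * l + 2, t - (2 * l + 2)})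
      \<union> (if odd p then mat t (x (p div 2)) \<union> mat t (x (p div 2) + 2) else {})" if "i < 2 * K" for i
  proof -
    define l where "l = i div 2"
    have "t + 1 + 2 * i - 2 * K = x l \<or> t + 1 + 2 * i - 2 * K = x l + 2"
      unfolding x2 unfolding x_def l_def by (cases "even i") (auto elim!: evenE oddE)
    moreover have "l < p div 2 \<or> (odd p \<and> l = p div 2)"
      using that by (auto simp: l_def K_def elim!: oddE)
    ultimately show ?thesis by auto
  qed
  have e: "circ t {\<delta>\<in>near t p. even \<delta>} \<subseteq> (\<Union>l<p div 2. circ t {2 * l + 2, t - (2 * l + 2)})"
    unfolding circ_UN[symmetric]
  proof (rule circ_mono, clarify)
    fix \<delta> assume d: "\<delta> \<in> near t p" "even \<delta>"
    have even: "\<exists>l<p div 2. \<epsilon> = 2 * l + 2" if "even \<epsilon>" "0 < \<epsilon>" "\<epsilon> \<le> p" for \<epsilon>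
      using that by (intro exI[of _ "\<epsilon> div 2 - 1"]) (auto elim!: evenE)
    show "\<delta> \<in> (\<Union>l<p div 2. {2 * l + 2, t - (2 * l + 2)})"
    proof (cases "\<delta> \<le> p")
      case True
      then show ?thesis using even[of \<delta>] d by (auto simp: near_def)
    next
      case False
      then have d': "\<delta> < t" "t - \<delta> \<le> p" using d by (auto simp: near_def)
      then obtain l where "l < p div 2" "t - \<delta> = 2 * l + 2" using even[of "t - \<delta>"] d t by auto
      then show ?thesis using d' by (intro UN_I[of l]) auto
    qed
  qed
  have "circ t (near t p) \<subseteq> (\<Union>l<p div 2. mat t (x l) \<union> mat t (x l + 2) \<union> circ t {2 * l + 2, t - (2 * l + 2)})
      \<union> (if odd p then mat t (x (p div 2)) \<union> mat t (x (p div 2) + 2) else {})"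
    unfolding circ_split_parity[of t "near t p"]
  proof (rule Un_least)
    show "circ t {\<delta>\<in>near t p. odd \<delta>} \<subseteq> (\<Union>l<p div 2. mat t (x l) \<union> mat t (x l + 2) \<union> circ t {2 * l + 2, t - (2 * l + 2)})
        \<union> (if odd p then mat t (x (p div 2)) \<union> mat t (x (p div 2) + 2) else {})"
      by (rule order_trans[OF o], unfold UN_simps(10), rule UN_least, rule cls) simp
  qed (rule order_trans[OF e], blast)
  moreover have "4 * (p div 2) + 2 * (p mod 2) = 2 * p" by presburger
  ultimately show ?thesis using covers_mono[OF covers_Un[OF 1 2]] by simp
qed

lemma covers_near: "2 * p < t \<Longrightarrow> covers [t] {..<t} (2 * p) (circ t (near t p))"
  using covers_near_odd covers_near_even by blast

text \<open>As \<open>m\<close> is odd, the excluded differences are even, so there are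
  \<open>m\<close> matchings but only \<open>k = (m - 3) / 2\<close> pairs of even differences.
  Three matchings must therefore be covered alone: \<open>C1\<close>, \<open>C3\<close>,
  \<open>C5\<close> use 1, 3, 5 forward and 3, 5, 1 backward. The last of them advances by 4 on the
  even residues, which is a single cycle because \<open>gcd 4 t = 2\<close>. The other
  \<open>2 * k\<close> matchings are combined with the even differences.\<close>

lemma covers_all_but_middle:
  assumes m: "odd m" "m \<ge> 3" and t: "t = 2 * m"
  shows "covers [t] {..<t} (t - 3) (circ t ({1..<t} - {m - 1, m + 1}))"
proof -
  have t0: "even t" "t > 0" using t m by auto
  have gc: "gcd (t - 2) t = 2" "gcd 4 t = 2"
  proof -
    show "gcd (t - 2) t = 2" using t0 by (rule gcd_minus_2)
    have "coprime 2 m" using m by simp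
    then have "gcd (2 * 2) (2 * m) = 2" by (simp only: gcd_mult_distrib_nat[symmetric] coprime_imp_gcd_eq_1)
    then show "gcd 4 t = 2" by (simp add: t)
  qed
  have odds: "odd (1::nat)" "odd (3::nat)" "odd (5::nat)" by simp_all
  obtain C1 where C1: "factor [t] {..<t} C1" "\<And>e. e < t \<Longrightarrow> even e \<Longrightarrow> (e, (e + 1) mod t) \<in> C1"
    "\<And>e. e < t \<Longrightarrow> even e \<Longrightarrow> ((e + 1) mod t, (e + (t - 2)) mod t) \<in> C1"
    using alternating_ham[OF t0(1) odds(1) gc(1) t0(2)] by metis
  obtain C3 where C3: "factor [t] {..<t} C3" "\<And>e. e < t \<Longrightarrow> even e \<Longrightarrow> (e, (e + 3) mod t) \<in> C3"
    "\<And>e. e < t \<Longrightarrow> even e \<Longrightarrow> ((e + 3) mod t, (e + (t - 2)) mod t) \<in> C3"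
    using alternating_ham[OF t0(1) odds(2) gc(1) t0(2)] by metis
  obtain C5 where C5: "factor [t] {..<t} C5" "\<And>e. e < t \<Longrightarrow> even e \<Longrightarrow> (e, (e + 5) mod t) \<in> C5"
    "\<And>e. e < t \<Longrightarrow> even e \<Longrightarrow> ((e + 5) mod t, (e + 4) mod t) \<in> C5"
    using alternating_ham[OF t0(1) odds(3) gc(2) t0(2)] by metis
  have bk: "((e + (x + 2)) mod t, e) \<in> C"
    if C: "\<And>e. e < t \<Longrightarrow> even e \<Longrightarrow> ((e + x) mod t, (e + (t - 2)) mod t) \<in> C" and e: "e < t" "even e" for e x C
  proof -
    have "(((e + 2) mod t + x) mod t, ((e + 2) mod t + (t - 2)) mod t) \<in> C"
      using e t0 by (intro C) (auto simp: dvd_mod_iff)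
    moreover have "((e + 2) mod t + (t - 2)) mod t = e" using e m t by (intro add_mod_cancel) auto
    moreover have "((e + 2) mod t + x) mod t = (e + (x + 2)) mod t"
      by (simp only: mod_add_left_eq) (simp add: ac_simps)
    ultimately show ?thesis by simp
  qed
  have n: "(1::nat) + 2 = 3" "(3::nat) + 2 = 5" by simp_all
  have b1: "((e + 3) mod t, e) \<in> C1" if "e < t" "even e" for e using bk[OF C1(3) that] unfolding n .
  have b3: "((e + 5) mod t, e) \<in> C3" if "e < t" "even e" for e using bk[OF C3(3) that] unfolding n .
  have b5: "((e + 1) mod t, e) \<in> C5" if e: "e < t" "even e" for e
  proof -
    have "(((e + (t - 4)) mod t + 5) mod t, ((e + (t - 4)) mod t + 4) mod t) \<in> C5"
      using e t0 m t by (intro C5(3)) (auto simp: dvd_mod_iff)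
    moreover have "((e + (t - 4)) mod t + 4) mod t = e" using e m t by (intro add_mod_cancel') auto
    moreover have "e + (t - 4) + 5 = e + 1 + t" using m t by simp
    then have "((e + (t - 4)) mod t + 5) mod t = (e + 1) mod t" by (simp only: mod_add_left_eq mod_add_self2)
    ultimately show ?thesis by simp
  qed
  have "mat t 1 \<union> mat t 3 \<union> mat t 5 \<subseteq> C1 \<union> C3 \<union> C5"
    unfolding mat_def using C1(2) C3(2) C5(2) b1 b3 b5 by auto
  then have 1: "covers [t] {..<t} 3 (mat t 1 \<union> mat t 3 \<union> mat t 5)"
    using covers_mono[OF covers_Un[OF covers_Un[OF covers_1[OF C1(1) order_refl] covers_1[OF C3(1) order_refl]]
        covers_1[OF C5(1) order_refl]]] by (simp add: numeral_3_eq_3)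
  define k where "k = (m - 3) div 2"
  have mk: "m = 2 * k + 3" using m by (auto simp: k_def elim!: oddE)
  have "covers [t] {..<t} (\<Sum>l<k. 4) (\<Union>l<k. mat t (7 + 4 * l) \<union> mat t (7 + 4 * l + 2) \<union> circ t {2 * l + 2, t - (2 * l + 2)})"
    using t0 t mk by (intro covers_UN covers_mat_pair_even) auto
  then have 2: "covers [t] {..<t} (4 * k) (\<Union>l<k. mat t (7 + 4 * l) \<union> mat t (7 + 4 * l + 2) \<union> circ t {2 * l + 2, t - (2 * l + 2)})"
    by (simp add: mult.commute)
  let ?R = "{1..<t} - {m - 1, m + 1}"
  have "circ t {\<delta>\<in>?R. odd \<delta>} \<subseteq> (\<Union>y\<in>{y. odd y \<and> y < t}. mat t y)"
    using m t by (intro circ_odd_subset_mats t0(1)) auto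
  moreover have "mat t y \<subseteq> (mat t 1 \<union> mat t 3 \<union> mat t 5) \<union>
      (\<Union>l<k. mat t (7 + 4 * l) \<union> mat t (7 + 4 * l + 2) \<union> circ t {2 * l + 2, t - (2 * l + 2)})"
    if y: "odd y" "y < t" for y
  proof -
    obtain i where i: "y = 2 * i + 1" using y(1) by (elim oddE)
    consider "i = 0" | "i = 1" | "i = 2" | "i \<ge> 3" by linarith
    then show ?thesis
    proof cases
      case 4
      define l where "l = (i - 3) div 2"
      have "y = 7 + 4 * l \<or> y = 7 + 4 * l + 2" "l < k"
        using 4 i y(2) t mk unfolding l_def by presburger+
      then show ?thesis by auto
    qed (use i in \<open>auto simp: numeral_3_eq_3 eval_nat_numeral\<close>)
  qed
  moreover have "circ t {\<delta>\<in>?R. even \<delta>} \<subseteq> (\<Union>l<k. circ t {2 * l + 2, t - (2 * l + 2)})"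
    unfolding circ_UN[symmetric]
  proof (rule circ_mono, rule subsetI)
    fix \<delta> assume "\<delta> \<in> {\<delta>\<in>?R. even \<delta>}"
    then have d: "\<delta> \<in> {1..<t}" "even \<delta>" "\<delta> \<notin> {m - 1, m + 1}" by auto
    obtain i where i: "\<delta> = 2 * i" using d(2) by blast
    show "\<delta> \<in> (\<Union>l<k. {2 * l + 2, t - (2 * l + 2)})"
    proof (cases "\<delta> < m")
      case True
      then show ?thesis using i d mk t by (intro UN_I[of "i - 1"]) auto
    next
      case False
      have "2 * i \<noteq> 2 * k + 4" using d(3) i mk by simp
      then have "k + 3 \<le> i" using False i mk by presburger
      then show ?thesis using i d(1) mk t by (intro UN_I[of "m - i - 1"]) auto
    qed
  qed
  ultimately have "circ t ?R \<subseteq> (mat t 1 \<union> mat t 3 \<union> mat t 5) \<union>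
      (\<Union>l<k. mat t (7 + 4 * l) \<union> mat t (7 + 4 * l + 2) \<union> circ t {2 * l + 2, t - (2 * l + 2)})"
    unfolding circ_split_parity[of t ?R] by (intro Un_least) blast+
  moreover have "3 + 4 * k = t - 3" using mk t by simp
  ultimately show ?thesis using covers_mono[OF covers_Un[OF 1 2]] by simp
qed

section \<open>Perfect matchings in circulants\<close>

text \<open>The involution partitions \<open>V\<close> into digons; each is listed once, from its
  smaller element.\<close>

lemma factor_involution:
  fixes V :: "nat set"
  assumes V: "finite V" and g: "\<And>v. v \<in> V \<Longrightarrow> g v \<in> V \<and> g v \<noteq> v \<and> g (g v) = v"
  shows "factor (replicate (card V div 2) 2) V {(v, g v) | v. v \<in> V}"
proof -
  define L where "L = sorted_list_of_set {v\<in>V. v < g v}"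
  have L: "set L = {v\<in>V. v < g v}" "distinct L" using V by (auto simp: L_def)
  define css where "css = map (\<lambda>v. [v, g v]) L"
  have dist: "distinct (concat (map (\<lambda>v. [v, g v]) K))" if "distinct K" "set K \<subseteq> {v\<in>V. v < g v}" for K
    using that
  proof (induction K)
    case (Cons v K)
    have v: "v \<in> V" "v < g v" using Cons.prems by auto
    have "u \<noteq> v \<and> g u \<noteq> v \<and> u \<noteq> g v \<and> g u \<noteq> g v" if "u \<in> set K" for u
    proof -
      have u: "u \<in> V" "u < g u" "u \<noteq> v" using Cons.prems that by auto
      then show ?thesis using g[OF u(1)] g[OF v(1)] v by (metis less_asym)
    qed
    then have "v \<notin> set (concat (map (\<lambda>v. [v, g v]) K))" "g v \<notin> set (concat (map (\<lambda>v. [v, g v]) K))"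
      by fastforce+
    then show ?case using Cons v by simp
  qed simp
  have d: "distinct (concat css)" unfolding css_def using dist L by simp
  have s: "set (concat css) = V"
  proof
    show "set (concat css) \<subseteq> V" using L g by (auto simp: css_def)
    show "V \<subseteq> set (concat css)"
    proof
      fix v assume v: "v \<in> V"
      show "v \<in> set (concat css)"
      proof (cases "v < g v")
        case True
        then show ?thesis using v L by (auto simp: css_def)
      next
        case False
        then have "g v \<in> set L" using g[OF v] L by auto
        moreover have "v = g (g v)" using g[OF v] by simp
        ultimately show ?thesis by (auto simp: css_def intro!: bexI[of _ "g v"])
      qed
    qed
  qed
  have "length (concat css) = 2 * length L" unfolding css_def by (induction L) auto
  then have "card V = 2 * length L" using d s distinct_card by metis
  then have m: "map length css = replicate (card V div 2) 2"
    by (auto simp: css_def intro!: replicate_eqI)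
  have arcs: "{(v, g v) | v. v \<in> V} = (\<Union>xs\<in>set css. cyc_arcs xs)"
  proof
    show "(\<Union>xs\<in>set css. cyc_arcs xs) \<subseteq> {(v, g v) | v. v \<in> V}"
      using L g by (auto simp: css_def cyc_arcs_def)
    show "{(v, g v) | v. v \<in> V} \<subseteq> (\<Union>xs\<in>set css. cyc_arcs xs)"
    proof clarify
      fix v assume v: "v \<in> V"
      show "(v, g v) \<in> (\<Union>xs\<in>set css. cyc_arcs xs)"
      proof (cases "v < g v")
        case True
        then show ?thesis using v L by (auto simp: css_def cyc_arcs_def)
      next
        case False
        then have "g v \<in> set L" using g[OF v] L by auto
        moreover have "(v, g v) \<in> cyc_arcs [g v, g (g v)]" using g[OF v] by (simp add: cyc_arcs_def)
        ultimately show ?thesis by (auto simp: css_def intro!: bexI[of _ "g v"])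
      qed
    qed
  qed
  show ?thesis unfolding factor_def using m d s arcs by blast
qed

text \<open>A new element is in conflict only with its image and its at most one preimage, so a
  third colour is free. With \<open>col v\<close> read as the colour of the edge from
  \<open>v\<close> to \<open>f v\<close>, this is a proper edge colouring.\<close>

lemma three_colouring:
  assumes "finite A" "inj_on f A" "\<And>v. v \<in> A \<Longrightarrow> f v \<noteq> v"
  shows "\<exists>col. (\<forall>v. col v < (3::nat)) \<and> (\<forall>v\<in>A. f v \<in> A \<longrightarrow> col v \<noteq> col (f v))"
  using assms
proof (induction A)
  case empty
  then show ?case by (intro exI[of _ "\<lambda>_. 0"]) simp
next
  case (insert v A)
  then obtain col where col: "\<forall>v. col v < (3::nat)" "\<forall>v\<in>A. f v \<in> A \<longrightarrow> col v \<noteq> col (f v)"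
    by (auto simp: inj_on_insert)
  obtain u0 where u0: "\<And>u. u \<in> A \<Longrightarrow> f u = v \<Longrightarrow> u = u0"
    using insert.prems(1) by (metis inj_onD insertCI)
  have "\<exists>c<3. c \<noteq> col (f v) \<and> c \<noteq> col u0"
  proof -
    have "card {col (f v), col u0} < card {..<3::nat}" by (simp add: card_insert_if)
    then have "\<not> {..<3} \<subseteq> {col (f v), col u0}" by (metis card_mono finite.emptyI finite_insert not_less)
    then show ?thesis by blast
  qed
  then obtain c where c: "c < 3" "c \<noteq> col (f v)" "c \<noteq> col u0" by blast
  show ?case
  proof (intro exI[of _ "col(v := c)"] conjI allI ballI impI)
    show "(col(v := c)) w < 3" for w using col(1) c(1) by simp
    fix w assume w: "w \<in> insert v A" "f w \<in> insert v A"
    have "f v \<noteq> v" "f w \<noteq> w" using insert.prems(2) w by auto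
    then show "(col(v := c)) w \<noteq> (col(v := c)) (f w)"
      using w c col(2) u0[of w] insert.hyps(2) by auto
  qed
qed

text \<open>
  The prism over the 2-regular graph \<open>v \<midarrow> f v\<close> on \<open>E\<close> is 3-edge-colourable: take a proper
  3-edge-colouring of both copies of the graph and give each rung the colour missing at its ends.
\<close>
lemma covers_prism:
  fixes E :: "nat set"
  assumes E: "finite E" and f: "bij_betw f E E" "\<And>v. v \<in> E \<Longrightarrow> f v \<noteq> v"
    and m: "inj_on m E" "E \<inter> m ` E = {}"
  shows "covers (replicate (card E) 2) (E \<union> m ` E) 3
    (\<Union>v\<in>E. {(v, f v), (f v, v), (m v, m (f v)), (m (f v), m v), (v, m v), (m v, v)})"
proof -
  obtain col where col: "\<And>v. col v < (3::nat)" "\<And>v. v \<in> E \<Longrightarrow> col v \<noteq> col (f v)"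
    using three_colouring[OF E bij_betw_imp_inj_on[OF f(1)] f(2)] f(1) by (auto simp: bij_betw_def)
  define f' where "f' = inv_into E f"
  have f': "f' v \<in> E" "f (f' v) = v" "f' (f v) = v" "f v \<in> E" if "v \<in> E" for v
    using that f(1) by (auto simp: f'_def bij_betw_def f_inv_into_f inv_into_into)
  define m' where "m' = inv_into E m"
  have m': "m' (m v) = v" if "v \<in> E" for v using that m(1) by (simp add: m'_def)
  \<comment> \<open>The map \<open>p k\<close> swaps the ends of each edge of colour
    \<open>k\<close> and fixes the vertices that colour misses. Below, \<open>g k\<close> applies it
    in both copies and uses the rungs at fixed vertices.\<close>
  define p where "p k v = (if col v = k then f v else if col (f' v) = k then f' v else v)" for k v
  have pE: "p k v \<in> E" if "v \<in> E" for k v using f' that by (simp add: p_def)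
  have pp: "p k (p k v) = v" if "v \<in> E" for k v
    using f' col(2)[of "f' v"] col(2)[of v] that by (auto simp: p_def)
  define g where "g k u = (let v = (if u \<in> E then u else m' u) in
    if p k v = v then (if u \<in> E then m v else v) else (if u \<in> E then p k v else m (p k v)))" for k u
  have gE: "g k v = (if p k v = v then m v else p k v)" if "v \<in> E" for k v
    using that by (simp add: g_def)
  have gm: "g k (m v) = (if p k v = v then v else m (p k v))" if "v \<in> E" for k v
  proof -
    have "m v \<notin> E" using that m(2) by blast
    then show ?thesis using m'[OF that] by (simp add: g_def)
  qed
  have mne: "m v \<noteq> v" if "v \<in> E" for v
    using that m(2) by (metis IntI empty_iff imageI)
  have card: "card (E \<union> m ` E) div 2 = card E"
    using E m by (simp add: card_Un_disjoint card_image)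
  have fac: "factor (replicate (card E) 2) (E \<union> m ` E) {(u, g k u) | u. u \<in> E \<union> m ` E}" for k
    unfolding card[symmetric]
  proof (rule factor_involution)
    fix u assume "u \<in> E \<union> m ` E"
    then consider "u \<in> E" | v where "v \<in> E" "u = m v" by blast
    then show "g k u \<in> E \<union> m ` E \<and> g k u \<noteq> u \<and> g k (g k u) = u"
    proof cases
      case 1
      have "m u \<noteq> u" using mne[OF 1] .
      show ?thesis
      proof (cases "p k u = u")
        case True
        then have "g k u = m u" "g k (m u) = u" using gE[OF 1] gm[OF 1] by simp_all
        then show ?thesis using \<open>m u \<noteq> u\<close> 1 by simp
      next
        case False
        then have "g k u = p k u" using gE[OF 1] by simp
        moreover have "g k (p k u) = u" using gE[OF pE[OF 1]] pp[OF 1] False by simp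
        ultimately show ?thesis using False pE[OF 1] by simp
      qed
    next
      case 2
      have "m v \<noteq> v" using mne[OF 2(1)] .
      show ?thesis
      proof (cases "p k v = v")
        case True
        then have "g k v = m v" "g k (m v) = v" using gE[OF 2(1)] gm[OF 2(1)] by simp_all
        then show ?thesis using \<open>m v \<noteq> v\<close> 2 by simp
      next
        case False
        then have "g k (m v) = m (p k v)" using gm[OF 2(1)] by simp
        moreover have "g k (m (p k v)) = m v" using gm[OF pE[OF 2(1)]] pp[OF 2(1)] False by simp
        moreover have "m (p k v) \<noteq> m v" using inj_onD[OF m(1)] pE[OF 2(1)] 2(1) False by blast
        ultimately show ?thesis using 2 pE[OF 2(1)] by simp
      qed
    qed
  qed (use E in simp)
  have ex: "\<exists>k<3. col v \<noteq> k \<and> col (f' v) \<noteq> k" for v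
  proof -
    have "card {col v, col (f' v)} < card {..<3::nat}" by (simp add: card_insert_if)
    then have "\<not> {..<3} \<subseteq> {col v, col (f' v)}" by (metis card_mono finite.emptyI finite_insert not_less)
    then show ?thesis by blast
  qed
  have I: "(u, w) \<in> (\<Union>k<3. {(u, g k u) | u. u \<in> E \<union> m ` E})"
    if "k < 3" "u \<in> E \<union> m ` E" "g k u = w" for u w k using that by blast
  have "{(v, f v), (f v, v), (m v, m (f v)), (m (f v), m v), (v, m v), (m v, v)}
      \<subseteq> (\<Union>k<3. {(u, g k u) | u. u \<in> E \<union> m ` E})" if v: "v \<in> E" for v
  proof -
    have "p (col v) v = f v" by (simp add: p_def)
    then have 1: "g (col v) v = f v" "g (col v) (m v) = m (f v)"
      using gE[OF v] gm[OF v] f(2)[OF v] by auto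
    have "p (col v) (f v) = v" using pp[OF v, of "col v"] by (simp add: p_def[of _ v])
    then have 2: "g (col v) (f v) = v" "g (col v) (m (f v)) = m v"
      using gE[of "f v"] gm[of "f v"] f'(4)[OF v] f(2)[OF v] by auto
    obtain k where k: "k < 3" "col v \<noteq> k" "col (f' v) \<noteq> k" using ex by blast
    then have "p k v = v" by (simp add: p_def)
    then have 3: "g k v = m v" "g k (m v) = v" using gE[OF v] gm[OF v] by auto
    have V: "v \<in> E \<union> m ` E" "f v \<in> E \<union> m ` E" "m v \<in> E \<union> m ` E" "m (f v) \<in> E \<union> m ` E"
      using v f'(4)[OF v] by simp_all
    show ?thesis
      using I[OF col(1) V(1) 1(1)] I[OF col(1) V(2) 2(1)] I[OF col(1) V(3) 1(2)] I[OF col(1) V(4) 2(2)]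
        I[OF k(1) V(1) 3(1)] I[OF k(1) V(3) 3(2)] by (simp only: insert_subset empty_subsetI simp_thms)
  qed
  then have "(\<Union>v\<in>E. {(v, f v), (f v, v), (m v, m (f v)), (m (f v), m v), (v, m v), (m v, v)})
      \<subseteq> (\<Union>k<3. {(u, g k u) | u. u \<in> E \<union> m ` E})" by (rule UN_least)
  then show ?thesis unfolding covers_def using fac
    by (intro exI[of _ "\<lambda>k. {(u, g k u) | u. u \<in> E \<union> m ` E}"]) simp
qed

lemma evens_odds:
  assumes "even t" "odd x" "t > (0::nat)"
  defines "E \<equiv> {e. e < t \<and> even e}"
  shows "finite E" "card E = t div 2" "inj_on (\<lambda>v. (v + x) mod t) E"
    "E \<inter> (\<lambda>v. (v + x) mod t) ` E = {}" "E \<union> (\<lambda>v. (v + x) mod t) ` E = {..<t}"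
proof -
  let ?m = "\<lambda>v. (v + x) mod t"
  show fin: "finite E" by (simp add: E_def)
  show inj: "inj_on ?m E" by (auto simp: E_def intro!: inj_onI elim: add_mod_inj)
  show dis: "E \<inter> ?m ` E = {}" using assms by (auto simp: dvd_mod_iff)
  have sub: "{..<t} - E \<subseteq> ?m ` E"
  proof
    fix w assume w: "w \<in> {..<t} - E"
    define y where "y = x mod t"
    have y: "y < t" "odd y" using assms by (auto simp: y_def dvd_mod_iff)
    have "(w + (t - y)) mod t \<in> E" using w y assms by (auto simp: dvd_mod_iff)
    moreover have "((w + (t - y)) mod t + x) mod t = w"
      using add_mod_cancel'[of w t y] w y by (simp add: y_def mod_add_right_eq)
    ultimately show "w \<in> ?m ` E" by (metis (no_types, lifting) image_eqI)
  qed
  have lt: "?m ` E \<subseteq> {..<t}" "E \<subseteq> {..<t}" using assms(3) by (auto simp: E_def)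
  then show un: "E \<union> ?m ` E = {..<t}" using sub by blast
  have "card {..<t} = card E + card (?m ` E)" using dis fin by (simp add: card_Un_disjoint flip: un)
  then show "card E = t div 2" by (simp add: card_image[OF inj])
qed

lemma factor_mat:
  assumes "even t" "odd x" "t > 0"
  shows "factor (replicate (t div 2) 2) {..<t} (mat t x)"
proof -
  let ?E = "{e. e < t \<and> even e}"
  let ?m = "\<lambda>v. (v + x) mod t"
  note E = evens_odds[OF assms]
  define g where "g u = (if u \<in> ?E then ?m u else inv_into ?E ?m u)" for u
  have gm: "g (?m v) = v" if "v \<in> ?E" for v
  proof -
    have "?m v \<notin> ?E" using E(4) that by blast
    then have "g (?m v) = inv_into ?E ?m (?m v)" unfolding g_def by (rule if_not_P)
    then show ?thesis using inv_into_f_f[OF E(3) that] by (simp only:)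
  qed
  have gE: "g v = ?m v" if "v \<in> ?E" for v using that by (simp add: g_def)
  have ne: "?m v \<noteq> v" if "v \<in> ?E" for v
  proof
    assume "?m v = v"
    then have "v \<in> ?m ` ?E" using that by (metis (no_types, lifting) image_eqI)
    then show False using E(4) that by blast
  qed
  have "factor (replicate (card {..<t} div 2) 2) {..<t} {(v, g v) | v. v \<in> {..<t}}"
  proof (rule factor_involution)
    fix u assume "u \<in> {..<t}"
    then consider "u \<in> ?E" | v where "v \<in> ?E" "u = ?m v" using E(5) by blast
    then show "g u \<in> {..<t} \<and> g u \<noteq> u \<and> g (g u) = u"
    proof cases
      case 1
      have "?m u \<in> {..<t}" using assms(3) by simp
      then show ?thesis using gE[OF 1] gm[OF 1] ne[OF 1] by metis
    next
      case 2
      have "v \<in> {..<t}" using 2(1) by simp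
      then show ?thesis using gE[OF 2(1)] gm[OF 2(1)] ne[OF 2(1)] 2(2) by metis
    qed
  qed simp
  moreover have "{(v, g v) | v. v \<in> {..<t}} = mat t x"
  proof -
    have "{(v, g v) | v. v \<in> {..<t}} = (\<lambda>v. (v, g v)) ` (?E \<union> ?m ` ?E)" unfolding E(5) by auto
    also have "\<dots> = (\<lambda>v. (v, ?m v)) ` ?E \<union> (\<lambda>v. (?m v, v)) ` ?E"
      unfolding image_Un image_image using gm gE by (intro arg_cong2[of _ _ _ _ "(\<union>)"] image_cong) auto
    also have "\<dots> = mat t x" unfolding mat_def by auto
    finally show ?thesis .
  qed
  ultimately show ?thesis by simp
qed

text \<open>The matching supplies the rungs of a prism whose two ends are the steps by
  \<open>a\<close> on the even and on the odd residues; the ends correspond because the two shifts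
  commute.\<close>

lemma covers_mat_prism:
  assumes t: "even t" and x: "odd x" and a: "even a" "0 < a" "a < t"
  shows "covers (replicate (t div 2) 2) {..<t} 3 (mat t x \<union> circ t {a, t - a})"
proof -
  have t0: "t > 0" using a by simp
  let ?E = "{e. e < t \<and> even e}"
  let ?m = "\<lambda>v. (v + x) mod t"
  let ?f = "\<lambda>v. (v + a) mod t"
  note E = evens_odds[OF t x t0]
  have f: "bij_betw ?f ?E ?E"
  proof -
    have "inj_on ?f ?E" by (auto intro!: inj_onI elim: add_mod_inj)
    moreover have "?f ` ?E \<subseteq> ?E" using t a by (auto simp: dvd_mod_iff)
    ultimately show ?thesis unfolding bij_betw_def using endo_inj_surj[OF E(1)] by blast
  qed
  have fne: "?f v \<noteq> v" if "v \<in> ?E" for v using add_mod_neq[of v t a] that a by simp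
  have *: "covers (replicate (t div 2) 2) {..<t} 3
      (\<Union>v\<in>?E. {(v, ?f v), (?f v, v), (?m v, ?m (?f v)), (?m (?f v), ?m v), (v, ?m v), (?m v, v)})"
    using covers_prism[OF E(1) f fne E(3,4)] unfolding E(5) E(2) .
  have comm: "?m (?f v) = ?f (?m v)" for v
    by (simp only: mod_add_left_eq add.assoc add.commute[of a])
  have "(\<Union>v\<in>{..<t}. {(v, ?f v), (?f v, v)}) \<subseteq>
      (\<Union>v\<in>?E. {(v, ?f v), (?f v, v), (?m v, ?m (?f v)), (?m (?f v), ?m v), (v, ?m v), (?m v, v)})"
    unfolding E(5)[symmetric] comm by blast
  moreover have "mat t x \<subseteq>
      (\<Union>v\<in>?E. {(v, ?f v), (?f v, v), (?m v, ?m (?f v)), (?m (?f v), ?m v), (v, ?m v), (?m v, v)})"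
    unfolding mat_def by blast
  ultimately show ?thesis using circ_pair_subset[of a t] a by (intro covers_mono[OF *]) blast
qed

lemma circ_odd_subset_mat:
  assumes "even t" "odd x" "x < t"
  shows "circ t {x, t - x} \<subseteq> mat t x \<union> mat t (t - x)"
proof -
  have "{\<delta>\<in>{x, t - x}. odd \<delta>} = {x, t - x}" using assms by auto
  moreover have "circ t {\<delta>\<in>{x, t - x}. odd \<delta>} \<subseteq> (\<Union>y\<in>{x, t - x}. mat t y)"
  proof (rule circ_odd_subset_mats[OF assms(1)])
    fix \<delta> assume d: "\<delta> \<in> {x, t - x}" "odd \<delta>"
    have "x > 0" using assms(2) by (cases x) auto
    then show "\<delta> < t \<and> t - \<delta> \<in> {x, t - x}" using d assms by auto
    then show "\<exists>y\<in>{x, t - x}. y mod t = \<delta>" using d by (intro bexI[of _ \<delta>]) auto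
  qed
  ultimately show ?thesis by auto
qed

text \<open>The odd difference \<open>2 * l + 1\<close> splits into two matchings up to sign. One
  serves as the rungs of the prism for \<open>2 * l + 2\<close>, which gives 3 factors, and the
  other is a factor itself: 4 factors for four differences. For odd \<open>p\<close> the last odd
  difference gives two matchings.\<close>

lemma digon_covers_near:
  assumes t: "even t" and p: "2 * p < t"
  shows "covers (replicate (t div 2) 2) {..<t} (2 * p) (circ t (near t p))"
proof -
  have t0: "t > 0" using p by simp
  let ?ms = "replicate (t div 2) 2"
  have one: "covers ?ms {..<t} 1 (mat t x)" if "odd x" for x
    using covers_1[OF factor_mat[OF t that t0] order_refl] .
  have step: "covers ?ms {..<t} 4 (circ t {2 * l + 1, t - (2 * l + 1), 2 * l + 2, t - (2 * l + 2)})"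
    if "l < p div 2" for l
  proof -
    have lt: "2 * l + 2 < t" using that p by linarith
    have X: "covers ?ms {..<t} (3 + 1) ((mat t (2 * l + 1) \<union> circ t {2 * l + 2, t - (2 * l + 2)}) \<union> mat t (t - (2 * l + 1)))"
      using lt t by (intro covers_Un covers_mat_prism one) auto
    have "circ t {2 * l + 1, t - (2 * l + 1), 2 * l + 2, t - (2 * l + 2)} =
        circ t {2 * l + 1, t - (2 * l + 1)} \<union> circ t {2 * l + 2, t - (2 * l + 2)}" by (auto simp: circ_def)
    moreover have "circ t {2 * l + 1, t - (2 * l + 1)} \<subseteq> mat t (2 * l + 1) \<union> mat t (t - (2 * l + 1))"
      using lt t by (intro circ_odd_subset_mat) auto
    ultimately have "circ t {2 * l + 1, t - (2 * l + 1), 2 * l + 2, t - (2 * l + 2)} \<subseteq>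
        (mat t (2 * l + 1) \<union> circ t {2 * l + 2, t - (2 * l + 2)}) \<union> mat t (t - (2 * l + 1))" by auto
    from covers_mono[OF X this] show ?thesis by simp
  qed
  have "covers ?ms {..<t} (\<Sum>l<p div 2. 4) (\<Union>l<p div 2. circ t {2 * l + 1, t - (2 * l + 1), 2 * l + 2, t - (2 * l + 2)})"
    by (intro covers_UN step) 
  then have 1: "covers ?ms {..<t} (4 * (p div 2)) (\<Union>l<p div 2. circ t {2 * l + 1, t - (2 * l + 1), 2 * l + 2, t - (2 * l + 2)})"
    by (simp add: mult.commute)
  have 2: "covers ?ms {..<t} (2 * (p mod 2)) (if odd p then circ t {p, t - p} else {})"
  proof (cases "odd p")
    case True
    have "covers ?ms {..<t} (1 + 1) (mat t p \<union> mat t (t - p))"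
      using True t p by (intro covers_Un one) auto
    moreover have "circ t {p, t - p} \<subseteq> mat t p \<union> mat t (t - p)"
      using True t p by (intro circ_odd_subset_mat) auto
    ultimately have "covers ?ms {..<t} (1 + 1) (circ t {p, t - p})" by (rule covers_mono)
    moreover have "1 + 1 = 2 * (p mod 2)" using True by (simp add: odd_iff_mod_2_eq_one)
    ultimately show ?thesis unfolding if_P[OF True] by (simp only:)
  qed simp
  have "near t p \<subseteq> (\<Union>l<p div 2. {2 * l + 1, t - (2 * l + 1), 2 * l + 2, t - (2 * l + 2)}) \<union> (if odd p then {p, t - p} else {})"
  proof
    fix \<delta> assume "\<delta> \<in> near t p"
    then obtain \<epsilon> where e: "0 < \<epsilon>" "\<epsilon> \<le> p" "\<delta> = \<epsilon> \<or> \<delta> = t - \<epsilon>"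
      unfolding near_def by (cases "\<delta> \<le> p") (auto intro: that[of \<delta>] that[of "t - \<delta>"])
    show "\<delta> \<in> (\<Union>l<p div 2. {2 * l + 1, t - (2 * l + 1), 2 * l + 2, t - (2 * l + 2)}) \<union> (if odd p then {p, t - p} else {})"
    proof (cases "odd p \<and> \<epsilon> = p")
      case False
      then have "(\<epsilon> - 1) div 2 < p div 2" "\<epsilon> = 2 * ((\<epsilon> - 1) div 2) + 1 \<or> \<epsilon> = 2 * ((\<epsilon> - 1) div 2) + 2"
        using e(1,2) by presburger+
      then show ?thesis using e(3) by (intro UnI1 UN_I[of "(\<epsilon> - 1) div 2"]) auto
    qed (use e in auto)
  qed
  then have "circ t (near t p) \<subseteq> (\<Union>l<p div 2. circ t {2 * l + 1, t - (2 * l + 1), 2 * l + 2, t - (2 * l + 2)}) \<union>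
      circ t (if odd p then {p, t - p} else {})"
    unfolding circ_UN[symmetric] circ_Un[symmetric] by (rule circ_mono)
  also have "circ t (if odd p then {p, t - p} else {}) = (if odd p then circ t {p, t - p} else {})"
    by (simp add: circ_def)
  finally have "covers ?ms {..<t} (4 * (p div 2) + 2 * (p mod 2)) (circ t (near t p))"
    using covers_mono[OF covers_Un[OF 1 2]] by blast
  moreover have "4 * (p div 2) + 2 * (p mod 2) = 2 * p" by presburger
  ultimately show ?thesis by (simp only:)
qed

text \<open>Adding half of \<open>t\<close> is an involution, so these arcs already form
  digons.\<close>

lemma digon_covers_middle:
  assumes "t = 2 * m" "m > 0"
  shows "covers (replicate (t div 2) 2) {..<t} 1 (circ t {m})"
proof -
  have "factor (replicate (card {..<t} div 2) 2) {..<t} {(v, (v + m) mod t) | v. v \<in> {..<t}}"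
  proof (rule factor_involution)
    fix v assume "v \<in> {..<t}"
    then show "(v + m) mod t \<in> {..<t} \<and> (v + m) mod t \<noteq> v \<and> ((v + m) mod t + m) mod t = v"
      using assms add_mod_neq[of v t m] add_mod_cancel[of v t m] by auto
  qed simp
  then show ?thesis by (intro covers_1) (auto simp: circ_def)
qed

section \<open>Zigzags\<close>

definition hits :: "nat \<Rightarrow> nat list \<Rightarrow> nat \<Rightarrow> bool" where
  "hits t q \<delta> \<longleftrightarrow> (\<exists>u v. (u, v) \<in> consec q \<and> (u + \<delta>) mod t = v)"

text \<open>The single arcs for the odd cycles come first in \<open>N\<close>. The equation on
  lengths says that the paths have \<open>t - s\<close> arcs in all. The last inequality on lengths
  leaves enough isolated vertices: there are \<open>s - length N\<close> of them, and the cycles of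
  \<open>ms\<close> consume \<open>(s - 3 * a) / 2\<close>.\<close>

definition path_system :: "nat \<Rightarrow> nat \<Rightarrow> nat \<Rightarrow> nat set \<Rightarrow> nat list list \<Rightarrow> bool" where
  "path_system s t a R N \<longleftrightarrow> [] \<notin> set N \<and> distinct (concat N) \<and> set (concat N) \<subseteq> {..<t} \<and>
     a \<le> length N \<and> (\<forall>i<a. length (N ! i) = 2) \<and> length (concat N) = t - s + length N \<and>
     2 * length N \<le> s + 3 * a \<and> (\<forall>\<delta>. 0 < \<delta> \<longrightarrow> \<delta> < t \<longrightarrow> \<delta> \<notin> R \<longrightarrow> (\<exists>q\<in>set N. hits t q \<delta>))"

lemma consec_subset: "(u, v) \<in> consec xs \<Longrightarrow> u \<in> set xs \<and> v \<in> set xs"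
  using consec_cyc_arcs[of xs] cyc_arcs_subset[of xs] by blast

lemma OP_star_long:
  assumes ms: "\<forall>m\<in>set ms. m \<ge> 2" "ms \<noteq> []" "s = sum_list ms" "a = length (filter odd ms)" "s < t"
    and sol: "OP_star_has_solution ms"
    and R: "covers [t] {..<t} (s - 1) (circ t R)" and N: "path_system s t a R N"
  shows "OP_star_has_solution (ms @ [t])"
proof -
  have s: "s > 0" using ms(1-3) by (cases ms) auto
  note N' = N[unfolded path_system_def]
  obtain C where C: "factor (ms @ [t]) {..<s + t} C" "\<And>x. x < s \<Longrightarrow> \<exists>v. (x, s + v) \<in> C"
    "\<And>q u v. q \<in> set N \<Longrightarrow> (u, v) \<in> consec q \<Longrightarrow> (s + u, s + v) \<in> C"
    using base_factor_long[OF ms(1,3,4), of t N] ms(5) N' by (metis less_imp_le)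
  have "covers (ms @ [t]) {..<s + t} (s + t - 1) (all_arcs {..<s + t})"
  proof (rule covers_rotate[OF OP_star_has_solution_imp_covers[OF sol ms(1-3)] R C(1,2)])
    fix \<delta> assume "0 < \<delta>" "\<delta> < t" "\<delta> \<notin> R"
    then obtain q u v where q: "q \<in> set N" "(u, v) \<in> consec q" "(u + \<delta>) mod t = v"
      using N' unfolding hits_def by blast
    have "u \<in> set (concat N)" using q(1) consec_subset[OF q(2)] by auto
    then have "u < t" using N' by blast
    then show "\<exists>u<t. (s + u, s + (u + \<delta>) mod t) \<in> C" using C(3)[OF q(1,2)] q(3) by blast
  qed (use s ms(5) in auto)
  then show ?thesis
    using ms(1,3,5) s by (intro covers_imp_OP_star_has_solution[where n = "s + t"]) auto
qed

text \<open>A digon contributes its difference and the negative one, hence the use of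
  \<open>rev q\<close>.\<close>

definition digon_system :: "nat \<Rightarrow> nat \<Rightarrow> nat \<Rightarrow> nat set \<Rightarrow> nat list list \<Rightarrow> nat list list \<Rightarrow> bool" where
  "digon_system s t a R N D \<longleftrightarrow> (\<forall>q\<in>set N. length q = 2) \<and> (\<forall>q\<in>set D. length q = 2) \<and>
     distinct (concat (N @ D)) \<and> set (concat (N @ D)) \<subseteq> {..<t} \<and> length N = a \<and> a + 2 * length D = t - s \<and>
     (\<forall>\<delta>. 0 < \<delta> \<longrightarrow> \<delta> < t \<longrightarrow> \<delta> \<notin> R \<longrightarrow> (\<exists>q\<in>set N. hits t q \<delta>) \<or> (\<exists>q\<in>set D. hits t q \<delta> \<or> hits t (rev q) \<delta>))"

lemma OP_star_digons:
  assumes ms: "\<forall>m\<in>set ms. m \<ge> 2" "ms \<noteq> []" "s = sum_list ms" "a = length (filter odd ms)" "s < t" "even t"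
    and sol: "OP_star_has_solution ms"
    and R: "covers (replicate (t div 2) 2) {..<t} (s - 1) (circ t R)" and N: "digon_system s t a R N D"
  shows "OP_star_has_solution (ms @ replicate (t div 2) 2)"
proof -
  have s: "s > 0" using ms(1-3) by (cases ms) auto
  note N' = N[unfolded digon_system_def]
  obtain C where C: "factor (ms @ replicate (t div 2) 2) {..<s + t} C" "\<And>x. x < s \<Longrightarrow> \<exists>v. (x, s + v) \<in> C"
    "\<And>u v. [u, v] \<in> set N \<Longrightarrow> (s + u, s + v) \<in> C"
    "\<And>u v. [u, v] \<in> set D \<Longrightarrow> (s + u, s + v) \<in> C \<and> (s + v, s + u) \<in> C"
    using base_factor_digons[OF ms(1,3,4), of t N D] ms(5,6) N' by (metis less_imp_le)
  have "covers (ms @ replicate (t div 2) 2) {..<s + t} (s + t - 1) (all_arcs {..<s + t})"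
  proof (rule covers_rotate[OF OP_star_has_solution_imp_covers[OF sol ms(1-3)] R C(1,2)])
    fix \<delta> assume "0 < \<delta>" "\<delta> < t" "\<delta> \<notin> R"
    then obtain q where q: "q \<in> set N \<and> hits t q \<delta> \<or> q \<in> set D \<and> (hits t q \<delta> \<or> hits t (rev q) \<delta>)"
      using N' by blast
    have "length q = 2" using q N' by blast
    then obtain u v where uv: "q = [u, v]" by (auto simp: length_Suc_conv numeral_2_eq_2)
    have "set q \<subseteq> set (concat (N @ D))" using q by auto
    then have "set q \<subseteq> {..<t}" using N' by (meson order_trans)
    then have lt: "u < t" "v < t" using uv by simp_all
    have h: "hits t [x, y] \<delta> \<Longrightarrow> y = (x + \<delta>) mod t" for x y by (auto simp: hits_def)
    show "\<exists>u<t. (s + u, s + (u + \<delta>) mod t) \<in> C"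
      using q C(3)[of u v] C(4)[of u v] h[of u v] h[of v u] lt unfolding uv by auto
  qed (use s ms(5) in auto)
  moreover have "sum_list (replicate (t div 2) 2) = t" using ms(6) by (simp add: sum_list_replicate)
  ultimately show ?thesis
    using ms(1,3) by (intro covers_imp_OP_star_has_solution[where n = "s + t"]) auto
qed

text \<open>The zigzag \<open>L, 0, L - 1, 1, ...\<close> of Walecki: step \<open>i\<close> has
  length \<open>L - i\<close>, alternately downwards and upwards, so vertices and lengths are all
  distinct.\<close>

definition zig :: "nat \<Rightarrow> nat \<Rightarrow> nat" where
  "zig L i = (if even i then L - i div 2 else i div 2)"

lemma zig_le: "i \<le> L \<Longrightarrow> zig L i \<le> L"
  by (auto simp: zig_def)

lemma zig_double:
  "even i \<Longrightarrow> i \<le> L \<Longrightarrow> 2 * zig L i + i = 2 * L" "odd i \<Longrightarrow> 2 * zig L i + 1 = i"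
  by (auto simp: zig_def elim!: evenE oddE)

lemma zig_inj: "inj_on (zig L) {..L}"
proof (rule inj_onI)
  fix i j assume "i \<in> {..L}" "j \<in> {..L}" "zig L i = zig L j"
  moreover have d: "2 * zig L k + k = 2 * L \<or> 2 * zig L k + 1 = k" if "k \<le> L" for k
    using zig_double[of k L] that by blast
  ultimately show "i = j" using d[of i] d[of j] unfolding atMost_iff by linarith
qed

lemma zig_step_even: "even i \<Longrightarrow> i < L \<Longrightarrow> zig L (Suc i) + (L - i) = zig L i"
  by (auto simp: zig_def elim!: evenE)

lemma zig_step_odd: "odd i \<Longrightarrow> i < L \<Longrightarrow> zig L i + (L - i) = zig L (Suc i)"
  by (auto simp: zig_def elim!: oddE)

text \<open>The zigzag closes in on the middle from both sides; stopped at index \<open>n\<close> it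
  has left a gap of \<open>L - n\<close> consecutive values. The single arcs are placed in such
  gaps.\<close>

lemma zig_avoid:
  assumes "i \<le> n" "n \<le> L"
  shows "zig L i < (n + 1) div 2 \<or> (n + 1) div 2 + (L - n) \<le> zig L i"
proof (cases "even i")
  case True
  then obtain e where "i = 2 * e" by blast
  then show ?thesis using zig_double(1)[OF True, of L] assms by linarith
next
  case False
  then show ?thesis using zig_double(2)[OF False, of L] assms by linarith
qed

text \<open>
  The offsets \<open>tau a i - i\<close> run through all integers of absolute value at most \<open>a div 2\<close>,
  except \<open>0\<close> when \<open>a\<close> is even.
\<close>
definition tau :: "nat \<Rightarrow> nat \<Rightarrow> nat" where
  "tau a i = (if 2 * i < a then 2 * i + (if even a then 1 else 0) else 2 * i - a)"

lemma tau_less: "i < a \<Longrightarrow> tau a i < a"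
  unfolding tau_def by (cases "even a") (auto elim!: evenE)

lemma tau_inj: "inj_on (tau a) {..<a}"
proof (rule inj_onI)
  fix i j assume ij: "i \<in> {..<a}" "j \<in> {..<a}" "tau a i = tau a j"
  define e where "e = (if even a then 1 else 0 :: nat)"
  have "odd (a + e)" by (simp add: e_def)
  then have no: "2 * k + e + a \<noteq> 2 * l" for k l by presburger
  have t: "tau a k = 2 * k + e \<or> tau a k + a = 2 * k" for k
    by (auto simp: tau_def e_def)
  show "i = j" using t[of i] t[of j] ij(3) no[of i j] no[of j i] by linarith
qed

lemma distinct_concat_pairs:
  assumes "distinct I" "inj_on f (set I)" "inj_on g (set I)" "f ` set I \<inter> g ` set I = {}"
  shows "distinct (concat (map (\<lambda>i. [f i, g i]) I))"
  using assms
proof (induction I)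
  case (Cons i I)
  then show ?case by (auto simp: inj_on_insert)
qed simp

lemma set_concat_pairs: "set (concat (map (\<lambda>i. [f i, g i]) I)) = f ` set I \<union> g ` set I"
  by auto

lemma length_concat_pairs: "length (concat (map (\<lambda>i. [f i, g i]) I)) = 2 * length I"
  by (induction I) auto

text \<open>Arc \<open>i\<close> has difference \<open>B + tau a i - i\<close>. With
  \<open>B\<close> close to \<open>t / 2\<close> these differences form a block in the middle,
  beyond those of the zigzags.\<close>

definition singles :: "nat \<Rightarrow> nat \<Rightarrow> nat \<Rightarrow> nat list list" where
  "singles B x a = map (\<lambda>i. [x + i, B + x + tau a i]) [0..<a]"

lemma length_singles [simp]: "length (singles B x a) = a"
  by (simp add: singles_def)

lemma singles_pairs: "q \<in> set (singles B x a) \<Longrightarrow> length q = 2"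
  by (auto simp: singles_def)

lemma length_concat_singles [simp]: "length (concat (singles B x a)) = 2 * a"
  unfolding singles_def length_concat_pairs by simp

lemma set_singles: "set (concat (singles B x a)) \<subseteq> {x..<x + a} \<union> {B + x..<B + x + a}"
  unfolding singles_def set_concat_pairs using tau_less by fastforce

lemma distinct_singles: "x + a \<le> B \<Longrightarrow> distinct (concat (singles B x a))"
  unfolding singles_def using tau_inj[of a]
  by (intro distinct_concat_pairs) (auto simp: inj_on_def)

lemma hits_singles:
  assumes "B + x + a \<le> t" "x + a \<le> B" "\<delta> = B + k \<and> 2 * k \<le> a \<or> \<delta> + k = B \<and> 2 * k \<le> a" "even a \<longrightarrow> k > 0"
  shows "\<exists>q\<in>set (singles B x a). hits t q \<delta>"
proof -
  have I: ?thesis if "i < a" "x + i + \<delta> = B + x + tau a i" for i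
  proof -
    have "(x + i + \<delta>) mod t = B + x + tau a i" using that tau_less[OF that(1)] assms(1) by simp
    then have "hits t [x + i, B + x + tau a i] \<delta>" by (auto simp: hits_def)
    then show ?thesis using that(1) by (auto simp: singles_def)
  qed
  show ?thesis
  proof (cases "\<delta> + k = B \<and> k > 0")
    case True
    then have "2 * k \<le> a" using assms(3) by auto
    \<comment> \<open>The offset \<open>- k\<close> sits in the second branch of \<open>tau\<close>,
      at index \<open>a - k\<close>.\<close>
    then have "tau a (a - k) + k = a - k" using True by (auto simp: tau_def)
    then show ?thesis using True \<open>2 * k \<le> a\<close> by (intro I[of "a - k"]) auto
  next
    case False
    then have *: "\<delta> = B + k" "2 * k \<le> a" using assms(3) by auto
    show ?thesis
    proof (cases "even a")
      case True
      \<comment> \<open>Since the offset 0 is skipped for even \<open>a\<close>, the offset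
        \<open>k\<close> sits at index \<open>k - 1\<close>; for odd \<open>a\<close> it sits at
        index \<open>k\<close>.\<close>
      then have "tau a (k - 1) = (k - 1) + k" using * assms(4) by (auto simp: tau_def)
      then show ?thesis using * True assms(4) by (intro I[of "k - 1"]) auto
    next
      case False
      then have "2 * k < a" using * by (metis dvd_triv_left le_neq_implies_less)
      then have "tau a k = k + k" using False by (simp add: tau_def)
      then show ?thesis using * \<open>2 * k < a\<close> by (intro I[of k]) auto
    qed
  qed
qed

lemma consec_upt: "m \<le> i \<Longrightarrow> Suc i < k \<Longrightarrow> (i, Suc i) \<in> consec [m..<k]"
  using consec_nthI[of "i - m" "[m..<k]"] by simp

lemma consec_revI: "(u, v) \<in> consec xs \<Longrightarrow> (v, u) \<in> consec (rev xs)"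
proof (induction xs)
  case (Cons x xs)
  show ?case
  proof (cases xs)
    case Nil
    then show ?thesis using Cons.prems by simp
  next
    case (Cons y ys)
    have "(y, x) \<in> consec (rev ys @ [y, x])"
      using consec_append[of "rev ys" "[y, x]"] by auto
    moreover have "consec (rev xs) \<subseteq> consec (rev xs @ [x])" using consec_append[of "rev xs" "[x]"] by simp
    ultimately show ?thesis using Cons.prems Cons.IH Cons by auto
  qed
qed simp

lemma hitsI: "(u, v) \<in> consec q \<Longrightarrow> (u + \<delta>) mod t = v \<Longrightarrow> hits t q \<delta>"
  unfolding hits_def by blast

lemma hits_forward: "(u, v) \<in> consec q \<Longrightarrow> u + \<delta> = v \<Longrightarrow> v < t \<Longrightarrow> hits t q \<delta>"
  by (erule hitsI) auto

lemma hits_backward: "(u, v) \<in> consec q \<Longrightarrow> v + \<delta> = u \<Longrightarrow> u < t \<Longrightarrow> hits t q (t - \<delta>)"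
  by (erule hitsI) auto

text \<open>The zigzag is traversed backwards, so its even steps rise. In \<open>zig_up\<close> the
  even steps fall, and between them the two paths realise each length with both signs.\<close>

definition zig_down :: "nat \<Rightarrow> nat \<Rightarrow> nat \<Rightarrow> nat list" where
  "zig_down L i0 n = map (zig L) (rev [i0..<Suc n])"

definition zig_up :: "nat \<Rightarrow> nat \<Rightarrow> nat \<Rightarrow> nat \<Rightarrow> nat list" where
  "zig_up B L i0 n = map (\<lambda>i. B + zig L i) [i0..<Suc n]"

lemma consec_mapI: "(u, v) \<in> consec xs \<Longrightarrow> (f u, f v) \<in> consec (map f xs)"
  unfolding consec_map by force

lemma hits_zig_down:
  assumes "i0 \<le> i" "i < n" "n \<le> L" "L < t"
  shows "even i \<Longrightarrow> hits t (zig_down L i0 n) (L - i)" "odd i \<Longrightarrow> hits t (zig_down L i0 n) (t - (L - i))"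
proof -
  have c: "(zig L (Suc i), zig L i) \<in> consec (zig_down L i0 n)"
    unfolding zig_down_def using assms by (intro consec_mapI consec_revI consec_upt) auto
  show "hits t (zig_down L i0 n) (L - i)" if "even i"
    using hits_forward[OF c zig_step_even[OF that]] assms zig_le[of i L] by simp
  show "hits t (zig_down L i0 n) (t - (L - i))" if "odd i"
    using hits_backward[OF c zig_step_odd[OF that]] assms zig_le[of "Suc i" L] by simp
qed

lemma hits_zig_up:
  assumes "i0 \<le> i" "i < n" "n \<le> L" "B + zig L i < t" "B + zig L (Suc i) < t"
  shows "even i \<Longrightarrow> hits t (zig_up B L i0 n) (t - (L - i))" "odd i \<Longrightarrow> hits t (zig_up B L i0 n) (L - i)"
proof -
  have c: "(B + zig L i, B + zig L (Suc i)) \<in> consec (zig_up B L i0 n)"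
    unfolding zig_up_def using assms consec_mapI[OF consec_upt[of i0 i "Suc n"], of "\<lambda>i. B + zig L i"] by simp
  show "hits t (zig_up B L i0 n) (t - (L - i))" if "even i"
    using hits_backward[OF c, of "L - i"] zig_step_even[OF that, of L] assms by simp
  show "hits t (zig_up B L i0 n) (L - i)" if "odd i"
    using hits_forward[OF c, of "L - i"] zig_step_odd[OF that, of L] assms by simp
qed

lemma set_zig_down: "set (zig_down L i0 n) = zig L ` {i0..n}"
  unfolding zig_down_def by (simp add: atLeastLessThanSuc_atLeastAtMost del: upt_Suc)

lemma set_zig_up: "set (zig_up B L i0 n) = (\<lambda>i. B + zig L i) ` {i0..n}"
  unfolding zig_up_def by (simp add: atLeastLessThanSuc_atLeastAtMost del: upt_Suc)

lemma distinct_zig_down: "n \<le> L \<Longrightarrow> distinct (zig_down L i0 n)"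
  unfolding zig_down_def using inj_on_subset[OF zig_inj, of "{i0..n}" L]
  by (auto simp: distinct_map inj_on_def atLeastLessThanSuc_atLeastAtMost simp del: upt_Suc)

lemma distinct_zig_up: "n \<le> L \<Longrightarrow> distinct (zig_up B L i0 n)"
  unfolding zig_up_def using inj_on_subset[OF zig_inj, of "{i0..n}" L]
  by (auto simp: distinct_map inj_on_def atLeastLessThanSuc_atLeastAtMost simp del: upt_Suc)

lemma length_zigs [simp]: "length (zig_down L i0 n) = Suc n - i0" "length (zig_up B L i0 n) = Suc n - i0"
  by (simp_all add: zig_down_def zig_up_def del: upt_Suc)

text \<open>The singles occupy the vertices that the two zigzags leave free in the middle.\<close>
lemma zig_singles_disjoint:
  assumes "n \<le> L" "x = (n + 1) div 2" "a \<le> L - n" "L < B"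
  shows "set (zig_down L 0 n) \<inter> set (concat (singles B x a)) = {}"
    "set (zig_up B L i0 n) \<inter> set (concat (singles B x a)) = {}"
    "set (zig_down L 0 n) \<inter> set (zig_up B L i0 n) = {}" "x + a \<le> Suc L"
proof -
  have xL: "x + (L - n) \<le> Suc L" using assms by simp
  then show "x + a \<le> Suc L" using assms by simp
  have z: "zig L i \<le> L \<and> (zig L i < x \<or> x + a \<le> zig L i)" if "i \<le> n" for i
    using zig_le[of i L] zig_avoid[OF that assms(1)] that assms by auto
  then have z': "y \<le> L \<and> (y < x \<or> x + a \<le> y)" if "y \<in> set (zig_down L 0 n)" for y
  proof -
    obtain i where "i \<le> n" "y = zig L i" using \<open>y \<in> set (zig_down L 0 n)\<close> by (auto simp: set_zig_down)
    then show ?thesis using z[of i] by simp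
  qed
  have z'': "B \<le> y \<and> (y < B + x \<or> B + x + a \<le> y)" if "y \<in> set (zig_up B L i0 n)" for y
  proof -
    obtain i where "i \<le> n" "y = B + zig L i" using \<open>y \<in> set (zig_up B L i0 n)\<close> by (auto simp: set_zig_up)
    then show ?thesis using z[of i] by simp
  qed
  have s: "y \<in> {x..<x + a} \<union> {B + x..<B + x + a}" if "y \<in> set (concat (singles B x a))" for y
    using that set_singles by blast
  show "set (zig_down L 0 n) \<inter> set (concat (singles B x a)) = {}"
    using z' s xL assms by fastforce
  show "set (zig_up B L i0 n) \<inter> set (concat (singles B x a)) = {}"
    using z'' s xL assms by fastforce
  show "set (zig_down L 0 n) \<inter> set (zig_up B L i0 n) = {}"
    using z' z'' assms by fastforce
qed

section \<open>Path systems with prescribed missing differences\<close>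

lemma zig_down_append: "j \<le> n \<Longrightarrow> zig_down L (Suc j) n @ zig_down L 0 j = zig_down L 0 n"
  using upt_add_eq_append[of 0 "Suc j" "n - j"]
  by (simp add: zig_down_def del: upt_Suc flip: map_append rev_append)

lemma hits_append: "hits t xs \<delta> \<Longrightarrow> hits t (xs @ ys) \<delta>" "hits t ys \<delta> \<Longrightarrow> hits t (xs @ ys) \<delta>"
  unfolding hits_def using consec_append[of xs ys] by blast+

lemma hits_two: "(u + \<delta>) mod t = v \<Longrightarrow> hits t [u, v] \<delta>"
  by (rule hitsI) auto

lemma not_near_cases:
  assumes "0 < \<delta>" "\<delta> < t" "\<delta> \<notin> near t (c - 1)" "c > 0"
  shows "c \<le> \<delta> \<and> \<delta> + c \<le> t"
  using assms by (auto simp: near_def)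

text \<open>The zigzags realise the differences from \<open>c\<close> to \<open>L\<close> up to
  sign, in \<open>n = Suc L - c\<close> steps, and the singles those around \<open>B\<close>. For
  even \<open>s\<close> also \<open>a\<close> is even, so the singles skip \<open>B\<close>, which
  is then put into \<open>R\<close>. The bound \<open>s + a \<ge> 4\<close> makes room for two paths
  besides the singles.\<close>

lemma path_system_two_zigzags:
  assumes a: "even (s + a)" "3 * a \<le> s" "a + s \<le> t" "s + a \<ge> 4" and s: "s > 0" "s < t" "odd s \<or> odd t"
  defines "R \<equiv> near t ((s - 1) div 2) \<union> (if even s then {(t + 1) div 2} else {})"
  shows "\<exists>N. path_system s t a R N"
proof -
  define c where "c = (s + 1) div 2"
  define L where "L = (t - a) div 2"
  define n where "n = Suc L - c"
  define x where "x = (n + 1) div 2"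
  define B where "B = (t + 1) div 2"
  \<comment> \<open>For odd \<open>t\<close> the difference \<open>t - L = B + a div 2\<close> is
    the upper end of the middle block, so the upper zigzag omits its step 0.\<close>
  define i0 where "i0 = t mod 2"
  define s' a' t' where "s' = s div 2" and "a' = a div 2" and "t' = t div 2"
  \<comment> \<open>In each admissible combination of parities the halves become exact, and all that
    is needed about the parameters is linear.\<close>
  consider "s = 2 * s' + 1" "a = 2 * a' + 1" "t = 2 * t' + 1" "c = s' + 1" "L = t' - a'" "B = t' + 1" "i0 = 1" "(s - 1) div 2 = s'"
    | "s = 2 * s' + 1" "a = 2 * a' + 1" "t = 2 * t'" "c = s' + 1" "L = t' - a' - 1" "B = t'" "i0 = 0" "(s - 1) div 2 = s'"
    | "s = 2 * s'" "a = 2 * a'" "t = 2 * t' + 1" "c = s'" "L = t' - a'" "B = t' + 1" "i0 = 1" "(s - 1) div 2 = s' - 1"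
  proof (cases "odd s"; cases "odd t")
    assume "odd s" "odd t"
    moreover have "odd a" using a \<open>odd s\<close> by simp
    ultimately show thesis
      by (intro that(1)) (auto simp: s'_def a'_def t'_def c_def L_def B_def i0_def elim!: oddE)
  next
    assume "odd s" "\<not> odd t"
    moreover have "odd a" using a \<open>odd s\<close> by simp
    ultimately show thesis
      by (intro that(2)) (auto simp: s'_def a'_def t'_def c_def L_def B_def i0_def elim!: oddE evenE)
  next
    assume "\<not> odd s" "odd t"
    moreover have "even a" using a \<open>\<not> odd s\<close> by simp
    ultimately show thesis
      by (intro that(3)) (auto simp: s'_def a'_def t'_def c_def L_def B_def i0_def elim!: oddE evenE)
  qed (use s in simp)
  then have "c > 0 \<and> (s - 1) div 2 = c - 1 \<and> (i0 = 0 \<or> i0 = 1) \<and> c \<le> Suc L \<and> (i0 = 1 \<longrightarrow> c \<le> L) \<and>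
      a \<le> c - 1 \<and> L < B \<and> (i0 = 0 \<longrightarrow> B + L < t) \<and> (i0 = 1 \<longrightarrow> B + L \<le> t) \<and>
      a + 2 * Suc L + s = t + i0 + 2 * c \<and> 2 * B \<le> 2 * L + 2 + a \<and> 2 * t + 2 * i0 \<le> 2 * B + a + 2 * L + 2"
    (is ?facts)
  proof cases
    case 1
    have "3 * a' + 1 \<le> s'" "a' + s' + 1 \<le> t'" using a 1 by simp_all
    then show ?facts unfolding 1 by auto
  next
    case 2
    have "3 * a' + 1 \<le> s'" "a' + s' + 1 \<le> t'" using a 2 by simp_all
    then show ?facts unfolding 2 by auto
  next
    case 3
    have "3 * a' \<le> s'" "a' + s' \<le> t'" "2 \<le> s' + a'" using a 3 by simp_all
    then show ?facts unfolding 3(1-7) 3(8)[unfolded 3(1)] by auto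
  qed
  then have c: "c > 0" "(s - 1) div 2 = c - 1" and i01: "i0 = 0 \<or> i0 = 1"
    and cL: "c \<le> Suc L" "i0 = 1 \<Longrightarrow> c \<le> L" and ac: "a \<le> c - 1" and LB: "L < B"
    and BLt: "i0 = 0 \<Longrightarrow> B + L < t" "i0 = 1 \<Longrightarrow> B + L \<le> t"
    and arcs: "a + 2 * Suc L + s = t + i0 + 2 * c"
    and mid: "2 * B \<le> 2 * L + 2 + a" "2 * t + 2 * i0 \<le> 2 * B + a + 2 * L + 2"
    by blast+
  have n: "n \<le> L" "L - n = c - 1" using c cL by (auto simp: n_def)
  have i0n: "i0 \<le> n" using cL i01 by (auto simp: n_def)
  note dis = zig_singles_disjoint[OF n(1) x_def ac[folded n(2)] LB]
  have Lt: "L < t" using LB BLt i01 by linarith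
  have down_lt: "zig L i < t" if "i \<le> n" for i using zig_le[of i L] that n Lt by linarith
  have Bxat: "B + x + a \<le> t"
  proof -
    have "x + a \<le> L \<or> n = 0" using n ac c unfolding x_def by (cases n) auto
    then show ?thesis using BLt i01 i0n dis(4) by auto
  qed
  have up_lt: "B + zig L i < t" if "i0 \<le> i" "i \<le> n" for i
  proof (cases "i0 = 0")
    case True
    then show ?thesis using BLt zig_le[of i L] that n by simp
  next
    case False
    then have "zig L i \<noteq> zig L 0"
      using inj_onD[OF zig_inj, of L i 0] that n by auto
    then have "zig L i < L" using zig_le[of i L] that n by (auto simp: zig_def)
    then show ?thesis using BLt False i01 by simp
  qed
  define N where "N = singles B x a @ [zig_down L 0 n, zig_up B L i0 n]"
  have N: "concat N = concat (singles B x a) @ zig_down L 0 n @ zig_up B L i0 n" by (simp add: N_def)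
  have "path_system s t a R N"
    unfolding path_system_def
  proof (intro conjI allI impI)
    show "[] \<notin> set N"
      using i0n by (auto simp: N_def singles_def zig_up_def zig_down_def simp del: upt_Suc)
    show "distinct (concat N)"
    proof -
      have "distinct (concat (singles B x a))" using dis(4) LB by (intro distinct_singles) simp
      then show ?thesis
        unfolding N distinct_append set_append
        using dis(1-3) distinct_zig_down[OF n(1)] distinct_zig_up[OF n(1)] by blast
    qed
    have "set (zig_down L 0 n) \<subseteq> {..<t}" using down_lt by (auto simp: set_zig_down)
    moreover have "set (zig_up B L i0 n) \<subseteq> {..<t}" using up_lt by (auto simp: set_zig_up)
    moreover have "{x..<x + a} \<union> {B + x..<B + x + a} \<subseteq> {..<t}" using Bxat by auto
    ultimately show "set (concat N) \<subseteq> {..<t}"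
      unfolding N set_append using set_singles[of B x a] by blast
    show "a \<le> length N" by (simp add: N_def)
    show "length (N ! i) = 2" if "i < a" for i
      using that singles_pairs[OF nth_mem[of i "singles B x a"]] by (simp add: N_def nth_append)
    have "a + 2 * n = t - s + i0" using arcs s cL by (simp add: n_def)
    then show "length (concat N) = t - s + length N" using i0n unfolding N by (simp add: N_def)
    show "2 * length N \<le> s + 3 * a" using a by (simp add: N_def)
    fix \<delta> assume d: "0 < \<delta>" "\<delta> < t" "\<delta> \<notin> R"
    then have cd: "c \<le> \<delta>" "\<delta> + c \<le> t" using not_near_cases[of \<delta> t c] c by (auto simp: R_def)
    have zz: "\<exists>q\<in>set N. hits t q \<delta>" if "i < n" "\<delta> = L - i \<and> (even i \<or> i0 \<le> i) \<or> \<delta> = t - (L - i) \<and> (odd i \<or> i0 \<le> i)" for i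
    proof -
      have "even i \<Longrightarrow> hits t (zig_down L 0 n) (L - i)" "odd i \<Longrightarrow> hits t (zig_down L 0 n) (t - (L - i))"
        using hits_zig_down[OF _ that(1) n(1) Lt] by blast+
      moreover have "i0 \<le> i \<Longrightarrow> even i \<Longrightarrow> hits t (zig_up B L i0 n) (t - (L - i))"
        "i0 \<le> i \<Longrightarrow> odd i \<Longrightarrow> hits t (zig_up B L i0 n) (L - i)"
        using hits_zig_up[OF _ that(1) n(1)] up_lt that(1) by auto
      moreover have "odd i \<Longrightarrow> i0 \<le> i" using i01 by (cases i) auto
      ultimately show ?thesis using that(2) by (auto simp: N_def)
    qed
    consider "\<delta> \<le> L" | "t - L < \<delta>" | "\<delta> = t - L" "i0 = 0" | "L < \<delta>" "\<delta> < t - L \<or> \<delta> = t - L \<and> i0 = 1"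
      using i01 by linarith
    then show "\<exists>q\<in>set N. hits t q \<delta>"
    proof cases
      case 1
      have "even (L - \<delta>) \<or> i0 \<le> L - \<delta>" using i01 by (cases "L - \<delta>") auto
      then show ?thesis using zz[of "L - \<delta>"] 1 cd c by (simp add: n_def)
    next
      case 2
      then have "i0 \<le> L - (t - \<delta>)" "L - (t - \<delta>) < n" "\<delta> = t - (L - (L - (t - \<delta>)))"
        using cd c d i01 by (auto simp: n_def)
      then show ?thesis using zz[of "L - (t - \<delta>)"] by blast
    next
      case 3
      then have "0 < n" using cd c Lt by (auto simp: n_def)
      then show ?thesis using zz[of 0] 3 by simp
    next
      case 4
      define k where "k = (if \<delta> \<ge> B then \<delta> - B else B - \<delta>)"
      have "2 * k \<le> a"
        using 4 mid i01 unfolding k_def by auto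
      moreover have "even a \<longrightarrow> k > 0"
        using d(3) a by (auto simp: k_def R_def B_def)
      moreover have "\<delta> = B + k \<or> \<delta> + k = B" by (auto simp: k_def)
      ultimately have "\<exists>q\<in>set (singles B x a). hits t q \<delta>"
        using hits_singles[of B x a t \<delta> k] Bxat dis(4) LB by auto
      then show ?thesis by (auto simp: N_def)
    qed
  qed
  then show ?thesis by blast
qed

text \<open>For \<open>s = 2\<close> and \<open>a = 0\<close> only one path is permitted, so the two
  zigzags are joined by the arc from \<open>h\<close> to \<open>h + 1\<close>, which has difference
  1. The missing difference \<open>h + 1\<close> is \<open>- h\<close>.\<close>

lemma path_system_two:
  assumes "odd t" "t > 2"
  shows "\<exists>N. path_system 2 t 0 {(t + 1) div 2} N"
proof -
  define h where "h = (t - 1) div 2"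
  have t: "t = 2 * h + 1" "h > 0" "(t + 1) div 2 = h + 1" using assms by (auto simp: h_def elim!: oddE)
  \<comment> \<open>The joining arc already has difference 1, so the step \<open>h - 1\<close> is
    dropped from the zigzag in which it rises; the parity of \<open>h\<close> tells which
    one.\<close>
  define k l where "k = (if odd h then h - 1 else h)" and "l = (if odd h then h else h - 1)"
  have kl: "k \<le> h" "l \<le> h" "k + l + 1 = 2 * h" "l > 0 \<or> h = 1" using t(2) by (auto simp: k_def l_def)
  have l0: "l > 0" using t(2) by (cases "h = 1") (auto simp: l_def elim: oddE)
  define q where "q = zig_down h 0 k @ zig_up (h + 1) h 1 l"
  have z: "zig h i < h" if "0 < i" "i \<le> h" for i
    using zig_le[of i h] inj_onD[OF zig_inj, of h i 0] that by (auto simp: zig_def)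
  have up: "h < y \<and> y < t" if "y \<in> set (zig_up (h + 1) h 1 l)" for y
    using that z kl(2) t(1) by (fastforce simp: set_zig_up)
  have down: "y \<le> h" if "y \<in> set (zig_down h 0 k)" for y
    using that zig_le kl(1) by (fastforce simp: set_zig_down)
  have "set (zig_down h 0 k) \<inter> set (zig_up (h + 1) h 1 l) = {}" using up down by fastforce
  then have dis: "distinct q" unfolding q_def using distinct_zig_down distinct_zig_up kl by simp
  have sub: "set q \<subseteq> {..<t}" unfolding q_def using up down t(1) by fastforce
  have len: "length q = t - 2 + 1" unfolding q_def using kl t l0 by simp
  have "hits t q \<delta>" if d: "0 < \<delta>" "\<delta> < t" "\<delta> \<noteq> h + 1" for \<delta>
  proof -
    consider "\<delta> = 1" | "1 < \<delta>" "\<delta> \<le> h" | "h + 1 < \<delta>" using d by linarith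
    then show ?thesis
    proof cases
      case 1
      have "zig_down h 0 k = zig_down h 1 k @ [h]"
        using zig_down_append[of 0 k h] by (simp add: zig_down_def[of h 0 0] zig_def)
      moreover have "zig_up (h + 1) h 1 l = (h + 1) # zig_up (h + 1) h 2 l"
        using l0 upt_conv_Cons[of 1 "Suc l"] by (simp add: zig_up_def zig_def numeral_2_eq_2 del: upt_Suc)
      ultimately have q: "q = zig_down h 1 k @ ([h, h + 1] @ zig_up (h + 1) h 2 l)" by (simp add: q_def)
      have "hits t [h, h + 1] 1" using t by (intro hits_two) simp
      then show ?thesis unfolding q 1 by (intro hits_append(2)[OF hits_append(1)])
    next
      case 2
      define i where "i = h - \<delta>"
      have i: "i < k" "i < l" "\<delta> = h - i" using 2 d by (auto simp: i_def k_def l_def)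
      have "0 < i" if "odd i" using that by (cases i) auto
      then show ?thesis
        using hits_zig_down(1)[of 0 i k h t] hits_zig_up(2)[of 1 i l h "h + 1" t] i kl t z[of i] z[of "Suc i"]
        unfolding q_def by (cases "even i") (auto intro: hits_append)
    next
      case 3
      define i where "i = h - (t - \<delta>)"
      have i: "0 < i" "i < h" "\<delta> = t - (h - i)" using 3 d t by (auto simp: i_def)
      have "(if even i then i < l else i < k)"
      proof -
        have "Suc i < h \<or> (even i \<longleftrightarrow> odd h)" using i by (cases "Suc i = h") auto
        then show ?thesis using i by (cases "even i"; cases "odd h") (auto simp: k_def l_def)
      qed
      then show ?thesis
        using hits_zig_down(2)[of 0 i k h t] hits_zig_up(1)[of 1 i l h "h + 1" t] i kl t z[of i] z[of "Suc i"]
        unfolding q_def by (cases "even i") (auto intro: hits_append)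
    qed
  qed
  then have "path_system 2 t 0 {h + 1} [q]"
    using dis sub len by (auto simp: path_system_def)
  then show ?thesis unfolding t(3) by blast
qed

text \<open>There are only two inner arcs. Put on disjoint pairs of vertices, both are single arcs
  and can serve up to two odd cycles.\<close>

lemma path_system_all_but_middle:
  assumes "t = 2 * m" "3 \<le> m" "a \<le> 2"
  shows "\<exists>N. path_system (t - 2) t a ({1..<t} - {m - 1, m + 1}) N"
proof -
  have "hits t [0, m - 1] (m - 1)" "hits t [t - 1, m] (m + 1)"
    using assms by (auto intro!: hits_two simp: mod_if)
  moreover have "length ([[0, m - 1], [t - 1, m]] ! i) = 2" if "i < a" for i
  proof -
    have "i = 0 \<or> i = 1" using that assms by linarith
    then show ?thesis by auto
  qed
  ultimately have "path_system (t - 2) t a ({1..<t} - {m - 1, m + 1}) [[0, m - 1], [t - 1, m]]"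
    using assms unfolding path_system_def by auto
  then show ?thesis by blast
qed

text \<open>
  For even \<open>t\<close> and \<open>s\<close> the two zigzags miss the difference \<open>t div 2\<close>. Joining them gains it, and
  cutting the joined path at another edge restores the number of paths.
\<close>
lemma path_system_cut:
  assumes t: "t = 2 * m" and s: "s = 2 * c" "c > 0" and a: "even a" "a < c" "3 * a \<le> s" and n: "n > 0" "L + 1 + a div 2 = m" "n + c = Suc L"
    and j: "j < n" "c = 1 \<Longrightarrow> Suc j = n"
  shows "\<exists>N. path_system s t a (near t (c - 1) \<union> {if even j then L - j else t - (L - j)}) N"
proof -
  define x where "x = (n + 1) div 2"
  have nL: "n \<le> L" "L - n = c - 1" and LB: "L < m" using n s(2) by auto
  have a0: "c = 1 \<Longrightarrow> a = 0" using a by simp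
  have aL: "a \<le> L - n" using nL a by simp
  note dis = zig_singles_disjoint[OF nL(1) x_def aL LB]
  have Bxat: "m + x + a \<le> t" using dis(4) LB t by simp
  define W where "W = zig_down L 0 j @ zig_up m L 0 n"
  \<comment> \<open>For \<open>c = 1\<close> the cut is at the last step and the remainder is one
    vertex. It is left to the isolated vertices, since \<open>s = 2\<close> permits only one path in
    \<open>N\<close>.\<close>
  define V where "V = (if c = 1 then [] else [zig_down L (Suc j) n])"
  define N where "N = singles m x a @ W # V"
  have N: "concat N = concat (singles m x a) @ W @ concat V" by (simp add: N_def)
  have cut: "zig_down L (Suc j) n @ zig_down L 0 j = zig_down L 0 n" using j by (intro zig_down_append) simp
  then have cut_set: "set (zig_down L 0 n) = set (zig_down L (Suc j) n) \<union> set (zig_down L 0 j)"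
    and cut_dis: "set (zig_down L (Suc j) n) \<inter> set (zig_down L 0 j) = {}" "distinct (zig_down L (Suc j) n)"
      "distinct (zig_down L 0 j)"
    using distinct_zig_down[OF nL(1), of 0] set_append distinct_append by metis+
  have V: "set (concat V) \<subseteq> set (zig_down L (Suc j) n)" "distinct (concat V)"
    using cut_dis(2) by (auto simp: V_def)
  have lt: "zig L i < t" "m + zig L i < t" if "i \<le> n" for i
    using zig_le[of i L] that nL LB t by auto
  have "path_system s t a (near t (c - 1) \<union> {if even j then L - j else t - (L - j)}) N"
    unfolding path_system_def
  proof (intro conjI allI impI)
    have "zig_down L 0 j \<noteq> []" "zig_down L (Suc j) n \<noteq> []" using length_zigs j by (metis list.size(3) Suc_diff_le Suc_neq_Zero Suc_leI zero_less_diff diff_zero)+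
    then show "[] \<notin> set N"
      by (auto simp: N_def W_def V_def singles_def)
    have "distinct (concat (singles m x a))" using dis(4) LB by (intro distinct_singles) simp
    then show "distinct (concat N)"
      unfolding N W_def distinct_append set_append
      using V dis(1-3) cut_set cut_dis distinct_zig_up[OF nL(1)] by blast
    have "set (zig_down L 0 n) \<subseteq> {..<t}" using lt by (auto simp: set_zig_down)
    moreover have "set (zig_up m L 0 n) \<subseteq> {..<t}" using lt by (auto simp: set_zig_up)
    moreover have "{x..<x + a} \<union> {m + x..<m + x + a} \<subseteq> {..<t}" using Bxat by auto
    ultimately show "set (concat N) \<subseteq> {..<t}"
      unfolding N W_def set_append using set_singles[of m x a] V cut_set by blast
    show "a \<le> length N" by (simp add: N_def)
    show "length (N ! i) = 2" if "i < a" for i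
      using that singles_pairs[OF nth_mem[of i "singles m x a"]] by (simp add: N_def nth_append)
    have ts: "a + 2 * n = t - s" using n t s a(1) by (auto elim!: evenE)
    show "length (concat N) = t - s + length N"
      unfolding N using j by (cases "c = 1") (auto simp: N_def V_def W_def Suc_diff_le a0 ts[symmetric])
    show "2 * length N \<le> s + 3 * a"
      using s a0 by (cases "c = 1") (auto simp: N_def V_def)
    fix \<delta> assume d: "0 < \<delta>" "\<delta> < t" "\<delta> \<notin> near t (c - 1) \<union> {if even j then L - j else t - (L - j)}"
    then have cd: "c \<le> \<delta>" "\<delta> + c \<le> t" using not_near_cases[of \<delta> t c] s by auto
    have Lt: "L < t" using LB t by linarith
    have zz: "\<exists>q\<in>set N. hits t q \<delta>" if "i < n" "\<delta> = L - i \<or> \<delta> = t - (L - i)" for i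
    proof (cases "odd i \<and> \<delta> = L - i \<or> even i \<and> \<delta> = t - (L - i)")
      case True
      then have "hits t (zig_up m L 0 n) \<delta>"
        using hits_zig_up[OF _ that(1) nL(1), of 0 m t] lt that(1) by auto
      then show ?thesis by (auto simp: N_def W_def intro: hits_append)
    next
      case False
      then have \<delta>: "\<delta> = (if even i then L - i else t - (L - i))" using that by auto
      then have "i \<noteq> j" using d(3) by auto
      then consider "i < j" | "j < i" by linarith
      then show ?thesis
      proof cases
        case 1
        then have "hits t (zig_down L 0 j) \<delta>" using hits_zig_down[of 0 i j L t] nL Lt j \<delta> by auto
        then show ?thesis by (auto simp: N_def W_def intro: hits_append)
      next
        case 2
        then have "hits t (zig_down L (Suc j) n) \<delta>" "c \<noteq> 1"
          using hits_zig_down[of "Suc j" i n L t] nL Lt that(1) \<delta> j(2) by auto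
        then show ?thesis by (auto simp: N_def V_def)
      qed
    qed
    consider "\<delta> \<le> L" | "t - L \<le> \<delta>" | "L < \<delta>" "\<delta> < t - L" by linarith
    then show "\<exists>q\<in>set N. hits t q \<delta>"
    proof cases
      case 1
      then show ?thesis using zz[of "L - \<delta>"] cd s n by simp
    next
      case 2
      then show ?thesis using zz[of "L - (t - \<delta>)"] cd d s n by simp
    next
      case 3
      define k where "k = (if \<delta> \<ge> m then \<delta> - m else m - \<delta>)"
      have k: "2 * k \<le> a" "\<delta> = m + k \<or> \<delta> + k = m"
        using 3 n t unfolding k_def by auto
      show ?thesis
      proof (cases "k = 0")
        case True
        have "zig_down L 0 j = zig_down L 1 j @ [L]"
          using zig_down_append[of 0 j L] by (simp add: zig_down_def[of L 0 0] zig_def)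
        moreover have "zig_up m L 0 n = (m + L) # zig_up m L 1 n"
          by (simp add: zig_up_def upt_rec[of 0] zig_def del: upt_Suc)
        ultimately have W: "W = zig_down L 1 j @ ([L, m + L] @ zig_up m L 1 n)" by (simp add: W_def)
        have "hits t [L, m + L] \<delta>" using LB t k True by (intro hits_two) auto
        then have "hits t W \<delta>" unfolding W by (intro hits_append(2)[OF hits_append(1)])
        then show ?thesis by (auto simp: N_def)
      next
        case False
        then have "\<exists>q\<in>set (singles m x a). hits t q \<delta>"
          using hits_singles[of m x a t \<delta> k] Bxat dis(4) LB k by auto
        then show ?thesis by (auto simp: N_def)
      qed
    qed
  qed
  then show ?thesis by blast
qed

text \<open>Here the difference \<open>t div 2\<close> replaces the difference \<open>t div 2 + j\<close> of one of the singles.\<close>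
lemma path_system_replace:
  assumes t: "t = 2 * m" and s: "s = 2 * c" "4 \<le> s" and a: "even a" "a < c" and n: "L + 1 + a div 2 = m" "n + c = Suc L"
    and j: "0 < j" "2 * j \<le> a"
  shows "\<exists>N. path_system s t a (near t (c - 1) \<union> {m + j}) N"
proof -
  define x where "x = (n + 1) div 2"
  have nL: "n \<le> L" "L - n = c - 1" and LB: "L + 1 < m" using n s a(1) j by (auto elim!: evenE)
  have aL: "a \<le> L - n" and LB': "L < m" using nL a LB by simp_all
  note dis = zig_singles_disjoint[OF nL(1) x_def aL LB']
  have Bxat: "m + x + a \<le> t" using dis(4) LB t by simp
  \<comment> \<open>For even \<open>a\<close> the single with index \<open>j - 1\<close> has offset
    \<open>j\<close>, hence difference \<open>m + j\<close>.\<close>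
  define r where "r = singles m x a ! (j - 1)"
  have j1: "j - 1 < a" using j by simp
  have "r = [x + (j - 1), m + x + tau a (j - 1)]" using j1 by (simp add: r_def singles_def)
  moreover have "tau a (j - 1) = 2 * (j - 1) + 1" using j a(1) by (simp add: tau_def)
  ultimately have r: "r = [x + (j - 1), m + x + (2 * (j - 1) + 1)]" by simp
  obtain P Q where PQ: "singles m x a = P @ r # Q"
    using split_list[of r "singles m x a"] j1 unfolding r_def by auto
  \<comment> \<open>The vertices \<open>L + 1\<close> and \<open>m + (L + 1)\<close> lie just above
    the two zigzags and below the end of their halves: \<open>j > 0\<close> forces
    \<open>a \<ge> 2\<close>, hence \<open>L + 1 < m\<close>.\<close>
  define N where "N = [L + 1, m + (L + 1)] # (P @ Q) @ [zig_down L 0 n, zig_up m L 0 n]"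
  have N: "concat N = [L + 1, m + (L + 1)] @ concat (P @ Q) @ zig_down L 0 n @ zig_up m L 0 n"
    by (simp add: N_def)
  have PQs: "set (concat (P @ Q)) \<subseteq> set (concat (singles m x a))" by (auto simp: PQ)
  have lt: "zig L i < t" "m + zig L i < t" if "i \<le> n" for i
    using zig_le[of i L] that nL LB t by auto
  have "path_system s t a (near t (c - 1) \<union> {m + j}) N"
    unfolding path_system_def
  proof (intro conjI allI impI)
    show "[] \<notin> set N"
      using singles_pairs[of "[]" m x a] by (auto simp: N_def zig_down_def zig_up_def PQ)
    have "distinct (concat (singles m x a))" using dis(4) LB by (intro distinct_singles) simp
    then have "distinct (concat (P @ Q))" by (auto simp: PQ)
    moreover have "set [L + 1, m + (L + 1)] \<inter> set (zig_down L 0 n) = {}"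
      "set [L + 1, m + (L + 1)] \<inter> set (zig_up m L 0 n) = {}"
    proof -
      have *: "zig L i < L + 1" if "i \<le> n" for i using zig_le[of i L] that nL by simp
      show "set [L + 1, m + (L + 1)] \<inter> set (zig_down L 0 n) = {}"
        using * by (force simp: set_zig_down)
      have "m \<le> y \<and> y < m + (L + 1)" if "y \<in> set (zig_up m L 0 n)" for y
        using that * by (auto simp: set_zig_up)
      then show "set [L + 1, m + (L + 1)] \<inter> set (zig_up m L 0 n) = {}"
        using LB by fastforce
    qed
    moreover have "set [L + 1, m + (L + 1)] \<inter> set (concat (singles m x a)) = {}"
    proof -
      have "L + 1 \<notin> {x..<x + a} \<union> {m + x..<m + x + a}" "m + (L + 1) \<notin> {x..<x + a} \<union> {m + x..<m + x + a}"
        using dis(4) LB by auto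
      then show ?thesis using set_singles[of m x a] by auto
    qed
    moreover have "distinct [L + 1, m + (L + 1)]" using LB by simp
    ultimately show "distinct (concat N)"
      unfolding N distinct_append set_append
      using PQs dis(1-3) distinct_zig_down[OF nL(1)] distinct_zig_up[OF nL(1)] by blast
    have "set (zig_down L 0 n) \<subseteq> {..<t}" using lt by (auto simp: set_zig_down)
    moreover have "set (zig_up m L 0 n) \<subseteq> {..<t}" using lt by (auto simp: set_zig_up)
    moreover have "{x..<x + a} \<union> {m + x..<m + x + a} \<subseteq> {..<t}" using Bxat by auto
    moreover have "set [L + 1, m + (L + 1)] \<subseteq> {..<t}" using LB t by auto
    ultimately show "set (concat N) \<subseteq> {..<t}"
      unfolding N set_append using set_singles[of m x a] PQs by blast
    have len: "length (P @ Q) + 1 = a" using arg_cong[OF PQ, of length] by simp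
    then show "a \<le> length N" by (simp add: N_def)
    show "length (N ! i) = 2" if i: "i < a" for i
    proof (cases i)
      case (Suc k)
      then have k: "k < length (P @ Q)" using i len by simp
      have "(P @ Q) ! k \<in> set (singles m x a)" using nth_mem[OF k] by (auto simp: PQ)
      then have "length ((P @ Q) ! k) = 2" by (rule singles_pairs)
      moreover have "N ! i = (P @ Q) ! k" using k unfolding N_def Suc nth_Cons_Suc nth_append[of "P @ Q"] by simp
      ultimately show ?thesis by simp
    qed (simp add: N_def)
    have "length (concat (P @ Q)) + 2 = 2 * a"
      using length_concat_singles[of m x a] by (simp add: PQ r)
    moreover have "a + 2 * n = t - s" using n t s a(1) by (auto elim!: evenE)
    ultimately show "length (concat N) = t - s + length N"
      unfolding N using len by (simp add: N_def)
    show "2 * length N \<le> s + 3 * a"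
      using s len by (simp add: N_def)
    fix \<delta> assume d: "0 < \<delta>" "\<delta> < t" "\<delta> \<notin> near t (c - 1) \<union> {m + j}"
    then have cd: "c \<le> \<delta>" "\<delta> + c \<le> t" using not_near_cases[of \<delta> t c] s by auto
    have Lt: "L < t" using LB t by linarith
    have zz: "\<exists>q\<in>set N. hits t q \<delta>" if "i < n" "\<delta> = L - i \<or> \<delta> = t - (L - i)" for i
    proof -
      have "hits t (zig_down L 0 n) \<delta> \<or> hits t (zig_up m L 0 n) \<delta>"
        using hits_zig_down[of 0 i n L t] hits_zig_up[of 0 i n L m t] lt that nL Lt
        by (cases "even i") auto
      then show ?thesis by (auto simp: N_def)
    qed
    consider "\<delta> \<le> L" | "t - L \<le> \<delta>" | "L < \<delta>" "\<delta> < t - L" by linarith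
    then show "\<exists>q\<in>set N. hits t q \<delta>"
    proof cases
      case 1
      then show ?thesis using zz[of "L - \<delta>"] cd s n by simp
    next
      case 2
      then show ?thesis using zz[of "L - (t - \<delta>)"] cd d s n by simp
    next
      case 3
      define k where "k = (if \<delta> \<ge> m then \<delta> - m else m - \<delta>)"
      have k: "2 * k \<le> a" "\<delta> = m + k \<or> \<delta> + k = m"
        using 3 n t unfolding k_def by auto
      show ?thesis
      proof (cases "k = 0")
        case True
        have "hits t [L + 1, m + (L + 1)] \<delta>" using LB t k True by (intro hits_two) auto
        then show ?thesis by (auto simp: N_def)
      next
        case False
        then obtain q where q: "q \<in> set (singles m x a)" "hits t q \<delta>"
          using hits_singles[of m x a t \<delta> k] Bxat dis(4) LB k by auto
        have "\<not> hits t r \<delta>"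
        proof
          assume "hits t r \<delta>"
          then have h: "(x + (j - 1) + \<delta>) mod t = m + x + (2 * (j - 1) + 1)" by (auto simp: hits_def r)
          have "x + (j - 1) < t" using Bxat j by simp
          moreover have "u mod t = u \<or> u mod t + t = u" if "u < t + t" for u
            using that by (cases "u < t") (auto simp: le_mod_geq)
          ultimately have "(x + (j - 1) + \<delta>) mod t = x + (j - 1) + \<delta> \<or> (x + (j - 1) + \<delta>) mod t + t = x + (j - 1) + \<delta>"
            using d(2) by simp
          then have "\<delta> = m + j" using h d(2) j by linarith
          then show False using d(3) by simp
        qed
        then have "q \<in> set (P @ Q)" using q PQ by auto
        then show ?thesis using q(2) by (auto simp: N_def)
      qed
    qed
  qed
  then show ?thesis by blast
qed

text \<open>A digon realises both signs of a difference, so one zigzag step per length suffices,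
  provided that the steps are made vertex-disjoint.\<close>

lemma digon_system_zigzags:
  assumes t: "t = 2 * m" and a: "even (s + a)" "3 * a \<le> s" "a + s \<le> t" and s: "s > 0" "s < t"
  defines "R \<equiv> near t ((s - 1) div 2) \<union> (if even s then {m} else {})"
  shows "\<exists>N D. digon_system s t a R N D"
proof -
  define c where "c = (s + 1) div 2"
  define b where "b = a div 2"
  define L where "L = m - 1 - b"
  define n where "n = Suc L - c"
  define x where "x = (n + 1) div 2"
  consider "s = 2 * c" "a = 2 * b" | "s + 1 = 2 * c" "a = 2 * b + 1"
    using a(1) by (cases "even s") (auto simp: c_def b_def elim!: evenE oddE)
  then have c: "c > 0" "(s - 1) div 2 = c - 1" and ac: "a \<le> c - 1" and L: "L + 1 + b = m"
    and cL: "c \<le> Suc L" and ab: "2 * b \<le> a" "a \<le> 2 * b + 1" and ts: "a + 2 * (Suc L - c) = t - s"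
    using a s t unfolding L_def by (cases; auto)+
  have n: "n \<le> L" "L - n = c - 1" and LB: "L < m" using c cL L by (auto simp: n_def)
  note dis = zig_singles_disjoint[OF n(1) x_def ac[folded n(2)] LB]
  have Bxat: "m + x + a \<le> t" using dis(4) LB t by simp
  \<comment> \<open>Even steps go to the lower half and odd steps to the upper half. Consecutive
    steps, which share a zigzag value, are thereby separated.\<close>
  define e where "e i = (if even i then 0 else m)" for i :: nat
  define f where "f i = e i + zig L i" for i
  define g where "g i = e i + zig L (Suc i)" for i
  define N where "N = singles m x a"
  define D where "D = map (\<lambda>i. [f i, g i]) [0..<n]"
  have z: "i = j" if "e k + zig L i = e l + zig L j" "i \<le> n" "j \<le> n" for i j k l
  proof -
    have "zig L i < m" "zig L j < m" using that n LB zig_le[of i L] zig_le[of j L] by auto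
    then have "zig L i = zig L j" using that(1) by (auto simp: e_def split: if_splits)
    then show ?thesis using inj_onD[OF zig_inj, of L i j] that n by auto
  qed
  have no: "f i \<noteq> g j" if "i < n" "j < n" for i j
  proof
    assume eq: "f i = g j"
    then have "i = Suc j" using z[of i i j "Suc j"] that by (simp add: f_def g_def)
    then show False using eq L by (auto simp: f_def g_def e_def split: if_splits)
  qed
  have sub: "set (concat D) \<subseteq> set (zig_down L 0 n) \<union> set (zig_up m L 0 n)"
  proof -
    have "e k + zig L i \<in> set (zig_down L 0 n) \<union> set (zig_up m L 0 n)" if "i \<le> n" for k i
      using that by (auto simp: e_def set_zig_down set_zig_up)
    then have "f i \<in> set (zig_down L 0 n) \<union> set (zig_up m L 0 n)" "g i \<in> set (zig_down L 0 n) \<union> set (zig_up m L 0 n)"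
      if "i < n" for i
      using that unfolding f_def g_def by simp_all
    then show ?thesis unfolding D_def set_concat_pairs by fastforce
  qed
  have dD: "distinct (concat D)"
  proof -
    have "inj_on f {0..<n}" using z by (intro inj_onI) (auto simp: f_def)
    moreover have "inj_on g {0..<n}" using z[of _ "Suc _" _ "Suc _"] by (intro inj_onI) (fastforce simp: g_def)
    ultimately show ?thesis unfolding D_def using no by (intro distinct_concat_pairs) auto
  qed
  have "digon_system s t a R N D"
    unfolding digon_system_def
  proof (intro conjI allI impI)
    show "\<forall>q\<in>set N. length q = 2" "\<forall>q\<in>set D. length q = 2"
      using singles_pairs by (auto simp: N_def D_def)
    have "distinct (concat N)" unfolding N_def using dis(4) LB by (intro distinct_singles) simp
    then show "distinct (concat (N @ D))"
      unfolding concat_append distinct_append using dD sub dis(1,2) unfolding N_def by blast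
    have lt: "zig L i < t" "m + zig L i < t" if "i \<le> n" for i
      using zig_le[of i L] that n LB t by auto
    have "set (zig_down L 0 n) \<union> set (zig_up m L 0 n) \<subseteq> {..<t}"
      using lt by (auto simp: set_zig_down set_zig_up)
    moreover have "{x..<x + a} \<union> {m + x..<m + x + a} \<subseteq> {..<t}" using Bxat by auto
    ultimately show "set (concat (N @ D)) \<subseteq> {..<t}"
      unfolding concat_append set_append using set_singles[of m x a] sub unfolding N_def by blast
    show "length N = a" by (simp add: N_def)
    show "a + 2 * length D = t - s" using ts by (simp add: D_def n_def)
    fix \<delta> assume d: "0 < \<delta>" "\<delta> < t" "\<delta> \<notin> R"
    then have cd: "c \<le> \<delta>" "\<delta> + c \<le> t" using not_near_cases[of \<delta> t c] c by (auto simp: R_def)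
    have dig: "\<exists>q\<in>set D. hits t q \<delta> \<or> hits t (rev q) \<delta>" if i: "i < n" "\<delta> = L - i \<or> \<delta> = t - (L - i)" for i
    proof -
      have lt: "f i < t" "g i < t"
        using zig_le[of i L] zig_le[of "Suc i" L] i n LB t by (auto simp: f_def g_def e_def)
      have "f i + (L - i) = g i \<or> g i + (L - i) = f i"
      proof (cases "even i")
        case True
        then show ?thesis unfolding f_def g_def using zig_step_even[of i L] i(1) n(1) by linarith
      next
        case False
        then show ?thesis unfolding f_def g_def using zig_step_odd[of i L] i(1) n(1) by linarith
      qed
      then have "hits t [f i, g i] \<delta> \<or> hits t [g i, f i] \<delta>"
      proof
        assume *: "f i + (L - i) = g i"
        then show ?thesis
          using i(2) hits_forward[of "f i" "g i" "[f i, g i]", OF _ * lt(2)]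
            hits_backward[of "g i" "f i" "[g i, f i]", OF _ * lt(2)] by auto
      next
        assume *: "g i + (L - i) = f i"
        then show ?thesis
          using i(2) hits_forward[of "g i" "f i" "[g i, f i]", OF _ * lt(1)]
            hits_backward[of "f i" "g i" "[f i, g i]", OF _ * lt(1)] by auto
      qed
      moreover have "[f i, g i] \<in> set D" using i(1) by (simp add: D_def)
      moreover have "rev [f i, g i] = [g i, f i]" by simp
      ultimately show ?thesis by metis
    qed
    consider "\<delta> \<le> L" | "t - L \<le> \<delta>" | "L < \<delta>" "\<delta> < t - L" by linarith
    then show "(\<exists>q\<in>set N. hits t q \<delta>) \<or> (\<exists>q\<in>set D. hits t q \<delta> \<or> hits t (rev q) \<delta>)"
    proof cases
      case 1
      then show ?thesis using dig[of "L - \<delta>"] cd c by (simp add: n_def)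
    next
      case 2
      then show ?thesis using dig[of "L - (t - \<delta>)"] cd c d by (simp add: n_def)
    next
      case 3
      define k where "k = (if \<delta> \<ge> m then \<delta> - m else m - \<delta>)"
      have "2 * k \<le> a" "\<delta> = m + k \<or> \<delta> + k = m"
        using 3 L t ab unfolding k_def by auto
      moreover have "even a \<longrightarrow> k > 0"
        using d(3) a(1) by (auto simp: k_def R_def)
      ultimately show ?thesis
        unfolding N_def using hits_singles[of m x a t \<delta> k] Bxat dis(4) LB by auto
    qed
  qed
  then show ?thesis by blast
qed

section \<open>Choice of the missing differences\<close>

lemma covers_near_unit:
  assumes "coprime q t" "2 * p < t"
  shows "covers [t] {..<t} (2 * p + 1) (circ t (near t p \<union> {q}))"
  unfolding circ_Un using assms by (intro covers_Un covers_near covers_unit) auto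

text \<open>Twice this number is 1 modulo \<open>t\<close>, so it is a unit.\<close>

lemma coprime_Suc_half:
  assumes "odd (t :: nat)"
  shows "coprime ((t + 1) div 2) t"
proof (rule coprimeI)
  fix d assume d: "d dvd (t + 1) div 2" "d dvd t"
  have "2 * ((t + 1) div 2) = t + 1" using assms by simp
  then have "d dvd t + 1" using d(1) by (metis dvd_mult)
  then show "is_unit d" using d(2) dvd_diff_nat[of d "t + 1" t] by simp
qed

lemma path_system_exists:
  assumes a: "even (s + a)" "3 * a \<le> s" "a + s \<le> 2 * (t div 2)" and s: "2 \<le> s" "s < t"
  shows "\<exists>R N. covers [t] {..<t} (s - 1) (circ t R) \<and> path_system s t a R N"
proof -
  have at: "a + s \<le> t" using a(3) by linarith
  consider "odd s" | "even s" "odd t" "4 \<le> s + a" | "even s" "odd t" "s + a < 4" | "even s" "even t" by linarith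
  then show ?thesis
  proof cases
    case 1
    then have "odd a" using a(1) by simp
    then have sa: "s \<ge> 3" "a > 0" using a(2) s by (auto elim!: oddE)
    obtain N where "path_system s t a (near t ((s - 1) div 2) \<union> (if even s then {(t + 1) div 2} else {})) N"
      using path_system_two_zigzags[of s a t] a at sa s 1 by auto
    moreover have "covers [t] {..<t} (s - 1) (circ t (near t ((s - 1) div 2)))"
      using covers_near[of "(s - 1) div 2" t] 1 s by simp
    ultimately show ?thesis using 1 by auto
  next
    case 2
    obtain N where N: "path_system s t a (near t ((s - 1) div 2) \<union> (if even s then {(t + 1) div 2} else {})) N"
      using path_system_two_zigzags[of s a t] a at s 2 by auto
    have "covers [t] {..<t} (2 * ((s - 1) div 2) + 1) (circ t (near t ((s - 1) div 2) \<union> {(t + 1) div 2}))"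
      using s 2 by (intro covers_near_unit coprime_Suc_half) auto
    moreover have "2 * ((s - 1) div 2) + 1 = s - 1" using 2 s by (auto elim!: evenE)
    moreover have "(if even s then {(t + 1) div 2} else {}) = {(t + 1) div 2}" using 2 by simp
    ultimately show ?thesis using N by metis
  next
    case 3
    then have sa: "s = 2" "a = 0" using s a(1,2) by (auto elim!: evenE)
    have "covers [t] {..<t} 1 (circ t {(t + 1) div 2})"
      using s 3 by (intro covers_unit coprime_Suc_half) auto
    then show ?thesis using path_system_two[of t] 3 s sa by auto
  next
    case 4
    obtain m c b where mcb: "t = 2 * m" "s = 2 * c" "a = 2 * b" using 4 a(1) by (auto elim!: evenE)
    have le: "3 * b \<le> c" "b + c \<le> m" "0 < c" "c < m" using a s mcb by auto
    \<comment> \<open>A common divisor of \<open>q\<close> and \<open>2 * m\<close> divides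
      \<open>2 * i\<close>; being odd, it divides \<open>i\<close>, which is 1 or 2.\<close>
    have cop: "coprime q t" if "odd q" "q + i = m \<or> q = m + i" "i = 1 \<or> i = 2" for q i
    proof (rule coprimeI)
      fix d assume d: "d dvd q" "d dvd t"
      have "2 * q + 2 * i = t \<or> 2 * q = t + 2 * i" using that(2) mcb by auto
      then have "d dvd 2 * i" using d by (metis dvd_add_right_iff dvd_mult)
      moreover have "coprime d 2" using d(1) that(1) by (metis coprime_right_2_iff_odd dvd_trans)
      ultimately have "d dvd i" by (simp add: coprime_dvd_mult_right_iff)
      then have "d dvd 2" using that(3) by auto
      then show "is_unit d" using \<open>coprime d 2\<close> by (metis coprime_absorb_left)
    qed
    have unit: "\<exists>R N. covers [t] {..<t} (s - 1) (circ t R) \<and> path_system s t a R N"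
      if "path_system s t a (near t (c - 1) \<union> {q}) N" "coprime q t" for q N
    proof -
      have "covers [t] {..<t} (2 * (c - 1) + 1) (circ t (near t (c - 1) \<union> {q}))"
        using that(2) le mcb by (intro covers_near_unit) auto
      moreover have "2 * (c - 1) + 1 = s - 1" using le mcb by simp
      ultimately show ?thesis using that(1) by metis
    qed
    have cut: "\<exists>N. path_system s t a (near t (c - 1) \<union> {if even j then L - j else t - (L - j)}) N"
      if "L + 1 + b = m" "j + c < Suc L" "c = 1 \<Longrightarrow> Suc j + c = Suc L" for L j
      using that mcb le by (intro path_system_cut[where m = m and n = "Suc L - c"]) auto
    \<comment> \<open>A cut at step \<open>j\<close> omits \<open>L - j\<close> or its negative, and
      a replacement omits \<open>m + j\<close>. For \<open>c = 1\<close> the omitted difference is 1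
      or \<open>- 1\<close>; otherwise the target is an odd number at distance 1 or 2 from
      \<open>m\<close>. For odd \<open>m = c + 1\<close> and \<open>b \<le> 1\<close> the zigzags
      have \<open>1 - b\<close> steps and only the even numbers \<open>m - 1\<close> and
      \<open>m + 1\<close> could be omitted, which makes this the exceptional case.\<close>
    consider "c = 1" | "c > 1" "b = 0" "even m" | "c > 1" "b = 0" "odd m" "c + 2 \<le> m"
      | "c > 1" "b = 1" "odd m" "c + 2 \<le> m" | "c > 1" "b \<le> 1" "odd m" "m = c + 1"
      | "b \<ge> 1" "even m" | "b \<ge> 2" "odd m"
      using le by linarith
    then show ?thesis
    proof cases
      case 1
      then have "b = 0" using le by simp
      have "coprime (if even (m - 2) then m - 1 - (m - 2) else t - (m - 1 - (m - 2))) t"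
      proof -
        have "m - 1 - (m - 2) = 1" using le by simp
        then show ?thesis using coprime_diff_one_left_nat[of t] s(2) by (cases "even (m - 2)") simp_all
      qed
      moreover obtain N where "path_system s t a (near t (c - 1) \<union>
          {if even (m - 2) then m - 1 - (m - 2) else t - (m - 1 - (m - 2))}) N"
      proof -
        have "m - 1 + 1 + b = m" "m - 2 + c < Suc (m - 1)" "Suc (m - 2) + c = Suc (m - 1)"
          using le 1 \<open>b = 0\<close> by simp_all
        then show thesis using cut[of "m - 1" "m - 2"] that by blast
      qed
      ultimately show ?thesis using unit by blast
    next
      case 2
      obtain N where "path_system s t a (near t (c - 1) \<union> {m - 1}) N"
        using cut[of "m - 1" 0] le 2 by auto
      then show ?thesis using unit cop[of "m - 1" 1] le 2 by auto
    next
      case 3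
      obtain N where "path_system s t a (near t (c - 1) \<union> {t - (m - 1 - 1)}) N"
        using cut[of "m - 1" 1] le 3 by auto
      moreover have "t - (m - 1 - 1) = m + 2" using le 3 mcb by auto
      ultimately show ?thesis using unit cop[of "m + 2" 2] 3 by auto
    next
      case 4
      obtain N where "path_system s t a (near t (c - 1) \<union> {m - 2}) N"
      proof -
        have "m - 2 + 1 + b = m" "0 + c < Suc (m - 2)" "c \<noteq> 1" using 4 by simp_all
        then show thesis using cut[of "m - 2" 0] that by auto
      qed
      moreover have "coprime (m - 2) t" using 4 by (intro cop[of "m - 2" 2]) auto
      ultimately show ?thesis using unit by blast
    next
      case 5
      then obtain N where "path_system (t - 2) t a ({1..<t} - {m - 1, m + 1}) N"
        using path_system_all_but_middle[of t m a] mcb by auto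
      moreover have "covers [t] {..<t} (t - 3) (circ t ({1..<t} - {m - 1, m + 1}))"
        using covers_all_but_middle[of m t] 5 mcb by auto
      moreover have "s = t - 2" "s - 1 = t - 3" using 5 mcb by auto
      ultimately show ?thesis by metis
    next
      case 6
      obtain N where "path_system s t a (near t (c - 1) \<union> {m + 1}) N"
      proof -
        have "4 \<le> s" "even a" "a < c" "m - 1 - b + 1 + a div 2 = m" "m - b - c + c = Suc (m - 1 - b)" "2 * 1 \<le> a"
          using le mcb 6 by simp_all
        then show thesis
          using path_system_replace[of t m s c a "m - 1 - b" "m - b - c" 1] mcb that by auto
      qed
      then show ?thesis using unit cop[of "m + 1" 1] 6 by auto
    next
      case 7
      obtain N where "path_system s t a (near t (c - 1) \<union> {m + 2}) N"
      proof -
        have "4 \<le> s" "even a" "a < c" "m - 1 - b + 1 + a div 2 = m" "m - b - c + c = Suc (m - 1 - b)" "2 * 2 \<le> a"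
          using le mcb 7 by simp_all
        then show thesis
          using path_system_replace[of t m s c a "m - 1 - b" "m - b - c" 2] mcb that by auto
      qed
      then show ?thesis using unit cop[of "m + 2" 2] 7 by auto
    qed
  qed
qed

theorem theorem1p6:
  fixes ms :: "nat list" and s t a :: nat
  assumes "ms \<noteq> []"
    and "\<forall>m\<in>set ms. m \<ge> 2"
    and "s = sum_list ms"
    and "t > s"
    and "a = length (filter odd ms)"
    and "int a \<le> 2 * int (t div 2) - int s"
    and "OP_star_has_solution ms"
  shows "OP_star_has_solution (ms @ [t]) \<and>
    (even t \<longrightarrow> OP_star_has_solution (ms @ replicate (t div 2) 2))"
proof -
  \<comment> \<open>An odd length is 3 plus an even number; this identity yields both
    \<open>3 * a \<le> s\<close> and the parity of \<open>s + a\<close>.\<close>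
  have eq: "2 * need ms + 3 * a = s" using need_eq[OF assms(2)] assms(3,5) by simp
  have "even (s + a)" unfolding eq[symmetric] by simp
  moreover have "3 * a \<le> s" using eq by simp
  moreover have "a + s \<le> 2 * (t div 2)" using assms(6) by linarith
  moreover have "s \<ge> 2" using assms(1-3) by (cases ms) auto
  ultimately have a: "even (s + a)" "3 * a \<le> s" "a + s \<le> 2 * (t div 2)" "2 \<le> s" .
  obtain R N where "covers [t] {..<t} (s - 1) (circ t R)" "path_system s t a R N"
    using path_system_exists[OF a assms(4)] by blast
  then have long: "OP_star_has_solution (ms @ [t])"
    by (rule OP_star_long[OF assms(2,1,3,5,4,7)])
  have "OP_star_has_solution (ms @ replicate (t div 2) 2)" if t: "even t"
  proof -
    define m where "m = t div 2"
    define p where "p = (s - 1) div 2"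
    have m: "t = 2 * m" "m > 0" using t a(4) assms(4) by (auto simp: m_def)
    obtain N D where ND: "digon_system s t a (near t p \<union> (if even s then {m} else {})) N D"
      using digon_system_zigzags[OF m(1) a(1,2) _ _ assms(4)] a m unfolding p_def by auto
    have near: "covers (replicate (t div 2) 2) {..<t} (2 * p) (circ t (near t p))"
      using t assms(4) by (intro digon_covers_near) (auto simp: p_def)
    have "covers (replicate (t div 2) 2) {..<t} (s - 1) (circ t (near t p \<union> (if even s then {m} else {})))"
    proof (cases "even s")
      case True
      then have "2 * p + 1 = s - 1" using a(4) by (auto simp: p_def elim!: evenE)
      moreover have "covers (replicate (t div 2) 2) {..<t} (2 * p + 1) (circ t (near t p \<union> {m}))"
        unfolding circ_Un by (rule covers_Un[OF near digon_covers_middle[OF m]])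
      ultimately show ?thesis using True by simp
    next
      case False
      then have "2 * p = s - 1" by (simp add: p_def)
      then show ?thesis using near False by simp
    qed
    then show ?thesis by (rule OP_star_digons[OF assms(2,1,3,5,4) t assms(7) _ ND])
  qed
  then show ?thesis using long by blast
qed

end
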